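(* Let $M$ be the origami associated to the data $(G,g_r,g_u,H)$, and let $N$ be the normalizer of $H$ in $G$. Then $M$ is quasiregular if and only if $N$ is a normal subgroup of $G$ and the quotient group $G/N$ is abelian.
   Context: An origami is a ramified covering $\pi:M\to \mathbf{T}^2=\mathbf{R}^2/\mathbf{Z}^2$ from a compact connected surface, unramified outside $0\in\mathbf{T}^2$. Its squares are the connected components of $\pi^{-1}((0,1)^2)$. $\mathrm{Aut}(M)$ is the group of homeomorphisms $f$ of $M$ with $\pi\circ f=\pi$. Data $(G,g_r,g_u,H)$: $G$ is a finite group generated by $g_r,g_u$, and $H$ is a subgroup of $G$ containing no normal subgroup of $G$ other than the trivial one. The associated origami $M$ has as squares the right cosets $Hg\in H\backslash G$, the square to the right of $Hg$ being $Hgg_r$ and the square above $Hg$ being $Hgg_u$. If $N$ is the normalizer of $H$ in $G$, then $\mathrm{Aut}(M)$ is canonically identified with $N/H$, the class of $n\in N$ acting on squares by $Hg\mapsto Hng$. $H_1^{(0)}(M,\mathbf{C})$ is the kernel of $\pi_*:H_1(M,\mathbf{C})\to H_1(\mathbf{T}^2,\mathbf{C})$. The origami $M$ is called quasiregular if the trivial representation of $\mathrm{Aut}(M)$ has multiplicity $0$ in $H_1^{(0)}(M,\mathbf{C})$. *)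

theory Defs
  imports "HOL-Homology.Homology" "HOL-Algebra.Group_Action" "HOL-Algebra.Generated_Groups"
    "HOL-Algebra.Module" "HOL-Library.Extended_Nat"
begin

section \<open>Quotient spaces\<close>

definition quotient_top :: "'a topology \<Rightarrow> ('a \<times> 'a) set \<Rightarrow> 'a set topology" where
  "quotient_top X E =
     topology (\<lambda>U. U \<subseteq> topspace X // E \<and> openin X {x \<in> topspace X. E `` {x} \<in> U})"

lemma openin_quotient_top:
  "openin (quotient_top X E) U \<longleftrightarrow>
     U \<subseteq> topspace X // E \<and> openin X {x \<in> topspace X. E `` {x} \<in> U}"
proof -
  let ?P = "\<lambda>U. {x \<in> topspace X. E `` {x} \<in> U}"
  have "istopology (\<lambda>U. U \<subseteq> topspace X // E \<and> openin X (?P U))"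
    unfolding istopology_def
  proof (intro conjI allI impI; (elim conjE)?)
    fix S T
    assume "openin X (?P S)" "openin X (?P T)"
    moreover have "?P (S \<inter> T) = ?P S \<inter> ?P T" by auto
    ultimately show "openin X (?P (S \<inter> T))" by auto
  next
    fix K assume K: "\<forall>S\<in>K. S \<subseteq> topspace X // E \<and> openin X (?P S)"
    then have "openin X (\<Union>(?P ` K))" by blast
    moreover have "?P (\<Union>K) = \<Union>(?P ` K)" by auto
    ultimately show "openin X (?P (\<Union>K))" by simp
    show "\<Union>K \<subseteq> topspace X // E" using K by blast
  qed blast
  then show ?thesis
    by (simp add: quotient_top_def topology_inverse')
qed

lemma topspace_quotient_top: "topspace (quotient_top X E) = topspace X // E"
proof
  show "topspace (quotient_top X E) \<subseteq> topspace X // E"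
    using openin_quotient_top openin_topspace by blast
  have "{x \<in> topspace X. E `` {x} \<in> topspace X // E} = topspace X"
    by (auto intro: quotientI)
  then show "topspace X // E \<subseteq> topspace (quotient_top X E)"
    by (intro openin_subset) (simp add: openin_quotient_top)
qed

lemma quotient_map_quotient_top:
  "quotient_map X (quotient_top X E) (\<lambda>x. E `` {x})"
  by (auto simp: quotient_map_def topspace_quotient_top openin_quotient_top quotient_def)

section \<open>Origamis\<close>

definition lattice_rel :: "((real \<times> real) \<times> (real \<times> real)) set" where
  "lattice_rel = {(v, w). fst w - fst v \<in> \<int> \<and> snd w - snd v \<in> \<int>}"

definition torus :: "(real \<times> real) set topology" where
  "torus = quotient_top euclidean lattice_rel"

text \<open>
  \<open>S\<close> is the set of squares, \<open>r s\<close> the square to the right of \<open>s\<close> and \<open>u s\<close> the square above \<open>s\<close>.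
  The surface is obtained from the closed squares \<open>{s} \<times> [0,1]\<^sup>2\<close> by gluing the right side of
  each \<open>s\<close> to the left side of \<open>r s\<close> and the top side of \<open>s\<close> to the bottom side of \<open>u s\<close>.
\<close>
definition squares_top :: "'s set \<Rightarrow> ('s \<times> (real \<times> real)) topology" where
  "squares_top S = prod_topology (discrete_topology S) (top_of_set ({0..1} \<times> {0..1}))"

definition side_gluing ::
    "'s set \<Rightarrow> ('s \<Rightarrow> 's) \<Rightarrow> ('s \<Rightarrow> 's)
      \<Rightarrow> (('s \<times> (real \<times> real)) \<times> ('s \<times> (real \<times> real))) set" where
  "side_gluing S r u =
     {((s, (1, t)), (r s, (0, t))) | s t. s \<in> S \<and> t \<in> {0..1}} \<union>
     {((s, (t, 1)), (u s, (t, 0))) | s t. s \<in> S \<and> t \<in> {0..1}}"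

definition square_tiled ::
    "'s set \<Rightarrow> ('s \<Rightarrow> 's) \<Rightarrow> ('s \<Rightarrow> 's) \<Rightarrow> ('s \<times> (real \<times> real)) set topology" where
  "square_tiled S r u =
     quotient_top (squares_top S) ((side_gluing S r u \<union> (side_gluing S r u)\<inverse>)\<^sup>*)"

text \<open>The point of the torus below a point of the surface: the class of \<open>(s, v)\<close> goes to \<open>v + \<int>\<^sup>2\<close>.\<close>
definition origami_proj :: "('s \<times> (real \<times> real)) set \<Rightarrow> (real \<times> real) set" where
  "origami_proj P = lattice_rel `` (snd ` P)"

definition origami ::
    "('g, 'b) monoid_scheme \<Rightarrow> 'g \<Rightarrow> 'g \<Rightarrow> 'g set \<Rightarrow> ('g set \<times> (real \<times> real)) set topology" where
  "origami G gr gu H =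
     square_tiled (rcosets\<^bsub>G\<^esub> H) (\<lambda>A. A #>\<^bsub>G\<^esub> gr) (\<lambda>A. A #>\<^bsub>G\<^esub> gu)"

text \<open>
  Homeomorphisms are normalised to be \<open>undefined\<close> off the surface, so that each automorphism is
  represented by exactly one HOL function.
\<close>
definition origami_aut ::
    "('s \<times> (real \<times> real)) set topology
      \<Rightarrow> (('s \<times> (real \<times> real)) set \<Rightarrow> ('s \<times> (real \<times> real)) set) set" where
  "origami_aut M = {f \<in> extensional (topspace M).
     homeomorphic_map M M f \<and> (\<forall>x \<in> topspace M. origami_proj (f x) = origami_proj x)}"

section \<open>Singular homology with complex coefficients\<close>

text \<open>
  HOL-Homology has integer coefficients only; the definitions below repeat its \<open>chain_boundary\<close>,
  \<open>chain_map\<close>, cycles and boundaries over the complex numbers, on the same singular simplices.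
\<close>
type_synonym 'a cchain = "((nat \<Rightarrow> real) \<Rightarrow> 'a) \<Rightarrow>\<^sub>0 complex"

definition cchain_scale :: "complex \<Rightarrow> ('b \<Rightarrow>\<^sub>0 complex) \<Rightarrow> ('b \<Rightarrow>\<^sub>0 complex)" where
  "cchain_scale z c = Poly_Mapping.map ((*) z) c"

definition cchain_extend :: "('b \<Rightarrow> ('a \<Rightarrow>\<^sub>0 complex)) \<Rightarrow> ('b \<Rightarrow>\<^sub>0 complex) \<Rightarrow> ('a \<Rightarrow>\<^sub>0 complex)" where
  "cchain_extend b c =
     (\<Sum>s \<in> Poly_Mapping.keys c. cchain_scale (Poly_Mapping.lookup c s) (b s))"

definition cchain_boundary :: "nat \<Rightarrow> 'a cchain \<Rightarrow> 'a cchain" where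
  "cchain_boundary p c =
     (if p = 0 then 0
      else cchain_extend (\<lambda>s. \<Sum>k\<le>p. Poly_Mapping.single (singular_face p k s) ((-1) ^ k)) c)"

definition cchain_map :: "nat \<Rightarrow> ('a \<Rightarrow> 'b) \<Rightarrow> 'a cchain \<Rightarrow> 'b cchain" where
  "cchain_map p g c = cchain_extend (\<lambda>s. Poly_Mapping.single (simplex_map p g s) 1) c"

definition cchains :: "nat \<Rightarrow> 'a topology \<Rightarrow> 'a cchain set" where
  "cchains p X = {c. Poly_Mapping.keys c \<subseteq> singular_simplex_set p X}"

definition ccycles :: "nat \<Rightarrow> 'a topology \<Rightarrow> 'a cchain set" where
  "ccycles p X = {c \<in> cchains p X. cchain_boundary p c = 0}"

definition cboundaries :: "nat \<Rightarrow> 'a topology \<Rightarrow> 'a cchain set" where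
  "cboundaries p X = cchain_boundary (Suc p) ` cchains (Suc p) X"

text \<open>
  The complex vector space of cosets \<open>c + B\<close>, \<open>B\<close> the boundaries, encoded as a module record;
  its ring fields \<open>mult\<close> and \<open>one\<close> carry no meaning. Adding \<open>B\<close> in \<open>smult\<close> and in
  \<open>chom_induced\<close> matters: the image of a coset need not be a full coset.
\<close>
definition chomology :: "nat \<Rightarrow> 'a topology \<Rightarrow> (complex, 'a cchain set) module" where
  "chomology p X =
     \<lparr>carrier = {{c + b | b. b \<in> cboundaries p X} | c. c \<in> ccycles p X},
      mult = undefined, one = undefined,
      zero = cboundaries p X,
      add = (\<lambda>A B. {a + b | a b. a \<in> A \<and> b \<in> B}),
      smult = (\<lambda>z A. {cchain_scale z a + b | a b. a \<in> A \<and> b \<in> cboundaries p X})\<rparr>"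

definition chom_induced ::
    "nat \<Rightarrow> 'b topology \<Rightarrow> ('a \<Rightarrow> 'b) \<Rightarrow> 'a cchain set \<Rightarrow> 'b cchain set" where
  "chom_induced p Y g A = {cchain_map p g a + b | a b. a \<in> A \<and> b \<in> cboundaries p Y}"

section \<open>Quasiregular origamis\<close>

definition lin_indep_family :: "(complex, 'v) module \<Rightarrow> 'v set \<Rightarrow> bool" where
  "lin_indep_family V B \<longleftrightarrow>
     (\<forall>a. finsum V (\<lambda>v. a v \<odot>\<^bsub>V\<^esub> v) B = \<zero>\<^bsub>V\<^esub> \<longrightarrow> (\<forall>v\<in>B. a v = 0))"

text \<open>
  The multiplicity of the trivial representation is \<open>dim Hom\<^sub>\<Gamma>(1, V) = dim V\<^sup>\<Gamma>\<close>.  The dimension is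
  taken in \<open>enat\<close>, so that it is never a junk value.
\<close>
definition trivial_multiplicity ::
    "'f set \<Rightarrow> ('f \<Rightarrow> 'v \<Rightarrow> 'v) \<Rightarrow> (complex, 'v) module \<Rightarrow> enat" where
  "trivial_multiplicity \<Gamma> \<rho> V =
     (SUP B \<in> {B. finite B \<and> B \<subseteq> {v \<in> carrier V. \<forall>g\<in>\<Gamma>. \<rho> g v = v} \<and> lin_indep_family V B}.
        enat (card B))"

definition H1_0 ::
    "('s \<times> (real \<times> real)) set topology
      \<Rightarrow> (complex, ('s \<times> (real \<times> real)) set cchain set) module" where
  "H1_0 M = (chomology 1 M)
     \<lparr>carrier := {A \<in> carrier (chomology 1 M).
        chom_induced 1 torus origami_proj A = \<zero>\<^bsub>chomology 1 torus\<^esub>}\<rparr>"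

definition quasiregular :: "('s \<times> (real \<times> real)) set topology \<Rightarrow> bool" where
  "quasiregular M \<longleftrightarrow>
     trivial_multiplicity (origami_aut M) (\<lambda>f. chom_induced 1 M f) (H1_0 M) = 0"

end

theory Submission
  imports Defs "HOL-Complex_Analysis.Winding_Numbers"
begin

text \<open>
  Let \<open>\<Gamma>\<close> be the automorphism group of \<open>M\<close>. The invariant part of \<open>H\<^sub>1(M, \<complex>)\<close> is the homology of
  \<open>M/\<Gamma>\<close>, the origami whose squares are the right cosets of \<open>N\<close>. So \<open>M\<close> is quasiregular iff \<open>M/\<Gamma>\<close> has no more homology
  than the torus below it, that is, iff \<open>M/\<Gamma>\<close> has genus one, iff \<open>M/\<Gamma> \<rightarrow> T\<^sup>2\<close> is unramified. Going once
  around a corner acts on these cosets as a commutator of \<open>g\<^sub>r\<close> and \<open>g\<^sub>u\<close>, so this says that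
  right multiplications by \<open>g\<^sub>r\<close> and \<open>g\<^sub>u\<close> commute on the cosets; as \<open>g\<^sub>r\<close> and \<open>g\<^sub>u\<close> generate \<open>G\<close>, this means
  that \<open>N\<close> is normal with abelian quotient (\<open>commuting_iff\<close>, \<open>normal_abelian_iff_commuting_cosets\<close>).

  The proof below never forms \<open>M/\<Gamma>\<close>; it works with invariant chains of edges of squares on \<open>M\<close>
  itself. Three facts link these finite objects with singular homology.

  Upper bound: every singular cycle is homologous to a chain of edges (\<open>cycle_in_edge_classes\<close>). A path
  is cut into pieces that lie in contractible star neighbourhoods; a cone over each piece replaces it
  by straight segments inside squares, and these are pushed to the edges.

  Lower bound: an integral cellular cocycle \<open>(f, g)\<close> is the derivative of a continuous map from \<open>M\<close> to the
  unit circle, bilinear in each square before exponentiation. Winding numbers turn this map into a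
  functional on singular chains that kills boundaries and takes the values \<open>f\<close>, \<open>g\<close> on the edges
  (\<open>edge_chain_boundary_pairing\<close>).

  Automorphisms: each one permutes the squares and commutes with the two gluing maps
  (\<open>origami_aut_permutes\<close>), hence it is left multiplication by an element of the normalizer.

  If the two multiplications commute on the cosets of \<open>N\<close>, an invariant class is represented by an edge chain whose
  coefficients depend only on the coset of \<open>N\<close>. Its boundary vanishes at the lower left corner of each
  square separately, since the squares with this corner at a given vertex all belong to the same coset. Sliding such a chain
  across the squares shows that its class does not change when it is moved one square to the right or up;
  the average over all these translations has constant coefficients, and it is determined by its
  image in the torus. So an invariant class that dies in the torus is zero
  (\<open>invariant_cycle_eq_boundary\<close>).

  If they do not commute, \<open>M/\<Gamma>\<close> has fewer vertices than squares, and a count of equations produces a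
  nonzero integral harmonic cochain on the cosets, simultaneously a cycle and a cocycle, of total weight zero
  (\<open>harmonic_cochain\<close>). It gives an invariant cycle that dies in the torus; its pairing with itself
  as a cocycle is a positive sum of squares, so it is not a boundary
  (\<open>exists_nontrivial_quotient_cycle\<close>).
\<close>

section \<open>Linear algebra of complex chains\<close>

lemma lookup_cchain_scale [simp]:
  "Poly_Mapping.lookup (cchain_scale z c) k = z * Poly_Mapping.lookup c k"
  by (simp add: cchain_scale_def map.rep_eq when_def)

interpretation cchain: vector_space "cchain_scale :: complex \<Rightarrow> ('b \<Rightarrow>\<^sub>0 complex) \<Rightarrow> ('b \<Rightarrow>\<^sub>0 complex)"
  by unfold_locales (auto intro!: poly_mapping_eqI simp: lookup_add algebra_simps)

abbreviation csingle :: "'b \<Rightarrow> ('b \<Rightarrow>\<^sub>0 complex)" where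
  "csingle s \<equiv> Poly_Mapping.single s 1"

abbreviation clinear :: "(('a \<Rightarrow>\<^sub>0 complex) \<Rightarrow> ('b \<Rightarrow>\<^sub>0 complex)) \<Rightarrow> bool" where
  "clinear \<equiv> Vector_Spaces.linear cchain_scale cchain_scale"

definition ceval :: "('b \<Rightarrow> complex) \<Rightarrow> ('b \<Rightarrow>\<^sub>0 complex) \<Rightarrow> complex" where
  "ceval \<phi> c = (\<Sum>s \<in> Poly_Mapping.keys c. Poly_Mapping.lookup c s * \<phi> s)"

lemma cchain_extend_superset:
  assumes "finite K" "Poly_Mapping.keys c \<subseteq> K"
  shows "cchain_extend b c = (\<Sum>s\<in>K. cchain_scale (Poly_Mapping.lookup c s) (b s))"
  unfolding cchain_extend_def
  by (rule sum.mono_neutral_left) (use assms in \<open>auto simp: in_keys_iff\<close>)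

lemma ceval_superset:
  assumes "finite K" "Poly_Mapping.keys c \<subseteq> K"
  shows "ceval \<phi> c = (\<Sum>s\<in>K. Poly_Mapping.lookup c s * \<phi> s)"
  unfolding ceval_def
  by (rule sum.mono_neutral_left) (use assms in \<open>auto simp: in_keys_iff\<close>)

lemma keys_cchain_scale: "Poly_Mapping.keys (cchain_scale z c) \<subseteq> Poly_Mapping.keys c"
  by (auto simp: in_keys_iff)

lemma linear_cchain_extend: "clinear (cchain_extend b)"
proof (intro Vector_Spaces.linear.intro module_hom.intro module_hom_axioms.intro)
  fix x y :: "'a \<Rightarrow>\<^sub>0 complex" and z
  let ?K = "Poly_Mapping.keys x \<union> Poly_Mapping.keys y"
  have "cchain_extend b (x + y) = (\<Sum>s\<in>?K. cchain_scale (Poly_Mapping.lookup (x + y) s) (b s))"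
    by (rule cchain_extend_superset) (use keys_add[of x y] in auto)
  also have "\<dots> = cchain_extend b x + cchain_extend b y"
    by (simp add: cchain_extend_superset[of ?K] lookup_add cchain.scale_left_distrib sum.distrib)
  finally show "cchain_extend b (x + y) = cchain_extend b x + cchain_extend b y" .
  show "cchain_extend b (cchain_scale z x) = cchain_scale z (cchain_extend b x)"
    by (subst cchain_extend_superset[OF _ keys_cchain_scale])
      (simp_all add: cchain_extend_def cchain.scale_sum_right)
qed (unfold_locales)

lemma linear_ceval: "Vector_Spaces.linear cchain_scale (*) (ceval \<phi>)"
proof (intro Vector_Spaces.linear.intro module_hom.intro module_hom_axioms.intro)
  fix x y :: "'a \<Rightarrow>\<^sub>0 complex" and z
  let ?K = "Poly_Mapping.keys x \<union> Poly_Mapping.keys y"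
  have "ceval \<phi> (x + y) = (\<Sum>s\<in>?K. Poly_Mapping.lookup (x + y) s * \<phi> s)"
    by (rule ceval_superset) (use keys_add[of x y] in auto)
  also have "\<dots> = ceval \<phi> x + ceval \<phi> y"
    by (simp add: ceval_superset[of ?K] lookup_add ring_distribs sum.distrib)
  finally show "ceval \<phi> (x + y) = ceval \<phi> x + ceval \<phi> y" .
  show "ceval \<phi> (cchain_scale z x) = z * ceval \<phi> x"
    by (subst ceval_superset[OF _ keys_cchain_scale])
      (simp_all add: ceval_def sum_distrib_left mult.assoc)
qed (unfold_locales, simp_all add: algebra_simps)

lemmas ceval_simps =
  module_hom.add[OF linear_ceval[THEN Vector_Spaces.linear.axioms(3)]]
  module_hom.diff[OF linear_ceval[THEN Vector_Spaces.linear.axioms(3)]]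
  module_hom.neg[OF linear_ceval[THEN Vector_Spaces.linear.axioms(3)]]
  module_hom.scale[OF linear_ceval[THEN Vector_Spaces.linear.axioms(3)]]
  module_hom.sum[OF linear_ceval[THEN Vector_Spaces.linear.axioms(3)]]
  module_hom.zero[OF linear_ceval[THEN Vector_Spaces.linear.axioms(3)]]

lemma ceval_csingle [simp]: "ceval \<phi> (csingle s) = \<phi> s"
  by (simp add: ceval_def)

lemma cchain_extend_csingle [simp]: "cchain_extend b (csingle s) = b s"
  by (simp add: cchain_extend_def)

lemma clinear_simps:
  assumes "clinear f"
  shows "f (x + y) = f x + f y" "f (x - y) = f x - f y" "f (- x) = - f x" "f 0 = 0"
    "f (cchain_scale z x) = cchain_scale z (f x)" "f (\<Sum>i\<in>I. g i) = (\<Sum>i\<in>I. f (g i))"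
proof -
  interpret f: module_hom cchain_scale cchain_scale f
    using assms by (rule Vector_Spaces.linear.axioms)
  show "f (x + y) = f x + f y" "f (x - y) = f x - f y" "f (- x) = - f x" "f 0 = 0"
    "f (cchain_scale z x) = cchain_scale z (f x)" "f (\<Sum>i\<in>I. g i) = (\<Sum>i\<in>I. f (g i))"
    by (simp_all add: f.add f.diff f.neg f.scale f.sum)
qed

lemma csingle_expansion:
  "c = (\<Sum>s\<in>Poly_Mapping.keys c. cchain_scale (Poly_Mapping.lookup c s) (csingle s))"
  by (rule poly_mapping_eqI)
    (simp add: lookup_sum lookup_single when_def if_distrib sum.delta in_keys_iff cong: if_cong)

text \<open>
  A chain is a combination of simplices, so every statement about a linear image of chains is reduced
  to single simplices by this lemma.
\<close>
lemma clinear_image_in_subspace: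
  assumes "clinear f" "cchain.subspace U" "\<And>s. s \<in> Poly_Mapping.keys c \<Longrightarrow> f (csingle s) \<in> U"
  shows "f c \<in> U"
  by (subst csingle_expansion[of c], unfold clinear_simps(5,6)[OF assms(1)])
    (intro cchain.subspace_sum cchain.subspace_scale assms)

lemma clinear_eq_on_keys:
  assumes "clinear f" "clinear g" "\<And>s. s \<in> Poly_Mapping.keys c \<Longrightarrow> f (csingle s) = g (csingle s)"
  shows "f c = g c"
  by (subst (1 2) csingle_expansion[of c], unfold clinear_simps(5,6)[OF assms(1)] clinear_simps(5,6)[OF assms(2)])
    (simp add: assms(3))

lemma linear_cchain_boundary: "clinear (cchain_boundary p)"
proof (cases "p = 0")
  case True
  have "clinear (\<lambda>c :: 'a cchain. 0 :: 'a cchain)"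
    by unfold_locales auto
  then show ?thesis
    using True by (simp add: cchain_boundary_def[abs_def])
next
  case False
  then have "cchain_boundary p = cchain_extend (\<lambda>s :: (nat \<Rightarrow> real) \<Rightarrow> 'a.
      \<Sum>k\<le>p. Poly_Mapping.single (singular_face p k s) ((-1) ^ k))"
    by (simp add: cchain_boundary_def fun_eq_iff)
  then show ?thesis
    by (simp add: linear_cchain_extend)
qed

lemma linear_cchain_map: "clinear (cchain_map p g)"
  unfolding cchain_map_def[abs_def] by (rule linear_cchain_extend)

lemmas cchain_boundary_simps = clinear_simps[OF linear_cchain_boundary]
lemmas cchain_map_simps = clinear_simps[OF linear_cchain_map]

lemma cchain_map_csingle [simp]: "cchain_map p g (csingle s) = csingle (simplex_map p g s)"
  by (simp add: cchain_map_def)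

lemma cchain_boundary_1_csingle:
  "cchain_boundary (Suc 0) (csingle s) =
     csingle (singular_face (Suc 0) 0 s) - csingle (singular_face (Suc 0) (Suc 0) s)"
  by (simp add: cchain_boundary_def single_uminus)

lemma cchain_boundary_2_csingle:
  "cchain_boundary (Suc (Suc 0)) (csingle s) =
     csingle (singular_face 2 0 s) - csingle (singular_face 2 1 s) + csingle (singular_face 2 2 s)"
  by (simp add: cchain_boundary_def single_uminus numeral_2_eq_2)

lemma subspace_cchains: "cchain.subspace (cchains p X)"
  unfolding cchain.subspace_def cchains_def
  using keys_add keys_cchain_scale by fastforce

lemma subspace_cboundaries: "cchain.subspace (cboundaries p X)"
  unfolding cboundaries_def
proof -
  interpret module_hom cchain_scale cchain_scale "cchain_boundary (Suc p)"
    using linear_cchain_boundary by (rule Vector_Spaces.linear.axioms)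
  show "cchain.subspace (cchain_boundary (Suc p) ` cchains (Suc p) X)"
    by (rule subspace_image) (rule subspace_cchains)
qed

lemma subspace_ccycles: "cchain.subspace (ccycles p X)"
  using subspace_cchains[of p X]
  by (auto simp: cchain.subspace_def ccycles_def cchain_boundary_simps)

lemma csingle_in_cchains [simp]: "csingle s \<in> cchains p X \<longleftrightarrow> singular_simplex p X s"
  by (simp add: cchains_def)

lemma cchain_map_in_cchains:
  assumes "continuous_map X Y g" "c \<in> cchains p X"
  shows "cchain_map p g c \<in> cchains p Y"
  by (rule clinear_image_in_subspace[OF linear_cchain_map subspace_cchains])
    (use assms in \<open>auto simp: cchains_def intro: singular_simplex_simplex_map\<close>)

text \<open>
  Restriction to faces commutes with composition on the left.
\<close>
lemma cchain_boundary_map: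
  assumes "continuous_map X Y g" "c \<in> cchains (Suc p) X"
  shows "cchain_boundary (Suc p) (cchain_map (Suc p) g c) = cchain_map p g (cchain_boundary (Suc p) c)"
proof -
  have lin: "clinear (\<lambda>c. cchain_boundary (Suc p) (cchain_map (Suc p) g c))"
    "clinear (\<lambda>c. cchain_map p g (cchain_boundary (Suc p) c))"
    using Vector_Spaces.linear_compose[OF linear_cchain_map linear_cchain_boundary]
      Vector_Spaces.linear_compose[OF linear_cchain_boundary linear_cchain_map]
    by (auto simp: o_def)
  show ?thesis
  proof (rule clinear_eq_on_keys[OF lin])
    fix s assume "s \<in> Poly_Mapping.keys c"
    have face: "singular_face (Suc p) k (simplex_map (Suc p) g s) = simplex_map p g (singular_face (Suc p) k s)"
      if "k \<le> Suc p" for k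
      using that by (subst singular_face_simplex_map)
        (auto simp: simplex_map_def singular_face_def simplical_face_in_standard_simplex)
    have single_map: "cchain_map p g (Poly_Mapping.single t z) = Poly_Mapping.single (simplex_map p g t) z" for t z
      by (cases "z = 0") (auto simp: cchain_map_def cchain_extend_def cchain_scale_def)
    show "cchain_boundary (Suc p) (cchain_map (Suc p) g (csingle s)) =
        cchain_map p g (cchain_boundary (Suc p) (csingle s))"
      by (simp add: cchain_boundary_def face cchain_map_simps single_map)
  qed
qed

lemma cchain_map_in_cboundaries:
  assumes "continuous_map X Y g" "c \<in> cboundaries p X"
  shows "cchain_map p g c \<in> cboundaries p Y"
proof -
  from assms(2) obtain d where d: "c = cchain_boundary (Suc p) d" "d \<in> cchains (Suc p) X"
    by (auto simp: cboundaries_def)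
  have "cchain_map p g c = cchain_boundary (Suc p) (cchain_map (Suc p) g d)"
    by (simp only: d(1) cchain_boundary_map[OF assms(1) d(2)])
  with cchain_map_in_cchains[OF assms(1) d(2)] show ?thesis
    unfolding cboundaries_def by (rule rev_image_eqI)
qed

section \<open>Homology classes and invariant classes\<close>

definition hclass :: "nat \<Rightarrow> 'a topology \<Rightarrow> 'a cchain \<Rightarrow> 'a cchain set" where
  "hclass p X c = {c + b | b. b \<in> cboundaries p X}"

text \<open>
  The identities between cosets below become membership statements for the subspace of boundaries.
\<close>
lemma mem_hclass: "x \<in> hclass p X c \<longleftrightarrow> x - c \<in> cboundaries p X"
  by (auto simp: hclass_def intro: exI[of _ "x - c"])

lemma hclass_eq_iff: "hclass p X c = hclass p X d \<longleftrightarrow> c - d \<in> cboundaries p X"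
proof
  assume "hclass p X c = hclass p X d"
  moreover have "c \<in> hclass p X c"
    using cchain.subspace_0[OF subspace_cboundaries] by (simp add: mem_hclass)
  ultimately show "c - d \<in> cboundaries p X"
    by (simp add: mem_hclass)
next
  assume *: "c - d \<in> cboundaries p X"
  have "x - c \<in> cboundaries p X \<longleftrightarrow> x - d \<in> cboundaries p X" for x
    using cchain.subspace_add[OF subspace_cboundaries *, of "x - c"]
      cchain.subspace_diff[OF subspace_cboundaries _ *, of "x - d"] by auto
  then show "hclass p X c = hclass p X d"
    by (auto simp: mem_hclass)
qed

lemma hclass_0: "hclass p X 0 = cboundaries p X"
  by (simp add: hclass_def)

lemma hclass_add: "{a + b | a b. a \<in> hclass p X c \<and> b \<in> hclass p X d} = hclass p X (c + d)"
proof (intro subset_antisym subsetI)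
  fix x assume "x \<in> {a + b | a b. a \<in> hclass p X c \<and> b \<in> hclass p X d}"
  then obtain a b where x: "x = a + b" and ab: "a - c \<in> cboundaries p X" "b - d \<in> cboundaries p X"
    by (auto simp: mem_hclass)
  show "x \<in> hclass p X (c + d)"
    using cchain.subspace_add[OF subspace_cboundaries ab] by (simp add: x mem_hclass algebra_simps)
next
  fix x assume "x \<in> hclass p X (c + d)"
  then have "x = (x - d) + d" "x - d \<in> hclass p X c" "d \<in> hclass p X d"
    using cchain.subspace_0[OF subspace_cboundaries] by (simp_all add: mem_hclass algebra_simps)
  then show "x \<in> {a + b | a b. a \<in> hclass p X c \<and> b \<in> hclass p X d}"
    by (intro CollectI exI conjI)
qed

lemma hclass_linear_image:
  assumes "clinear f" "\<And>b. b \<in> cboundaries p X \<Longrightarrow> f b \<in> cboundaries q Y"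
  shows "{f a + b | a b. a \<in> hclass p X c \<and> b \<in> cboundaries q Y} = hclass q Y (f c)"
proof (intro subset_antisym subsetI)
  fix x assume "x \<in> {f a + b | a b. a \<in> hclass p X c \<and> b \<in> cboundaries q Y}"
  then obtain a b where x: "x = f a + b" and ab: "a - c \<in> cboundaries p X" "b \<in> cboundaries q Y"
    by (auto simp: mem_hclass)
  show "x \<in> hclass q Y (f c)"
    using cchain.subspace_add[OF subspace_cboundaries assms(2)[OF ab(1)] ab(2)]
    by (simp add: x mem_hclass clinear_simps[OF assms(1)] algebra_simps)
next
  fix x assume "x \<in> hclass q Y (f c)"
  then have "x = f c + (x - f c)" "c \<in> hclass p X c" "x - f c \<in> cboundaries q Y"
    using cchain.subspace_0[OF subspace_cboundaries] by (simp_all add: mem_hclass)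
  then show "x \<in> {f a + b | a b. a \<in> hclass p X c \<and> b \<in> cboundaries q Y}"
    by (intro CollectI exI conjI)
qed

lemma linear_cchain_scale: "clinear (cchain_scale z)"
  by unfold_locales (auto simp: cchain.scale_right_distrib mult.commute)

lemma chom_induced_hclass:
  assumes "continuous_map X Y g"
  shows "chom_induced p Y g (hclass p X c) = hclass p Y (cchain_map p g c)"
  unfolding chom_induced_def
  by (rule hclass_linear_image) (auto simp: linear_cchain_map intro: cchain_map_in_cboundaries[OF assms])

lemma carrier_chomology: "carrier (chomology p X) = hclass p X ` ccycles p X"
  by (simp only: chomology_def partial_object.simps hclass_def[symmetric]) (rule Setcompr_eq_image)

lemma zero_chomology: "\<zero>\<^bsub>chomology p X\<^esub> = hclass p X 0"
  by (simp only: chomology_def hclass_0 ring.simps)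

lemma add_chomology:
  "hclass p X c \<oplus>\<^bsub>chomology p X\<^esub> hclass p X d = hclass p X (c + d)"
  by (simp only: chomology_def ring_record_simps hclass_add)

lemma smult_chomology:
  "z \<odot>\<^bsub>chomology p X\<^esub> hclass p X c = hclass p X (cchain_scale z c)"
proof -
  have "{cchain_scale z a + b | a b. a \<in> hclass p X c \<and> b \<in> cboundaries p X} = hclass p X (cchain_scale z c)"
    by (rule hclass_linear_image[OF linear_cchain_scale])
      (rule cchain.subspace_scale[OF subspace_cboundaries])
  then show ?thesis
    by (simp only: chomology_def module.simps)
qed

lemmas chomology_simps = carrier_chomology zero_chomology add_chomology smult_chomology

text \<open>
  A single nonzero invariant vector is a linearly independent family; conversely a nonempty family of
  zero vectors is never independent. Stating this for a record that is only an additive monoid with a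
  torsion-free scalar action avoids the module locale, whose ring operations are not those
  stored in the record of homology.
\<close>
lemma trivial_multiplicity_eq_0_iff:
  fixes V :: "(complex, 'v) module"
  assumes V: "abelian_monoid V"
    and smult: "\<And>a v. v \<in> carrier V \<Longrightarrow> a \<odot>\<^bsub>V\<^esub> v \<in> carrier V"
    and smult_0: "\<And>a. a \<odot>\<^bsub>V\<^esub> \<zero>\<^bsub>V\<^esub> = \<zero>\<^bsub>V\<^esub>"
    and smult_eq_0: "\<And>a v. v \<in> carrier V \<Longrightarrow> a \<odot>\<^bsub>V\<^esub> v = \<zero>\<^bsub>V\<^esub> \<Longrightarrow> a = 0 \<or> v = \<zero>\<^bsub>V\<^esub>"
  shows "trivial_multiplicity \<Gamma> \<rho> V = 0 \<longleftrightarrow>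
    (\<forall>v \<in> carrier V. (\<forall>g\<in>\<Gamma>. \<rho> g v = v) \<longrightarrow> v = \<zero>\<^bsub>V\<^esub>)"
proof -
  interpret abelian_monoid V by (rule V)
  have fin: "finsum V (\<lambda>v. a v \<odot>\<^bsub>V\<^esub> v) {v} = a v \<odot>\<^bsub>V\<^esub> v" if "v \<in> carrier V" for a v
    using that smult by simp
  let ?I = "{v \<in> carrier V. \<forall>g\<in>\<Gamma>. \<rho> g v = v}"
  have "trivial_multiplicity \<Gamma> \<rho> V = 0 \<longleftrightarrow> (\<forall>B. finite B \<and> B \<subseteq> ?I \<and> lin_indep_family V B \<longrightarrow> B = {})"
    unfolding trivial_multiplicity_def
    by (subst bot_enat_def[symmetric], subst SUP_bot_conv) (auto simp: bot_enat_def zero_enat_def)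
  also have "\<dots> \<longleftrightarrow> (\<forall>v \<in> ?I. v = \<zero>\<^bsub>V\<^esub>)"
  proof (intro iffI ballI allI impI)
    fix v assume *: "\<forall>B. finite B \<and> B \<subseteq> ?I \<and> lin_indep_family V B \<longrightarrow> B = {}" and v: "v \<in> ?I"
    show "v = \<zero>\<^bsub>V\<^esub>"
    proof (rule ccontr)
      assume "v \<noteq> \<zero>\<^bsub>V\<^esub>"
      then have "lin_indep_family V {v}"
        using v smult_eq_0[of v] by (auto simp: lin_indep_family_def fin)
      with * v show False by blast
    qed
  next
    fix B assume *: "\<forall>v \<in> ?I. v = \<zero>\<^bsub>V\<^esub>" and B: "finite B \<and> B \<subseteq> ?I \<and> lin_indep_family V B"
    show "B = {}"
    proof (rule ccontr)
      assume "B \<noteq> {}"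
      moreover have "v = \<zero>\<^bsub>V\<^esub>" if "v \<in> B" for v
        using * B that by blast
      ultimately have B0: "B = {\<zero>\<^bsub>V\<^esub>}" by auto
      \<comment> \<open>all coefficients equal to one: a nontrivial relation for the family that consists of zero alone\<close>
      have "finsum V (\<lambda>v. 1 \<odot>\<^bsub>V\<^esub> v) B = \<zero>\<^bsub>V\<^esub>"
        unfolding B0 by (subst fin) (auto simp: smult_0)
      with B B0 show False
        by (auto simp: lin_indep_family_def dest!: spec[of _ "\<lambda>_. 1"])
    qed
  qed
  finally show ?thesis by auto
qed

text \<open>
  From here on, representations and homology classes disappear: quasiregularity is a statement about cycles
  modulo boundaries.
\<close>
lemma quasiregular_iff:
  fixes M :: "('s \<times> (real \<times> real)) set topology"
  assumes proj: "continuous_map M torus origami_proj"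
  shows "quasiregular M \<longleftrightarrow>
    (\<forall>c \<in> ccycles 1 M. cchain_map 1 origami_proj c \<in> cboundaries 1 torus \<longrightarrow>
       (\<forall>f \<in> origami_aut M. cchain_map 1 f c - c \<in> cboundaries 1 M) \<longrightarrow> c \<in> cboundaries 1 M)"
proof -
  note One_nat_def [simp del]
  let ?V = "H1_0 M"
  let ?Z = "{c \<in> ccycles 1 M. cchain_map 1 origami_proj c \<in> cboundaries 1 torus}"
  have car: "carrier ?V = hclass 1 M ` ?Z"
  proof -
    have "chom_induced 1 torus origami_proj (hclass 1 M c) = hclass 1 torus 0 \<longleftrightarrow>
        cchain_map 1 origami_proj c \<in> cboundaries 1 torus" for c
      by (simp add: chom_induced_hclass[OF proj] hclass_eq_iff)
    then show ?thesis
      unfolding H1_0_def by (auto simp: chomology_simps(1,2))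
  qed
  have ops: "\<zero>\<^bsub>?V\<^esub> = hclass 1 M 0" "hclass 1 M c \<oplus>\<^bsub>?V\<^esub> hclass 1 M d = hclass 1 M (c + d)"
    "z \<odot>\<^bsub>?V\<^esub> hclass 1 M c = hclass 1 M (cchain_scale z c)" for c d z
    by (simp_all add: H1_0_def chomology_simps(3,4) chomology_simps(2))
  have Z: "cchain.subspace ?Z"
    using subspace_ccycles[of 1 M] subspace_cboundaries[of 1 torus]
    by (auto simp: cchain.subspace_def cchain_map_simps)
  have "quasiregular M \<longleftrightarrow>
     (\<forall>v\<in>carrier ?V. (\<forall>f \<in> origami_aut M. chom_induced 1 M f v = v) \<longrightarrow> v = \<zero>\<^bsub>?V\<^esub>)"
    unfolding quasiregular_def
  proof (rule trivial_multiplicity_eq_0_iff)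
    show "abelian_monoid ?V"
      by (rule abelian_monoidI)
        (use cchain.subspace_add[OF Z] cchain.subspace_0[OF Z] in \<open>auto simp: car ops algebra_simps\<close>)
    fix a v
    show "a \<odot>\<^bsub>?V\<^esub> v \<in> carrier ?V" if "v \<in> carrier ?V"
      using that cchain.subspace_scale[OF Z] by (auto simp: car ops)
    show "a \<odot>\<^bsub>?V\<^esub> \<zero>\<^bsub>?V\<^esub> = \<zero>\<^bsub>?V\<^esub>"
      by (simp add: ops)
    show "a = 0 \<or> v = \<zero>\<^bsub>?V\<^esub>" if v: "v \<in> carrier ?V" and 0: "a \<odot>\<^bsub>?V\<^esub> v = \<zero>\<^bsub>?V\<^esub>"
    proof (rule disjCI)
      assume "v \<noteq> \<zero>\<^bsub>?V\<^esub>"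
      from v obtain c where c: "v = hclass 1 M c" by (auto simp: car)
      show "a = 0"
      proof (rule ccontr)
        assume "a \<noteq> 0"
        moreover have "cchain_scale a c \<in> cboundaries 1 M"
          using 0 by (simp add: c ops hclass_eq_iff)
        from cchain.subspace_scale[OF subspace_cboundaries this, of "1 / a"]
        have "c \<in> cboundaries 1 M"
          using \<open>a \<noteq> 0\<close> by simp
        ultimately show False
          using \<open>v \<noteq> \<zero>\<^bsub>?V\<^esub>\<close> by (simp add: c ops hclass_eq_iff)
      qed
    qed
  qed
  also have "\<dots> \<longleftrightarrow> (\<forall>c\<in>?Z. (\<forall>f \<in> origami_aut M. chom_induced 1 M f (hclass 1 M c) = hclass 1 M c) \<longrightarrow>
      hclass 1 M c = hclass 1 M 0)"
    by (simp add: car ops)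
  also have "\<dots> \<longleftrightarrow> (\<forall>c\<in>?Z. (\<forall>f \<in> origami_aut M. cchain_map 1 f c - c \<in> cboundaries 1 M) \<longrightarrow>
      c \<in> cboundaries 1 M)"
  proof -
    have "chom_induced 1 M f (hclass 1 M c) = hclass 1 M (cchain_map 1 f c)" if "f \<in> origami_aut M" for f c
      using that by (intro chom_induced_hclass) (auto simp: origami_aut_def homeomorphic_imp_continuous_map)
    then show ?thesis
      by (simp add: hclass_eq_iff)
  qed
  finally show ?thesis
    by blast
qed

text \<open>Homological degrees are written \<open>1\<close>; rewriting them to \<open>Suc 0\<close> would hide them from the rules.\<close>

declare One_nat_def [simp del]

section \<open>Straight segments and triangles\<close>

definition segment :: "('v::real_vector \<Rightarrow> 'a) \<Rightarrow> 'v \<Rightarrow> 'v \<Rightarrow> (nat \<Rightarrow> real) \<Rightarrow> 'a" where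
  "segment F a b = (\<lambda>x\<in>standard_simplex 1. F (x 0 *\<^sub>R a + x 1 *\<^sub>R b))"

abbreviation simplex_top :: "nat \<Rightarrow> (nat \<Rightarrow> real) topology" where
  "simplex_top p \<equiv> subtopology (powertop_real UNIV) (standard_simplex p)"

lemma standard_simplex_1_iff:
  "x \<in> standard_simplex 1 \<longleftrightarrow> 0 \<le> x 0 \<and> 0 \<le> x 1 \<and> x 0 + x 1 = 1 \<and> (\<forall>i>1. x i = 0)"
proof -
  have sum: "(\<Sum>i\<le>1. x i) = x 0 + x 1"
    by (simp add: One_nat_def)
  have "x \<in> standard_simplex 1"
    if x: "0 \<le> x 0" "0 \<le> x 1" "x 0 + x 1 = 1" "\<forall>i>1. x i = 0"
  proof -
    have "0 \<le> x i \<and> x i \<le> 1" for i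
      using x by (cases "i = 0"; cases "i = 1") auto
    then show ?thesis
      using x sum by (simp add: standard_simplex_def)
  qed
  then show ?thesis
    using sum by (auto simp: standard_simplex_def)
qed

lemma standard_simplex_2_iff:
  "x \<in> standard_simplex 2 \<longleftrightarrow>
     0 \<le> x 0 \<and> 0 \<le> x 1 \<and> 0 \<le> x 2 \<and> x 0 + x 1 + x 2 = 1 \<and> (\<forall>i>2. x i = 0)"
proof -
  have sum: "(\<Sum>i\<le>2. x i) = x 0 + x 1 + x 2"
    by (simp add: numeral_2_eq_2 One_nat_def)
  have "x \<in> standard_simplex 2"
    if x: "0 \<le> x 0" "0 \<le> x 1" "0 \<le> x 2" "x 0 + x 1 + x 2 = 1" "\<forall>i>2. x i = 0"
  proof -
    have "0 \<le> x i \<and> x i \<le> 1" for i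
      using x by (cases "i = 0"; cases "i = 1"; cases "i = 2") auto
    then show ?thesis
      using x sum by (simp add: standard_simplex_def)
  qed
  then show ?thesis
    using sum by (auto simp: standard_simplex_def)
qed

text \<open>
  The point of the standard 1-simplex with barycentric coordinates \<open>(1 - t, t)\<close>; it identifies the
  simplex with the unit interval.
\<close>
definition on_edge :: "real \<Rightarrow> nat \<Rightarrow> real" where
  "on_edge t = (\<lambda>i. if i = 0 then 1 - t else if i = 1 then t else 0)"

lemma on_edge_in_simplex: "t \<in> {0..1} \<Longrightarrow> on_edge t \<in> standard_simplex 1"
  by (auto simp: standard_simplex_1_iff on_edge_def)

lemma standard_simplex_1_eq: "standard_simplex 1 = on_edge ` {0..1}"
proof (intro subset_antisym subsetI)
  fix x assume "x \<in> standard_simplex 1"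
  then have x: "0 \<le> x 0" "0 \<le> x 1" "x 0 + x 1 = 1" "\<forall>i>1. x i = 0"
    by (auto simp: standard_simplex_1_iff)
  have "x = on_edge (x 1)"
    using x by (auto simp: on_edge_def fun_eq_iff)
  with x show "x \<in> on_edge ` {0..1}"
    by (intro image_eqI[of _ _ "x 1"]) auto
qed (auto intro: on_edge_in_simplex)

lemma extensional_simplex_1_eqI:
  assumes "s \<in> extensional (standard_simplex 1)" "t \<in> extensional (standard_simplex 1)"
    and "\<And>x. x \<in> {0..1} \<Longrightarrow> s (on_edge x) = t (on_edge x)"
  shows "s = t"
  by (rule extensionalityI[OF assms(1,2)]) (use assms(3) in \<open>auto simp: standard_simplex_1_eq\<close>)

lemma segment_on_edge:
  "t \<in> {0..1} \<Longrightarrow> segment F a b (on_edge t) = F ((1 - t) *\<^sub>R a + t *\<^sub>R b)"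
  using on_edge_in_simplex[of t] by (simp add: segment_def on_edge_def)

lemma segment_extensional: "segment F a b \<in> extensional (standard_simplex 1)"
  by (simp add: segment_def)

lemma segment_eqI:
  assumes "\<And>t. t \<in> {0..1} \<Longrightarrow> F ((1 - t) *\<^sub>R a + t *\<^sub>R b) = G ((1 - t) *\<^sub>R c + t *\<^sub>R d)"
  shows "segment F a b = segment G c d"
  by (rule extensional_simplex_1_eqI) (use assms in \<open>auto simp: segment_extensional segment_on_edge\<close>)

lemma continuous_map_barycentric:
  fixes a b c :: "'v::real_normed_vector"
  assumes "convex D" "a \<in> D" "b \<in> D" "c \<in> D"
  shows "continuous_map (simplex_top 2) (top_of_set D) (\<lambda>x. x 0 *\<^sub>R a + x 1 *\<^sub>R b + x 2 *\<^sub>R c)"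
    and "continuous_map (simplex_top 1) (top_of_set D) (\<lambda>x. x 0 *\<^sub>R a + x 1 *\<^sub>R b)"
proof -
  have proj: "continuous_map (powertop_real UNIV) euclideanreal (\<lambda>x. x i)" for i :: nat
    by (rule continuous_map_product_projection) auto
  have "continuous_map (powertop_real UNIV) euclidean (\<lambda>x. x i *\<^sub>R v)" for i :: nat and v :: 'v
    using continuous_map_compose[OF proj[of i], of euclidean "\<lambda>t. t *\<^sub>R v"]
    by (simp add: o_def continuous_intros)
  then have *: "continuous_map (powertop_real UNIV) euclidean (\<lambda>x :: nat \<Rightarrow> real. x 0 *\<^sub>R a + x 1 *\<^sub>R b + x 2 *\<^sub>R c)"
    "continuous_map (powertop_real UNIV) euclidean (\<lambda>x :: nat \<Rightarrow> real. x 0 *\<^sub>R a + x 1 *\<^sub>R b)"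
    by (intro continuous_map_add; blast)+
  show "continuous_map (simplex_top 2) (top_of_set D) (\<lambda>x. x 0 *\<^sub>R a + x 1 *\<^sub>R b + x 2 *\<^sub>R c)"
  proof -
    have "convex hull {a, b, c} \<subseteq> D"
      using assms by (intro hull_minimal) auto
    then have "x 0 *\<^sub>R a + x 1 *\<^sub>R b + x 2 *\<^sub>R c \<in> D" if "x \<in> standard_simplex 2" for x
      using that unfolding convex_hull_3 standard_simplex_2_iff by blast
    then show ?thesis
      using * by (auto simp: continuous_map_in_subtopology continuous_map_from_subtopology)
  qed
  show "continuous_map (simplex_top 1) (top_of_set D) (\<lambda>x. x 0 *\<^sub>R a + x 1 *\<^sub>R b)"
    using * assms by (auto simp: continuous_map_in_subtopology continuous_map_from_subtopology
        standard_simplex_1_iff intro!: convexD)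
qed

lemma singular_simplex_segment:
  fixes F :: "'v::real_normed_vector \<Rightarrow> 'a"
  assumes "convex D" "continuous_map (top_of_set D) X F" "a \<in> D" "b \<in> D"
  shows "singular_simplex 1 X (segment F a b)"
  using continuous_map_compose[OF continuous_map_barycentric(2)[OF assms(1,3,4,4)] assms(2)]
  unfolding singular_simplex_def segment_def by (auto simp: o_def elim: continuous_map_eq)

text \<open>
  The three segments are the faces of the affine triangle with vertices \<open>a\<close>, \<open>b\<close>, \<open>c\<close>, which lies in the
  convex set and is carried to \<open>X\<close>. All homologies between paths below come from this
  lemma: subdivision of paths, the two triangles of a square, and cones.
\<close>
lemma triangle_boundary:
  fixes F :: "'v::real_normed_vector \<Rightarrow> 'a"
  assumes D: "convex D" and F: "continuous_map (top_of_set D) X F" and abc: "a \<in> D" "b \<in> D" "c \<in> D"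
  shows "csingle (segment F a b) + csingle (segment F b c) - csingle (segment F a c) \<in> cboundaries 1 X"
proof -
  define \<tau> where "\<tau> = (\<lambda>x\<in>standard_simplex 2. F (x 0 *\<^sub>R a + x 1 *\<^sub>R b + x 2 *\<^sub>R c))"
  have "singular_simplex 2 X \<tau>"
    using continuous_map_compose[OF continuous_map_barycentric(1)[OF D abc] F]
    unfolding singular_simplex_def \<tau>_def by (auto simp: o_def elim: continuous_map_eq)
  moreover have "singular_face 2 0 \<tau> = segment F b c" "singular_face 2 1 \<tau> = segment F a c"
    "singular_face 2 2 \<tau> = segment F a b"
  proof -
    have "singular_face 2 k \<tau> = segment F p q"
      if "k \<le> 2" and "\<And>x :: nat \<Rightarrow> real. simplical_face k x 0 *\<^sub>R a + simplical_face k x 1 *\<^sub>R b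
          + simplical_face k x 2 *\<^sub>R c = x 0 *\<^sub>R p + x 1 *\<^sub>R q" for k p q
      using that simplical_face_in_standard_simplex[of 2 k]
      by (auto simp: singular_face_def segment_def \<tau>_def One_nat_def intro!: restrict_ext)
    then show "singular_face 2 0 \<tau> = segment F b c" "singular_face 2 1 \<tau> = segment F a c"
      "singular_face 2 2 \<tau> = segment F a b"
      by (auto simp: simplical_face_def One_nat_def)
  qed
  ultimately show ?thesis
    unfolding cboundaries_def
    by (intro image_eqI[of _ _ "csingle \<tau>"]) (auto simp: cchain_boundary_2_csingle numeral_2_eq_2)
qed

lemma segment_const_boundary:
  fixes F :: "'v::real_normed_vector \<Rightarrow> 'a"
  assumes "convex D" "continuous_map (top_of_set D) X F" "a \<in> D"
  shows "csingle (segment F a a) \<in> cboundaries 1 X"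
  using triangle_boundary[OF assms assms(3,3)] by simp

section \<open>The winding functional\<close>

text \<open>
  The number of turns of the path \<open>h \<circ> s\<close> around the origin, for a map \<open>h\<close> into the punctured plane. The path
  need not be closed, so this is a complex number in general.
\<close>
definition turning :: "('a \<Rightarrow> complex) \<Rightarrow> ((nat \<Rightarrow> real) \<Rightarrow> 'a) \<Rightarrow> complex" where
  "turning h s = winding_number (\<lambda>t. h (s (on_edge t))) 0"

text \<open>
  A continuous logarithm along the path computes the turning, by the formula for winding numbers of
  exponentials.
\<close>
lemma turning_exp:
  assumes L: "continuous_on {0..1} L" and eq: "\<And>t. t \<in> {0..1} \<Longrightarrow> h (s (on_edge t)) = exp (L t)"
  shows "turning h s = (L 1 - L 0) / (2 * of_real pi * \<i>)"
proof -
  have "turning h s = winding_number (exp \<circ> L) 0"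
    unfolding turning_def by (rule winding_number_cong) (use eq in auto)
  also have "\<dots> = (pathfinish L - pathstart L) / (2 * of_real pi * \<i>)"
    by (rule winding_number_compose_exp) (use L in \<open>simp add: path_def\<close>)
  finally show ?thesis
    by (simp add: pathfinish_def pathstart_def)
qed

text \<open>
  The triangle is convex, so \<open>h\<close> has a continuous logarithm \<open>L\<close> on it; the turning along each side is a
  difference of values of \<open>L\<close> at two vertices, and these cancel around the triangle.
\<close>
lemma turning_triangle:
  assumes h: "continuous_map X euclidean h" "\<And>x. x \<in> topspace X \<Longrightarrow> h x \<noteq> 0"
    and \<tau>: "singular_simplex 2 X \<tau>"
  shows "turning h (singular_face 2 0 \<tau>) - turning h (singular_face 2 1 \<tau>) + turning h (singular_face 2 2 \<tau>) = 0"
proof -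
  \<comment> \<open>a planar model of the standard 2-simplex, where logarithms on contractible sets are available\<close>
  define D where "D = {v :: real \<times> real. 0 \<le> fst v \<and> 0 \<le> snd v \<and> fst v + snd v \<le> 1}"
  define e where "e = (\<lambda>v :: real \<times> real. \<lambda>i::nat.
      if i = 0 then 1 - fst v - snd v else if i = 1 then fst v else if i = 2 then snd v else 0)"
  have e: "e v \<in> standard_simplex 2" if "v \<in> D" for v
    using that by (auto simp: standard_simplex_2_iff D_def e_def)
  have "continuous_map (top_of_set D) euclideanreal (\<lambda>v. e v i)" for i
    by (cases "i = 0"; cases "i = 1"; cases "i = 2") (auto simp: e_def intro!: continuous_intros)
  then have "continuous_map (top_of_set D) (simplex_top 2) e"
    using e by (auto simp: continuous_map_in_subtopology continuous_map_componentwise_UNIV)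
  then have "continuous_map (top_of_set D) euclidean (h \<circ> (\<tau> \<circ> e))"
    using \<tau> h(1) unfolding singular_simplex_def by (blast intro: continuous_map_compose)
  then have cont: "continuous_on D (\<lambda>v. h (\<tau> (e v)))"
    by (simp add: o_def)
  have nz: "h (\<tau> (e v)) \<noteq> 0" if "v \<in> D" for v
    using e[OF that] \<tau> h(2) by (auto simp: singular_simplex_def continuous_map_def Pi_iff)
  have "convex D"
  proof (rule convexI)
    fix x y :: "real \<times> real" and u v :: real
    assume x: "x \<in> D" and y: "y \<in> D" and uv: "0 \<le> u" "0 \<le> v" "u + v = 1"
    have "u * (fst x + snd x) + v * (fst y + snd y) \<le> u * 1 + v * 1"
      using x y uv by (intro add_mono mult_left_mono) (auto simp: D_def)
    then show "u *\<^sub>R x + v *\<^sub>R y \<in> D"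
      using x y uv by (auto simp: D_def algebra_simps)
  qed
  then obtain L where L: "continuous_on D L" "\<And>v. v \<in> D \<Longrightarrow> h (\<tau> (e v)) = exp (L v)"
    using continuous_logarithm_on_contractible[OF cont convex_imp_contractible] nz by blast
  have face: "singular_face 2 k \<tau> (on_edge t) = \<tau> (simplical_face k (on_edge t))" if "t \<in> {0..1}" for k t
    using on_edge_in_simplex[OF that] by (simp add: singular_face_def)
  have edge: "turning h (singular_face 2 k \<tau>) = (L (p 1) - L (p 0)) / (2 * of_real pi * \<i>)"
    if "continuous_on {0..1} p" "\<And>t. t \<in> {0..1} \<Longrightarrow> p t \<in> D"
      "\<And>t. t \<in> {0..1} \<Longrightarrow> simplical_face k (on_edge t) = e (p t)" for p k
  proof (rule turning_exp[where L = "\<lambda>t. L (p t)"])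
    show "continuous_on {0..1} (\<lambda>t. L (p t))"
      using that by (intro continuous_on_compose2[OF L(1)]) auto
    show "h (singular_face 2 k \<tau> (on_edge t)) = exp (L (p t))" if "t \<in> {0..1}" for t
      using that by (simp add: face \<open>\<And>t. t \<in> {0..1} \<Longrightarrow> simplical_face k (on_edge t) = e (p t)\<close> L(2)
          \<open>\<And>t. t \<in> {0..1} \<Longrightarrow> p t \<in> D\<close>)
  qed
  have "simplical_face 0 (on_edge t) = e (1 - t, t)" "simplical_face 1 (on_edge t) = e (0, t)"
    "simplical_face 2 (on_edge t) = e (t, 0)" for t
    by (rule ext, auto simp: simplical_face_def on_edge_def e_def)+
  then have "turning h (singular_face 2 0 \<tau>) = (L (1 - 1, 1) - L (1 - 0, 0)) / (2 * of_real pi * \<i>)"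
    "turning h (singular_face 2 1 \<tau>) = (L (0, 1) - L (0, 0)) / (2 * of_real pi * \<i>)"
    "turning h (singular_face 2 2 \<tau>) = (L (1, 0) - L (0, 0)) / (2 * of_real pi * \<i>)"
    by (intro edge[of "\<lambda>t. (1 - t, t)"] edge[of "\<lambda>t. (0, t)"] edge[of "\<lambda>t. (t, 0)"];
        auto simp: D_def intro!: continuous_intros)+
  then show ?thesis
    by (simp add: diff_divide_distrib)
qed

lemma ceval_turning_boundary:
  assumes h: "continuous_map X euclidean h" "\<And>x. x \<in> topspace X \<Longrightarrow> h x \<noteq> 0"
    and c: "c \<in> cboundaries 1 X"
  shows "ceval (turning h) c = 0"
proof -
  obtain d where d: "c = cchain_boundary (Suc (Suc 0)) d" "d \<in> cchains 2 X"
    using c by (auto simp: cboundaries_def numeral_2_eq_2)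
  have "cchain_boundary (Suc (Suc 0)) d \<in> {c. ceval (turning h) c = 0}"
  proof (rule clinear_image_in_subspace[OF linear_cchain_boundary])
    show "cchain.subspace {c. ceval (turning h) c = 0}"
      by (auto simp: cchain.subspace_def ceval_simps)
    fix \<tau> assume "\<tau> \<in> Poly_Mapping.keys d"
    then have "singular_simplex 2 X \<tau>"
      using d(2) by (auto simp: cchains_def)
    then show "cchain_boundary (Suc (Suc 0)) (csingle \<tau>) \<in> {c. ceval (turning h) c = 0}"
      using turning_triangle[OF h] by (simp add: cchain_boundary_2_csingle ceval_simps)
  qed
  then show ?thesis
    by (simp add: d(1))
qed

section \<open>Square-tiled surfaces\<close>

abbreviation unit_square :: "(real \<times> real) set" where
  "unit_square \<equiv> {0..1} \<times> {0..1}"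

lemma openin_squares_top:
  "openin (squares_top S) W \<longleftrightarrow>
     W \<subseteq> S \<times> unit_square \<and> (\<forall>s\<in>S. openin (top_of_set unit_square) {v \<in> unit_square. (s, v) \<in> W})"
proof (intro iffI conjI ballI)
  assume W: "openin (squares_top S) W"
  then show "W \<subseteq> S \<times> unit_square"
    using openin_subset by (fastforce simp: squares_top_def)
  fix s assume "s \<in> S"
  then have "continuous_map (top_of_set unit_square) (squares_top S) (\<lambda>v. (s, v))"
    by (simp add: squares_top_def continuous_map_pairwise o_def)
  from openin_continuous_map_preimage[OF this W]
  show "openin (top_of_set unit_square) {v \<in> unit_square. (s, v) \<in> W}"
    by simp
next
  assume W: "W \<subseteq> S \<times> unit_square \<and> (\<forall>s\<in>S. openin (top_of_set unit_square) {v \<in> unit_square. (s, v) \<in> W})"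
  then have eq: "W = (\<Union>s\<in>S. {s} \<times> {v \<in> unit_square. (s, v) \<in> W})"
    by auto
  show "openin (squares_top S) W"
    by (subst eq) (use W in \<open>auto simp: squares_top_def intro!: openin_Union openin_prod_Times_iff[THEN iffD2]\<close>)
qed

lemma equiv_lattice_rel: "equiv UNIV lattice_rel"
proof (intro equivI)
  show "sym lattice_rel"
  proof (rule symI)
    fix v w assume "(v, w) \<in> lattice_rel"
    then have "- (fst w - fst v) \<in> \<int>" "- (snd w - snd v) \<in> \<int>"
      by (auto simp only: lattice_rel_def Ints_minus mem_Collect_eq split_def fst_conv snd_conv)
    then show "(w, v) \<in> lattice_rel"
      by (simp add: lattice_rel_def)
  qed
  show "trans lattice_rel"
  proof (rule transI)
    fix v w x assume "(v, w) \<in> lattice_rel" "(w, x) \<in> lattice_rel"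
    then have "(fst w - fst v) + (fst x - fst w) \<in> \<int>" "(snd w - snd v) + (snd x - snd w) \<in> \<int>"
      by (auto simp only: lattice_rel_def Ints_add mem_Collect_eq split_def fst_conv snd_conv)
    then show "(v, x) \<in> lattice_rel"
      by (simp add: lattice_rel_def)
  qed
qed (auto simp: refl_on_def lattice_rel_def)

lemma lattice_class_eq_iff: "lattice_rel `` {v} = lattice_rel `` {w} \<longleftrightarrow> fst w - fst v \<in> \<int> \<and> snd w - snd v \<in> \<int>"
  using eq_equiv_class_iff[OF equiv_lattice_rel, of v w] by (simp add: lattice_rel_def)

lemma quotient_map_torus: "quotient_map euclidean torus (\<lambda>v. lattice_rel `` {v})"
  unfolding torus_def by (rule quotient_map_quotient_top)

locale square_surface =
  fixes S :: "'s set" and r u :: "'s \<Rightarrow> 's"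
  assumes finite_S: "finite S" and bij_r: "bij_betw r S S" and bij_u: "bij_betw u S S"
begin

abbreviation gluing :: "(('s \<times> (real \<times> real)) \<times> ('s \<times> (real \<times> real))) set" where
  "gluing \<equiv> (side_gluing S r u \<union> (side_gluing S r u)\<inverse>)\<^sup>*"

abbreviation M :: "('s \<times> (real \<times> real)) set topology" where
  "M \<equiv> square_tiled S r u"

definition pt :: "'s \<Rightarrow> real \<times> real \<Rightarrow> ('s \<times> (real \<times> real)) set" where
  "pt s v = gluing `` {(s, v)}"

lemma r_in_S [simp]: "s \<in> S \<Longrightarrow> r s \<in> S" and u_in_S [simp]: "s \<in> S \<Longrightarrow> u s \<in> S"
  using bij_r bij_u by (auto simp: bij_betw_def)

lemma equiv_gluing: "equiv UNIV gluing"
  by (intro equivI refl_rtrancl sym_rtrancl sym_Un_converse trans_rtrancl) auto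

lemma mem_pt: "(t, w) \<in> pt s v \<longleftrightarrow> pt s v = pt t w"
  using eq_equiv_class_iff[OF equiv_gluing, of "(s, v)" "(t, w)"] by (auto simp: pt_def)

lemma pt_right: "pt s (1, t) = pt (r s) (0, t)" if "s \<in> S" "t \<in> {0..1}"
proof -
  have "((s, (1, t)), (r s, (0, t))) \<in> side_gluing S r u"
    unfolding side_gluing_def using that by blast
  then have "((s, (1, t)), (r s, (0, t))) \<in> gluing"
    by blast
  then show ?thesis
    unfolding pt_def by (rule equiv_class_eq[OF equiv_gluing])
qed

lemma pt_up: "pt s (t, 1) = pt (u s) (t, 0)" if "s \<in> S" "t \<in> {0..1}"
proof -
  have "((s, (t, 1)), (u s, (t, 0))) \<in> side_gluing S r u"
    unfolding side_gluing_def using that by blast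
  then have "((s, (t, 1)), (u s, (t, 0))) \<in> gluing"
    by blast
  then show ?thesis
    unfolding pt_def by (rule equiv_class_eq[OF equiv_gluing])
qed

text \<open>
  The class of a point under the generated equivalence is never computed. Whatever has to be known about
  it is read off from suitable functions that take equal values on the two sides of every gluing.
\<close>
lemma gluing_invariant:
  assumes "pt s v = pt s' v'"
    and right: "\<And>s t. s \<in> S \<Longrightarrow> t \<in> {0..1} \<Longrightarrow> F s (1, t) = F (r s) (0, t)"
    and up: "\<And>s t. s \<in> S \<Longrightarrow> t \<in> {0..1} \<Longrightarrow> F s (t, 1) = F (u s) (t, 0)"
  shows "F s v = F s' v'"
proof -
  have "F (fst x) (snd x) = F (fst y) (snd y)" if "(x, y) \<in> gluing" for x y
    using that
  proof (induction rule: rtrancl_induct)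
    case (step y z)
    then show ?case
      using right up by (auto simp: side_gluing_def)
  qed simp
  moreover have "((s, v), (s', v')) \<in> gluing"
    using assms(1) unfolding pt_def by (rule eq_equiv_class[OF _ equiv_gluing]) simp
  ultimately show ?thesis
    by fastforce
qed

lemma topspace_M: "topspace M = {pt s v | s v. s \<in> S \<and> v \<in> unit_square}"
proof -
  have "topspace (squares_top S) = S \<times> unit_square"
    by (simp add: squares_top_def)
  moreover have "(\<Union>x\<in>A \<times> B. {f x}) = {f (s, v) | s v. s \<in> A \<and> v \<in> B}"
    for A :: "'s set" and B :: "(real \<times> real) set" and f :: "'s \<times> (real \<times> real) \<Rightarrow> ('s \<times> (real \<times> real)) set"
    by auto
  ultimately show ?thesis
    unfolding square_tiled_def topspace_quotient_top quotient_def pt_def by (simp only:)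
qed

lemma pt_in_M [simp]: "s \<in> S \<Longrightarrow> v \<in> unit_square \<Longrightarrow> pt s v \<in> topspace M"
  unfolding topspace_M by blast

lemma in_M_cases:
  assumes "x \<in> topspace M"
  obtains s v where "x = pt s v" "s \<in> S" "v \<in> unit_square"
  using assms by (auto simp: topspace_M)

text \<open>
  The squares form a topological sum before gluing, so openness is tested square by square.
\<close>
lemma openin_M:
  "openin M U \<longleftrightarrow> U \<subseteq> topspace M \<and> (\<forall>s\<in>S. openin (top_of_set unit_square) {v \<in> unit_square. pt s v \<in> U})"
proof -
  have "{v \<in> unit_square. (s, v) \<in> {x \<in> topspace (squares_top S). gluing `` {x} \<in> U}} = {v \<in> unit_square. pt s v \<in> U}"
    if "s \<in> S" for s
    using that by (auto simp: pt_def squares_top_def)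
  then show ?thesis
    unfolding square_tiled_def openin_quotient_top openin_squares_top topspace_quotient_top
    by (auto simp: squares_top_def cong: ball_cong)
qed

lemma quotient_map_pt: "quotient_map (squares_top S) M (\<lambda>x. pt (fst x) (snd x))"
  using quotient_map_quotient_top[of "squares_top S" gluing] by (simp add: square_tiled_def pt_def)

lemma continuous_map_pt: "s \<in> S \<Longrightarrow> continuous_map (top_of_set unit_square) M (pt s)"
  by (auto simp: continuous_map_def openin_M)

lemma continuous_map_from_M:
  assumes "\<And>s. s \<in> S \<Longrightarrow> continuous_map (top_of_set unit_square) Y (\<lambda>v. f (pt s v))"
  shows "continuous_map M Y f"
  unfolding continuous_map_def
proof (intro conjI allI impI)
  show "f \<in> topspace M \<rightarrow> topspace Y"
    using assms continuous_map_funspace by (fastforce simp: topspace_M simp del: atLeastAtMost_iff)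
  fix V assume "openin Y V"
  then have "openin (top_of_set unit_square) {v \<in> unit_square. f (pt s v) \<in> V}" if "s \<in> S" for s
    using openin_continuous_map_preimage[OF assms[OF that]] by simp
  then show "openin M {x \<in> topspace M. f x \<in> V}"
    by (auto simp: openin_M cong: conj_cong)
qed

text \<open>
  A function given square by square descends to the surface when it respects the gluings; the value is
  taken at an arbitrary representative that lies in a square.
\<close>
definition glue_map :: "('s \<Rightarrow> real \<times> real \<Rightarrow> 'b) \<Rightarrow> ('s \<times> (real \<times> real)) set \<Rightarrow> 'b" where
  "glue_map F P = (let x = SOME x. x \<in> P \<and> x \<in> S \<times> unit_square in F (fst x) (snd x))"

lemma glue_map_pt:
  assumes "s \<in> S" "v \<in> unit_square"
    and "\<And>s t. s \<in> S \<Longrightarrow> t \<in> {0..1} \<Longrightarrow> F s (1, t) = F (r s) (0, t)"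
    and "\<And>s t. s \<in> S \<Longrightarrow> t \<in> {0..1} \<Longrightarrow> F s (t, 1) = F (u s) (t, 0)"
  shows "glue_map F (pt s v) = F s v"
proof -
  define x where "x = (SOME x. x \<in> pt s v \<and> x \<in> S \<times> unit_square)"
  have "x \<in> pt s v \<and> x \<in> S \<times> unit_square"
    unfolding x_def by (rule someI[of _ "(s, v)"]) (use assms in \<open>simp add: mem_pt\<close>)
  then have "pt s v = pt (fst x) (snd x)"
    by (metis mem_pt prod.collapse)
  then have "F s v = F (fst x) (snd x)"
    by (rule gluing_invariant[OF _ assms(3,4)])
  then show ?thesis
    by (simp add: glue_map_def Let_def x_def)
qed

lemma origami_proj_pt: "origami_proj (pt s v) = lattice_rel `` {v}"
proof -
  have "lattice_rel `` {v} = lattice_rel `` {w}" if "(t, w) \<in> pt s v" for t w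
    using that unfolding mem_pt
    by (rule gluing_invariant) (auto simp: lattice_class_eq_iff)
  then have "lattice_rel `` {snd x} = lattice_rel `` {v}" if "x \<in> pt s v" for x
    using that by (metis prod.collapse)
  moreover have "lattice_rel `` (snd ` pt s v) = (\<Union>x\<in>pt s v. lattice_rel `` {snd x})"
    by auto
  moreover have "(s, v) \<in> pt s v"
    by (simp add: mem_pt)
  ultimately show ?thesis
    unfolding origami_proj_def by auto
qed

end

lemma (in square_surface) continuous_map_proj: "continuous_map M torus origami_proj"
proof (rule continuous_map_from_M)
  fix s assume "s \<in> S"
  show "continuous_map (top_of_set unit_square) torus (\<lambda>v. origami_proj (pt s v))"
    unfolding origami_proj_pt
    by (rule continuous_map_from_subtopology[OF quotient_imp_continuous_map[OF quotient_map_torus]])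
qed

section \<open>Star neighbourhoods\<close>

text \<open>
  A point of the surface with coordinate \<open>x0\<close> in one of its squares has a product neighbourhood. In a
  coordinate with \<open>0 < x0 < 1\<close> the neighbourhood is the whole open interval and is contracted to \<open>x0\<close>. For
  \<open>x0 \<in> {0, 1}\<close> the coordinate lies on a side of the square: the neighbourhood consists of all points
  but the middle \<open>1/2\<close>, and each point moves to the nearer of the two sides. The endpoints \<open>0\<close> and \<open>1\<close> are
  treated alike because gluing exchanges them.
\<close>
definition centre :: "real \<Rightarrow> real \<Rightarrow> real" where
  "centre x0 t = (if x0 \<in> {0, 1} then (if t < 1/2 then 0 else 1) else x0)"

definition star_dom :: "real \<Rightarrow> real set" where
  "star_dom x0 = (if x0 \<in> {0, 1} then - {1/2} else {0<..<1})"

definition radial :: "real \<Rightarrow> real \<Rightarrow> real \<Rightarrow> real" where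
  "radial x0 l t = (1 - l) * centre x0 t + l * t"

lemma open_centre_eq: "open {t. t \<in> star_dom x0 \<and> centre x0 t = i}"
proof -
  have "{t. t \<in> star_dom x0 \<and> centre x0 t = i} \<in> {{}, {..<1/2}, {1/2<..}, {0<..<1}}"
    by (auto simp: star_dom_def centre_def)
  then show ?thesis
    by (elim insertE emptyE; simp only: open_empty open_lessThan open_greaterThan open_greaterThanLessThan)
qed

text \<open>
  The centre is locally constant on the domain, so any condition on centres is open.
\<close>
lemma open_centre_pred:
  "open {w. fst w \<in> star_dom x0 \<and> snd w \<in> star_dom y0 \<and> R (centre x0 (fst w)) (centre y0 (snd w))}"
proof -
  have "{w. fst w \<in> star_dom x0 \<and> snd w \<in> star_dom y0 \<and> R (centre x0 (fst w)) (centre y0 (snd w))} =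
    (\<Union>(i, j) \<in> {(i, j). R i j}. {t. t \<in> star_dom x0 \<and> centre x0 t = i} \<times> {t. t \<in> star_dom y0 \<and> centre y0 t = j})"
    by auto
  also have "open \<dots>"
    by (intro open_UN ballI) (auto intro!: open_Times open_centre_eq)
  finally show ?thesis .
qed

lemma continuous_on_centre: "continuous_on (star_dom x0) (centre x0)"
proof -
  have "open (star_dom x0)"
    by (auto simp: star_dom_def)
  moreover have "open (centre x0 -` B \<inter> star_dom x0)" for B
  proof -
    have "centre x0 -` B \<inter> star_dom x0 = (\<Union>i\<in>B. {t. t \<in> star_dom x0 \<and> centre x0 t = i})"
      by auto
    then show ?thesis
      by (simp add: open_UN open_centre_eq)
  qed
  ultimately show ?thesis
    by (simp add: continuous_on_open_vimage)
qed

lemma centre_self: "centre x x = x"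
  by (auto simp: centre_def)

lemma star_dom_self: "x \<in> {0..1} \<Longrightarrow> x \<in> star_dom x"
  by (auto simp: star_dom_def)

lemma star_dom_01: "1 \<in> star_dom x0 \<longleftrightarrow> x0 \<in> {0, 1}" "0 \<in> star_dom x0 \<longleftrightarrow> x0 \<in> {0, 1}"
  by (auto simp: star_dom_def)

lemma radial_01:
  "x0 \<in> {0, 1} \<Longrightarrow> radial x0 l 1 = 1" "x0 \<in> {0, 1} \<Longrightarrow> radial x0 l 0 = 0"
  by (auto simp: radial_def centre_def)

lemma radial_end [simp]: "radial x0 1 t = t" "radial x0 0 t = centre x0 t"
  by (simp_all add: radial_def)

lemma centre_in: "x0 \<in> {0..1} \<Longrightarrow> centre x0 t \<in> {0..1}"
  by (auto simp: centre_def)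

lemma radial_in:
  assumes "x0 \<in> {0..1}" "l \<in> {0..1}" "t \<in> {0..1}" 
  shows "radial x0 l t \<in> {0..1}"
  using convexD[OF convex_real_interval(5) centre_in[OF assms(1), of t] assms(3), of "1 - l" l] assms
  by (simp add: radial_def)

text \<open>
  A coordinate in the unit interval is determined by its class modulo \<open>\<int>\<close>, except that \<open>0\<close> and \<open>1\<close> have
  the same class, and these two are treated alike.
\<close>
lemma centre_star_dom_cong:
  assumes "x \<in> {0..1}" "y \<in> {0..1}" "y - x \<in> \<int>"
  shows "centre x = centre y" "star_dom x = star_dom y"
proof -
  have "x = y \<or> x \<in> {0, 1} \<and> y \<in> {0, 1}"
  proof -
    obtain z where z: "y - x = of_int z"
      using assms(3) by (auto elim: Ints_cases)
    with assms have "of_int z \<le> (1 :: real)" "- 1 \<le> (of_int z :: real)"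
      by auto
    then have "z = -1 \<or> z = 0 \<or> z = 1"
      by linarith
    with z assms show ?thesis by auto
  qed
  then show "centre x = centre y" "star_dom x = star_dom y"
    by (auto simp: centre_def star_dom_def fun_eq_iff)
qed

context square_surface
begin

text \<open>
  At time \<open>l\<close> each point of the region is moved along a straight segment of its square; \<open>l = 0\<close> gives the
  centres and \<open>l = 1\<close> the identity. The value \<open>{}\<close> marks the points outside the region: it is not a point of
  the surface, and it is compatible with the gluings because both sides of a gluing are outside together.
\<close>
definition contraction :: "real \<times> real \<Rightarrow> real \<Rightarrow> ('s \<times> (real \<times> real)) set \<Rightarrow> ('s \<times> (real \<times> real)) set" where
  "contraction v l = glue_map (\<lambda>s w. if fst w \<in> star_dom (fst v) \<and> snd w \<in> star_dom (snd v)
     then pt s (radial (fst v) l (fst w), radial (snd v) l (snd w)) else {})"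

text \<open>
  The region on which the contraction is defined may have several centres; the star of \<open>P\<close> is the part that
  is contracted to \<open>P\<close>.
\<close>
definition star_region :: "real \<times> real \<Rightarrow> ('s \<times> (real \<times> real)) set set" where
  "star_region v = {x \<in> topspace M. contraction v 1 x \<noteq> {}}"

definition star :: "real \<times> real \<Rightarrow> ('s \<times> (real \<times> real)) set \<Rightarrow> ('s \<times> (real \<times> real)) set set" where
  "star v P = {x \<in> star_region v. contraction v 0 x = P}"

lemma pt_nonempty [simp]: "pt s v \<noteq> {}"
  using mem_pt[of s v s v] by auto

lemma contraction_pt:
  assumes "s \<in> S" "w \<in> unit_square" "v \<in> unit_square" "l \<in> {0..1}"
  shows "contraction v l (pt s w) = (if fst w \<in> star_dom (fst v) \<and> snd w \<in> star_dom (snd v)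
     then pt s (radial (fst v) l (fst w), radial (snd v) l (snd w)) else {})"
  unfolding contraction_def
proof (rule glue_map_pt[OF assms(1,2)])
  have rad: "radial (fst v) l t \<in> {0..1}" "radial (snd v) l t \<in> {0..1}" if "t \<in> {0..1}" for t
    using assms that by (auto intro!: radial_in simp del: atLeastAtMost_iff)
  fix s t assume s: "s \<in> S" and t: "t \<in> {0..1 :: real}"
  have "pt s (radial (fst v) l 1, radial (snd v) l t) = pt (r s) (radial (fst v) l 0, radial (snd v) l t)"
    if "fst v \<in> {0, 1}"
    using that pt_right[OF s rad(2)[OF t]] by (simp only: radial_01)
  then show "(if fst (1, t) \<in> star_dom (fst v) \<and> snd (1, t) \<in> star_dom (snd v)
          then pt s (radial (fst v) l (fst (1, t)), radial (snd v) l (snd (1, t))) else {}) =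
         (if fst (0, t) \<in> star_dom (fst v) \<and> snd (0, t) \<in> star_dom (snd v)
          then pt (r s) (radial (fst v) l (fst (0, t)), radial (snd v) l (snd (0, t))) else {})"
    by (simp only: fst_conv snd_conv star_dom_01 cong: if_cong)
  have "pt s (radial (fst v) l t, radial (snd v) l 1) = pt (u s) (radial (fst v) l t, radial (snd v) l 0)"
    if "snd v \<in> {0, 1}"
    using that pt_up[OF s rad(1)[OF t]] by (simp only: radial_01)
  then show "(if fst (t, 1) \<in> star_dom (fst v) \<and> snd (t, 1) \<in> star_dom (snd v)
          then pt s (radial (fst v) l (fst (t, 1)), radial (snd v) l (snd (t, 1))) else {}) =
         (if fst (t, 0) \<in> star_dom (fst v) \<and> snd (t, 0) \<in> star_dom (snd v)
          then pt (u s) (radial (fst v) l (fst (t, 0)), radial (snd v) l (snd (t, 0))) else {})"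
    by (simp only: fst_conv snd_conv star_dom_01 cong: if_cong)
qed

lemma pt_in_star_region_iff:
  assumes "s \<in> S" "w \<in> unit_square" "v \<in> unit_square"
  shows "pt s w \<in> star_region v \<longleftrightarrow> fst w \<in> star_dom (fst v) \<and> snd w \<in> star_dom (snd v)"
proof -
  have "contraction v 1 (pt s w) = (if fst w \<in> star_dom (fst v) \<and> snd w \<in> star_dom (snd v) then pt s w else {})"
    using contraction_pt[OF assms, of 1] by simp
  then show ?thesis
    unfolding star_region_def using pt_in_M[OF assms(1,2)] by simp
qed

lemma pt_in_star_iff:
  assumes "s \<in> S" "w \<in> unit_square" "v \<in> unit_square"
  shows "pt s w \<in> star v P \<longleftrightarrow> fst w \<in> star_dom (fst v) \<and> snd w \<in> star_dom (snd v) \<and>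
     pt s (centre (fst v) (fst w), centre (snd v) (snd w)) = P"
proof -
  have "contraction v 0 (pt s w) = (if fst w \<in> star_dom (fst v) \<and> snd w \<in> star_dom (snd v)
      then pt s (centre (fst v) (fst w), centre (snd v) (snd w)) else {})"
    using contraction_pt[OF assms, of 0] by simp
  then show ?thesis
    unfolding star_def mem_Collect_eq pt_in_star_region_iff[OF assms] by (simp cong: conj_cong)
qed

lemma openin_star_region:
  assumes v: "v \<in> unit_square"
  shows "openin M (star_region v)" and "openin M (star v P)"
proof -
  have "openin (top_of_set unit_square) {w \<in> unit_square. pt s w \<in> star_region v}"
    "openin (top_of_set unit_square) {w \<in> unit_square. pt s w \<in> star v P}" if s: "s \<in> S" for s
  proof -
    have "{w \<in> unit_square. pt s w \<in> star_region v} =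
      unit_square \<inter> {w. fst w \<in> star_dom (fst v) \<and> snd w \<in> star_dom (snd v) \<and> True}"
      "{w \<in> unit_square. pt s w \<in> star v P} =
      unit_square \<inter> {w. fst w \<in> star_dom (fst v) \<and> snd w \<in> star_dom (snd v) \<and>
        pt s (centre (fst v) (fst w), centre (snd v) (snd w)) = P}"
      using pt_in_star_region_iff[OF s _ v] pt_in_star_iff[OF s _ v, of _ P] by blast+
    then show "openin (top_of_set unit_square) {w \<in> unit_square. pt s w \<in> star_region v}"
      "openin (top_of_set unit_square) {w \<in> unit_square. pt s w \<in> star v P}"
      by (simp_all only: openin_open_Int open_centre_pred[of "fst v" "snd v" "\<lambda>x y. True"]
        open_centre_pred[of "fst v" "snd v" "\<lambda>x y. pt s (x, y) = P"])
  qed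
  then show "openin M (star_region v)" "openin M (star v P)"
    by (auto simp: openin_M star_def star_region_def)
qed

lemma centre_in_star: "s \<in> S \<Longrightarrow> v \<in> unit_square \<Longrightarrow> pt s v \<in> star v (pt s v)"
  by (cases v) (auto simp: pt_in_star_iff centre_self star_dom_self)

text \<open>
  Continuity in time and space together needs that the product of a quotient map with the identity of a
  compact interval is again a quotient map.
\<close>
lemma continuous_map_contraction:
  assumes v: "v \<in> unit_square"
  shows "continuous_map (prod_topology (top_of_set {0..1}) (subtopology M (star_region v))) M
    (\<lambda>(l, x). contraction v l x)"
proof -
  let ?R = "{x \<in> topspace (squares_top S). pt (fst x) (snd x) \<in> star_region v}"
  let ?X = "prod_topology (top_of_set {0..1::real}) (subtopology (squares_top S) ?R)"
  let ?p = "\<lambda>x. pt (fst x) (snd x)"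
  have "quotient_map (subtopology (squares_top S) ?R) (subtopology M (star_region v)) ?p"
    by (rule quotient_map_restriction[OF quotient_map_pt refl]) (simp add: openin_star_region v)
  then have quot: "quotient_map ?X (prod_topology (top_of_set {0..1}) (subtopology M (star_region v)))
      (\<lambda>(l, x). (l, ?p x))"
    by (intro quotient_map_prod_right)
      (auto simp: compact_imp_locally_compact_space compact_space_subtopology Hausdorff_space_subtopology)
  have R: "s \<in> S \<and> w \<in> unit_square \<and> fst w \<in> star_dom (fst v) \<and> snd w \<in> star_dom (snd v)"
    if "(s, w) \<in> ?R" for s w
    using that v by (auto simp: squares_top_def pt_in_star_region_iff)
  have cont_rad: "continuous_map ?X euclideanreal (\<lambda>(l, x). radial x0 l (f (snd x)))"
    if f: "continuous_on UNIV f" and dom: "\<And>s w. (s, w) \<in> ?R \<Longrightarrow> f w \<in> star_dom x0"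
    for f :: "real \<times> real \<Rightarrow> real" and x0
  proof -
    have sq: "continuous_map (squares_top S) euclidean snd"
      unfolding squares_top_def
      using continuous_map_snd[of "discrete_topology S" "top_of_set unit_square"]
      by (simp add: continuous_map_in_subtopology)
    have l: "continuous_map ?X euclideanreal fst"
      using continuous_map_fst[of "top_of_set {0..1::real}" "subtopology (squares_top S) ?R"]
      by (simp add: continuous_map_in_subtopology)
    have x: "continuous_map ?X euclidean (snd \<circ> snd)"
      by (rule continuous_map_compose[OF continuous_map_snd continuous_map_from_subtopology[OF sq]])
    have fx: "continuous_map ?X (top_of_set (star_dom x0)) (f \<circ> (snd \<circ> snd))"
      using continuous_map_compose[OF x, of euclidean f] f dom
      by (auto simp: continuous_map_in_subtopology)
    have c: "continuous_map ?X euclidean (centre x0 \<circ> (f \<circ> (snd \<circ> snd)))"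
      by (rule continuous_map_compose[OF fx]) (simp add: continuous_on_centre)
    have "continuous_map ?X euclidean (f \<circ> (snd \<circ> snd))"
      using fx by (simp add: continuous_map_in_subtopology)
    moreover have "continuous_map X euclideanreal (\<lambda>y. (1 - f y) * g y + f y * h y)"
      if "continuous_map X euclideanreal f" "continuous_map X euclideanreal g" "continuous_map X euclideanreal h"
      for X :: "'z topology" and f g h
      using that by (intro continuous_intros) auto
    ultimately have "continuous_map ?X euclidean
      (\<lambda>y. (1 - fst y) * (centre x0 \<circ> (f \<circ> (snd \<circ> snd))) y + fst y * (f \<circ> (snd \<circ> snd)) y)"
      using l c by blast
    then show ?thesis
      by (simp add: radial_def case_prod_unfold)
  qed
  have "continuous_map ?X (squares_top S)
      (\<lambda>(l, x). (fst x, (radial (fst v) l (fst (snd x)), radial (snd v) l (snd (snd x)))))"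
    unfolding squares_top_def continuous_map_pairwise
  proof (intro conjI)
    have "continuous_map (squares_top S) (discrete_topology S) fst"
      unfolding squares_top_def by (rule continuous_map_fst)
    from continuous_map_compose[OF continuous_map_snd continuous_map_from_subtopology[OF this]]
    show "continuous_map (prod_topology (top_of_set {0..1})
       (subtopology (prod_topology (discrete_topology S) (top_of_set unit_square)) {x \<in> topspace (prod_topology (discrete_topology S) (top_of_set unit_square)). ?p x \<in> star_region v}))
       (discrete_topology S) (fst \<circ> (\<lambda>(l, x). (fst x, (radial (fst v) l (fst (snd x)), radial (snd v) l (snd (snd x))))))"
      by (simp add: squares_top_def o_def case_prod_unfold)
    have "continuous_map ?X (prod_topology euclidean euclidean)
       (\<lambda>y. ((\<lambda>(l, x). radial (fst v) l (fst (snd x))) y, (\<lambda>(l, x). radial (snd v) l (snd (snd x))) y))"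
      by (intro continuous_map_pairedI cont_rad continuous_intros) (use R in blast)+
    moreover have "(radial (fst v) l (fst w), radial (snd v) l (snd w)) \<in> unit_square"
      if "l \<in> {0..1}" "(s, w) \<in> ?R" for l s w
      using R[OF that(2)] that(1) v by (auto intro!: radial_in simp del: atLeastAtMost_iff)
    ultimately show "continuous_map (prod_topology (top_of_set {0..1})
       (subtopology (prod_topology (discrete_topology S) (top_of_set unit_square)) {x \<in> topspace (prod_topology (discrete_topology S) (top_of_set unit_square)). ?p x \<in> star_region v}))
       (top_of_set unit_square) (snd \<circ> (\<lambda>(l, x). (fst x, (radial (fst v) l (fst (snd x)), radial (snd v) l (snd (snd x))))))"
      unfolding continuous_map_in_subtopology
      by (auto simp: squares_top_def o_def case_prod_unfold simp del: atLeastAtMost_iff)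
  qed
  from continuous_map_compose[OF this quotient_imp_continuous_map[OF quotient_map_pt]]
  have "continuous_map ?X M ((\<lambda>(l, x). contraction v l x) \<circ> (\<lambda>(l, x). (l, ?p x)))"
    by (rule continuous_map_eq) (use R v in \<open>auto simp: contraction_pt\<close>)
  then show ?thesis
    using continuous_compose_quotient_map_eq[OF quot] by blast
qed

end

lemma standard_simplex_0_eq: "standard_simplex 0 = {on_edge 0}"
  by (auto simp: standard_simplex_0 on_edge_def fun_eq_iff)

lemma simplical_face_on_edge_0:
  "simplical_face 0 (on_edge 0) = on_edge 1" "simplical_face (Suc 0) (on_edge 0) = on_edge 0"
  by (auto simp: simplical_face_def on_edge_def fun_eq_iff One_nat_def)

lemma continuous_map_on_edge: "continuous_map (top_of_set {0..1}) (simplex_top 1) on_edge"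
proof -
  have "continuous_map (top_of_set {0..1}) euclideanreal (\<lambda>t. on_edge t i)" for i
    by (cases "i = 0"; cases "i = 1") (auto simp: on_edge_def intro!: continuous_intros)
  then show ?thesis
    using on_edge_in_simplex by (auto simp: continuous_map_in_subtopology continuous_map_componentwise_UNIV)
qed

section \<open>The homology of a square-tiled surface is generated by edges\<close>

context square_surface
begin

definition hor :: "'s \<Rightarrow> (nat \<Rightarrow> real) \<Rightarrow> ('s \<times> (real \<times> real)) set" where
  "hor s = segment (pt s) (0, 0) (1, 0)"

definition ver :: "'s \<Rightarrow> (nat \<Rightarrow> real) \<Rightarrow> ('s \<times> (real \<times> real)) set" where
  "ver s = segment (pt s) (0, 0) (0, 1)"

definition edge_chain :: "('s \<Rightarrow> complex) \<Rightarrow> ('s \<Rightarrow> complex) \<Rightarrow> ('s \<times> (real \<times> real)) set cchain" where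
  "edge_chain a b = (\<Sum>s\<in>S. cchain_scale (a s) (csingle (hor s)) + cchain_scale (b s) (csingle (ver s)))"

lemma edge_chain_add: "edge_chain a b + edge_chain a' b' = edge_chain (\<lambda>s. a s + a' s) (\<lambda>s. b s + b' s)"
  by (simp add: edge_chain_def cchain.scale_left_distrib sum.distrib algebra_simps)

lemma edge_chain_scale: "cchain_scale z (edge_chain a b) = edge_chain (\<lambda>s. z * a s) (\<lambda>s. z * b s)"
  by (simp add: edge_chain_def cchain.scale_sum_right cchain.scale_right_distrib)

lemma edge_chain_0: "edge_chain (\<lambda>s. 0) (\<lambda>s. 0) = 0"
  by (simp add: edge_chain_def)

lemma edge_chain_sum: "(\<Sum>i\<in>I. edge_chain (a i) (b i)) = edge_chain (\<lambda>s. \<Sum>i\<in>I. a i s) (\<lambda>s. \<Sum>i\<in>I. b i s)"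
  by (induction I rule: infinite_finite_induct) (simp_all add: edge_chain_0 edge_chain_add)

lemma edge_chain_cong:
  assumes "\<And>s. s \<in> S \<Longrightarrow> a s = a' s" "\<And>s. s \<in> S \<Longrightarrow> b s = b' s"
  shows "edge_chain a b = edge_chain a' b'"
  using assms by (simp add: edge_chain_def)

lemma edge_chain_reindex:
  assumes "bij_betw t S S"
  shows "(\<Sum>s\<in>S. cchain_scale (a s) (csingle (hor (t s))) + cchain_scale (b s) (csingle (ver (t s))))
    = edge_chain (a \<circ> inv_into S t) (b \<circ> inv_into S t)"
  unfolding edge_chain_def
  by (rule sum.reindex_bij_betw[OF assms, symmetric, THEN trans, symmetric])
    (use assms in \<open>simp add: bij_betw_inv_into_left cong: sum.cong\<close>)

lemma corners: "(0, 0) \<in> unit_square" "(1, 0) \<in> unit_square" "(0, 1) \<in> unit_square" "(1, 1) \<in> unit_square"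
  by auto

lemma convex_unit_square: "convex unit_square"
  by (intro convex_Times) auto

lemma square_triangle:
  assumes "s \<in> S" "a \<in> unit_square" "b \<in> unit_square" "c \<in> unit_square"
  shows "csingle (segment (pt s) a b) + csingle (segment (pt s) b c) - csingle (segment (pt s) a c) \<in> cboundaries 1 M"
  by (rule triangle_boundary[OF convex_unit_square continuous_map_pt[OF assms(1)] assms(2-4)])

text \<open>
  The right side of a square is, as a parametrised segment, the left side of the next square, so the two
  singular simplices coincide; the same holds for the upper side.
\<close>
lemma right_side:
  assumes "s \<in> S" "t \<in> {0..1}"
  shows "segment (pt s) (1, 0) (1, t) = segment (pt (r s)) (0, 0) (0, t)"
proof (rule segment_eqI)
  fix x :: real assume x: "x \<in> {0..1}"
  have "x * t \<in> {0..1}"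
    using x assms(2) by (simp add: mult_le_one)
  from pt_right[OF assms(1) this]
  show "pt s ((1 - x) *\<^sub>R (1, 0) + x *\<^sub>R (1, t)) = pt (r s) ((1 - x) *\<^sub>R (0, 0) + x *\<^sub>R (0, t))"
    by simp
qed

lemma upper_side:
  assumes "s \<in> S" "t \<in> {0..1}"
  shows "segment (pt s) (0, 1) (t, 1) = segment (pt (u s)) (0, 0) (t, 0)"
proof (rule segment_eqI)
  fix x :: real assume x: "x \<in> {0..1}"
  have "x * t \<in> {0..1}"
    using x assms(2) by (simp add: mult_le_one)
  from pt_up[OF assms(1) this]
  show "pt s ((1 - x) *\<^sub>R (0, 1) + x *\<^sub>R (t, 1)) = pt (u s) ((1 - x) *\<^sub>R (0, 0) + x *\<^sub>R (t, 0))"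
    by simp
qed

text \<open>
  The diagonal cuts the square into two triangles.
\<close>
lemma square_boundary:
  assumes s: "s \<in> S"
  shows "(csingle (ver (r s)) - csingle (ver s)) - (csingle (hor (u s)) - csingle (hor s)) \<in> cboundaries 1 M"
proof -
  have "csingle (hor s) + csingle (ver (r s)) - csingle (segment (pt s) (0, 0) (1, 1)) \<in> cboundaries 1 M"
    using square_triangle[OF s corners(1,2,4)] right_side[OF s, of 1] by (simp add: hor_def ver_def)
  moreover have "csingle (ver s) + csingle (hor (u s)) - csingle (segment (pt s) (0, 0) (1, 1)) \<in> cboundaries 1 M"
    using square_triangle[OF s corners(1,3,4)] upper_side[OF s, of 1] by (simp add: hor_def ver_def)
  ultimately have "(csingle (hor s) + csingle (ver (r s)) - csingle (segment (pt s) (0, 0) (1, 1)))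
      - (csingle (ver s) + csingle (hor (u s)) - csingle (segment (pt s) (0, 0) (1, 1))) \<in> cboundaries 1 M"
    by (rule cchain.subspace_diff[OF subspace_cboundaries])
  then show ?thesis
    by (simp add: algebra_simps)
qed

text \<open>
  Paths that are not closed can be compared only modulo these chains; closed ones turn out to be among them.
\<close>
definition edge_classes :: "('s \<times> (real \<times> real)) set cchain set" where
  "edge_classes = {c. \<exists>a b. c - edge_chain a b \<in> cboundaries 1 M}"

lemma edge_classesI: "c - edge_chain a b \<in> cboundaries 1 M \<Longrightarrow> c \<in> edge_classes"
  by (auto simp: edge_classes_def)

lemma boundary_in_edge_classes: "c \<in> cboundaries 1 M \<Longrightarrow> c \<in> edge_classes"
  by (rule edge_classesI[of _ "\<lambda>s. 0" "\<lambda>s. 0"]) (simp add: edge_chain_0)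

lemma subspace_edge_classes: "cchain.subspace edge_classes"
  unfolding cchain.subspace_def
proof (intro conjI ballI allI)
  show "0 \<in> edge_classes"
    by (intro boundary_in_edge_classes cchain.subspace_0 subspace_cboundaries)
  fix c z assume "c \<in> edge_classes"
  then obtain a b where c: "c - edge_chain a b \<in> cboundaries 1 M"
    by (auto simp: edge_classes_def)
  show "cchain_scale z c \<in> edge_classes"
    using cchain.subspace_scale[OF subspace_cboundaries c, of z]
    by (intro edge_classesI[of _ "\<lambda>s. z * a s" "\<lambda>s. z * b s"])
      (simp add: cchain.scale_right_diff_distrib edge_chain_scale)
  fix c' assume "c' \<in> edge_classes"
  then obtain a' b' where c': "c' - edge_chain a' b' \<in> cboundaries 1 M"
    by (auto simp: edge_classes_def)
  have "c + c' - edge_chain (\<lambda>s. a s + a' s) (\<lambda>s. b s + b' s) =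
      (c - edge_chain a b) + (c' - edge_chain a' b')"
    by (simp add: edge_chain_add[symmetric])
  then show "c + c' \<in> edge_classes"
    using cchain.subspace_add[OF subspace_cboundaries c c'] edge_classesI by metis
qed

lemma edge_in_edge_classes:
  assumes "s \<in> S"
  shows "csingle (hor s) \<in> edge_classes" "csingle (ver s) \<in> edge_classes"
proof -
  have *: "(\<Sum>t\<in>S. cchain_scale (if t = s then 1 else 0) (f t)) = f s"
    for f :: "'s \<Rightarrow> ('s \<times> (real \<times> real)) set cchain"
    using sum.delta[OF finite_S, of s f] assms by (simp add: if_distrib[of "\<lambda>z. cchain_scale z _"] cong: if_cong)
  have "csingle (hor s) = edge_chain (\<lambda>t. if t = s then 1 else 0) (\<lambda>_. 0)"
    "csingle (ver s) = edge_chain (\<lambda>_. 0) (\<lambda>t. if t = s then 1 else 0)"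
    by (simp_all add: edge_chain_def * del: if_cancel)
  then show "csingle (hor s) \<in> edge_classes" "csingle (ver s) \<in> edge_classes"
    by (metis edge_classesI cancel_comm_monoid_add_class.diff_cancel cchain.subspace_0 subspace_cboundaries)+
qed

text \<open>
  Straight segments from the lower left corner serve as paths from a base point to each point of the square.
\<close>
definition ray :: "'s \<Rightarrow> real \<times> real \<Rightarrow> ('s \<times> (real \<times> real)) set cchain" where
  "ray s w = csingle (segment (pt s) (0, 0) w)"

lemma segment_ray:
  assumes "s \<in> S" "v \<in> unit_square" "w \<in> unit_square"
  shows "csingle (segment (pt s) v w) - (ray s w - ray s v) \<in> cboundaries 1 M"
  using square_triangle[OF assms(1) corners(1) assms(2,3)] by (simp add: ray_def algebra_simps)

lemma ray_right:
  assumes s: "s \<in> S" and t: "t \<in> {0..1}"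
  shows "ray s (1, t) - ray (r s) (0, t) \<in> edge_classes"
proof -
  have "(1, t) \<in> unit_square" using t by simp
  from segment_ray[OF s corners(2) this]
  have "ray (r s) (0, t) - (ray s (1, t) - csingle (hor s)) \<in> edge_classes"
    by (intro boundary_in_edge_classes) (simp add: right_side[OF s t] ray_def hor_def)
  from cchain.subspace_diff[OF subspace_edge_classes edge_in_edge_classes(1)[OF s] this]
  show ?thesis by (simp add: algebra_simps)
qed

lemma ray_up:
  assumes s: "s \<in> S" and t: "t \<in> {0..1}"
  shows "ray s (t, 1) - ray (u s) (t, 0) \<in> edge_classes"
proof -
  have "(t, 1) \<in> unit_square" using t by simp
  from segment_ray[OF s corners(3) this]
  have "ray (u s) (t, 0) - (ray s (t, 1) - csingle (ver s)) \<in> edge_classes"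
    by (intro boundary_in_edge_classes) (simp add: upper_side[OF s t] ray_def ver_def)
  from cchain.subspace_diff[OF subspace_edge_classes edge_in_edge_classes(2)[OF s] this]
  show ?thesis by (simp add: algebra_simps)
qed

text \<open>
  On the right side of \<open>s\<close>, the ray of \<open>s\<close> and the ray of the next square differ by the bottom edge of \<open>s\<close> and
  a triangle. So, modulo edges, the ray depends only on the point of the surface.
\<close>
lemma ray_unique:
  assumes "pt s v = pt s' v'"
  shows "ray s v - ray s' v' \<in> edge_classes"
proof -
  have eq: "{c. c - x \<in> edge_classes} = {c. c - y \<in> edge_classes}" if "x - y \<in> edge_classes" for x y
  proof -
    have "c - x \<in> edge_classes \<longleftrightarrow> c - y \<in> edge_classes" for c
      using cchain.subspace_add[OF subspace_edge_classes _ that, of "c - x"]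
        cchain.subspace_diff[OF subspace_edge_classes _ that, of "c - y"] by auto
    then show ?thesis by simp
  qed
  have "{c. c - ray s v \<in> edge_classes} = {c. c - ray s' v' \<in> edge_classes}"
    by (rule gluing_invariant[OF assms]) (intro eq ray_right ray_up; assumption)+
  then show ?thesis
    using cchain.subspace_0[OF subspace_edge_classes] by auto
qed

definition ray_to :: "('s \<times> (real \<times> real)) set \<Rightarrow> ('s \<times> (real \<times> real)) set cchain" where
  "ray_to P = (let x = SOME x. x \<in> P in ray (fst x) (snd x))"

lemma ray_to_pt: "ray s v - ray_to (pt s v) \<in> edge_classes"
proof -
  define x where "x = (SOME x. x \<in> pt s v)"
  have "x \<in> pt s v"
    unfolding x_def by (rule someI[of _ "(s, v)"]) (simp add: mem_pt)
  then have "pt s v = pt (fst x) (snd x)"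
    by (metis mem_pt prod.collapse)
  from ray_unique[OF this] show ?thesis
    by (simp add: ray_to_def Let_def x_def)
qed

lemma segment_ray_to:
  assumes "s \<in> S" "v \<in> unit_square" "w \<in> unit_square"
  shows "csingle (segment (pt s) v w) - (ray_to (pt s w) - ray_to (pt s v)) \<in> edge_classes"
proof -
  have "csingle (segment (pt s) v w) - (ray_to (pt s w) - ray_to (pt s v)) =
    (csingle (segment (pt s) v w) - (ray s w - ray s v)) +
    ((ray s w - ray_to (pt s w)) - (ray s v - ray_to (pt s v)))"
    by simp
  also have "\<dots> \<in> edge_classes"
    by (rule cchain.subspace_add[OF subspace_edge_classes
        boundary_in_edge_classes[OF segment_ray[OF assms]]
        cchain.subspace_diff[OF subspace_edge_classes ray_to_pt ray_to_pt]])
  finally show ?thesis .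
qed

text \<open>
  The contraction sweeps out a square \<open>[0, 1] \<times> [a, b]\<close> in the surface. The side \<open>l = 1\<close> is the path, the side
  \<open>l = 0\<close> is constant, and the two remaining sides are straight segments inside squares. Cutting the square
  along a diagonal shows that the path is homologous to the difference of these two segments.
\<close>
lemma cone_over_path:
  fixes a b :: real
  assumes v: "v \<in> unit_square" and ab: "a \<le> b"
    and g: "continuous_map (top_of_set {a..b}) M g" and star: "g ` {a..b} \<subseteq> star v P"
  shows "csingle (segment g a b) - (ray_to (g b) - ray_to (g a)) \<in> edge_classes"
proof -
  let ?D = "{0..1} \<times> {a..b} :: (real \<times> real) set"
  define F where "F = (\<lambda>(l, t). contraction v l (g t))"
  have D: "convex ?D"
    by (intro convex_Times) auto
  have "g ` {a..b} \<subseteq> star_region v"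
    using star by (auto simp: star_def)
  then have g': "continuous_map (top_of_set {a..b}) (subtopology M (star_region v)) g"
    using g by (auto simp: continuous_map_in_subtopology)
  have prod: "continuous_map (prod_topology (top_of_set {0..1}) (top_of_set {a..b}))
      (prod_topology (top_of_set {0..1}) (subtopology M (star_region v))) (\<lambda>(l, t). (l, g t))"
    using g' by (intro continuous_map_prod_top[THEN iffD2]) auto
  have "F = (\<lambda>(l, x). contraction v l x) \<circ> (\<lambda>(l, t). (l, g t))"
    by (auto simp: F_def)
  with continuous_map_compose[OF prod continuous_map_contraction[OF v]]
  have F: "continuous_map (top_of_set ?D) M F"
    by (simp only: prod_topology_subtopology_eu)
  have pts: "(0, a) \<in> ?D" "(0, b) \<in> ?D" "(1, a) \<in> ?D" "(1, b) \<in> ?D"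
    using ab by auto
  have F0: "F (0, t) = P" and F1: "F (1, t) = g t" and
    radius: "csingle (segment F (0, t) (1, t)) - (ray_to (g t) - ray_to P) \<in> edge_classes"
    if t: "t \<in> {a..b}" for t
  proof -
    have gt: "g t \<in> star v P"
      using star t by blast
    then have "g t \<in> topspace M"
      by (auto simp: star_def star_region_def)
    then obtain s w where s: "s \<in> S" and w: "w \<in> unit_square" and gt_eq: "g t = pt s w"
      by (elim in_M_cases)
    let ?c = "(centre (fst v) (fst w), centre (snd v) (snd w))"
    have dom: "fst w \<in> star_dom (fst v) \<and> snd w \<in> star_dom (snd v)" and P: "pt s ?c = P"
      using gt pt_in_star_iff[OF s w v] by (simp_all add: gt_eq)
    have F_eq: "F (l, t) = pt s (radial (fst v) l (fst w), radial (snd v) l (snd w))" if "l \<in> {0..1}" for l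
      using contraction_pt[OF s w v that] dom by (simp add: F_def gt_eq)
    show "F (0, t) = P" "F (1, t) = g t"
      using F_eq[of 0] F_eq[of 1] P gt_eq by simp_all
    have c: "?c \<in> unit_square"
      using v by (simp add: centre_in mem_Times_iff del: atLeastAtMost_iff)
    have "segment F (0, t) (1, t) = segment (pt s) ?c w"
    proof (rule segment_eqI)
      fix l :: real assume "l \<in> {0..1}"
      moreover have "(1 - l) *\<^sub>R (0, t) + l *\<^sub>R (1, t) = (l, t)"
        by (simp add: algebra_simps)
      moreover have "(1 - l) *\<^sub>R ?c + l *\<^sub>R w = (radial (fst v) l (fst w), radial (snd v) l (snd w))"
        by (simp add: radial_def prod_eq_iff)
      ultimately show "F ((1 - l) *\<^sub>R (0, t) + l *\<^sub>R (1, t)) = pt s ((1 - l) *\<^sub>R ?c + l *\<^sub>R w)"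
        by (simp add: F_eq)
    qed
    with segment_ray_to[OF s c w]
    show "csingle (segment F (0, t) (1, t)) - (ray_to (g t) - ray_to P) \<in> edge_classes"
      by (simp add: gt_eq P)
  qed
  have t_in: "(1 - t) * a + t * b \<in> {a..b}" if "t \<in> {0..1}" for t
    using convexD[of "{a..b}" a b "1 - t" t] ab that by auto
  have "segment F (0, a) (0, b) = segment F (0, a) (0, a)"
    by (rule segment_eqI) (use t_in F0 ab in \<open>simp add: algebra_simps\<close>)
  then have "csingle (segment F (0, a) (0, b)) \<in> cboundaries 1 M"
    using segment_const_boundary[OF D F pts(1)] by simp
  moreover have "segment F (1, a) (1, b) = segment g a b"
  proof (rule segment_eqI)
    fix t :: real assume "t \<in> {0..1}"
    moreover have "(1 - t) *\<^sub>R (1, a) + t *\<^sub>R (1, b) = (1, (1 - t) * a + t * b)"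
      by (simp add: algebra_simps)
    ultimately show "F ((1 - t) *\<^sub>R (1, a) + t *\<^sub>R (1, b)) = g ((1 - t) *\<^sub>R a + t *\<^sub>R b)"
      using F1[OF t_in] by simp
  qed
  moreover note triangle_boundary[OF D F pts(1,3,4)] triangle_boundary[OF D F pts(1,2,4)]
  ultimately have tri: "csingle (segment F (0, a) (0, b)) \<in> edge_classes"
    "csingle (segment F (0, a) (1, a)) + csingle (segment g a b) - csingle (segment F (0, a) (1, b)) \<in> edge_classes"
    "csingle (segment F (0, a) (0, b)) + csingle (segment F (0, b) (1, b)) - csingle (segment F (0, a) (1, b)) \<in> edge_classes"
    by (simp_all add: boundary_in_edge_classes)
  have rad: "csingle (segment F (0, a) (1, a)) - (ray_to (g a) - ray_to P) \<in> edge_classes"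
    "csingle (segment F (0, b) (1, b)) - (ray_to (g b) - ray_to P) \<in> edge_classes"
    using radius ab by simp_all
  define x y z w k where "x = csingle (segment F (0, a) (0, b))" and "y = csingle (segment F (0, a) (1, a))"
    and "z = csingle (segment F (0, b) (1, b))" and "w = csingle (segment F (0, a) (1, b))"
    and "k = csingle (segment g a b)"
  have "k - (ray_to (g b) - ray_to (g a)) =
      ((y + k - w) - (x + z - w) + x) + ((z - (ray_to (g b) - ray_to P)) - (y - (ray_to (g a) - ray_to P)))"
    by simp
  also have "\<dots> \<in> edge_classes"
    unfolding x_def y_def z_def w_def k_def
    by (rule cchain.subspace_add[OF subspace_edge_classes
          cchain.subspace_add[OF subspace_edge_classes
            cchain.subspace_diff[OF subspace_edge_classes tri(2,3)] tri(1)]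
          cchain.subspace_diff[OF subspace_edge_classes rad(2,1)]])
  finally show ?thesis
    by (simp add: k_def)
qed

text \<open>
  The property holds for short pieces by the cone construction, and it passes from two adjacent pieces to
  their union; the Bolzano bisection principle extends it to the whole interval.
\<close>
lemma path_in_edge_classes:
  fixes g :: "real \<Rightarrow> ('s \<times> (real \<times> real)) set"
  assumes g: "continuous_map (top_of_set {0..1}) M g"
  shows "csingle (segment g 0 1) - (ray_to (g 1) - ray_to (g 0)) \<in> edge_classes"
proof -
  define Q where "Q = (\<lambda>a b :: real. a \<in> {0..1} \<longrightarrow> b \<in> {0..1} \<longrightarrow>
      csingle (segment g a b) - (ray_to (g b) - ray_to (g a)) \<in> edge_classes)"
  have "0 \<le> (1 :: real)" by simp
  then have "Q 0 1"
  proof (induction rule: Bolzano)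
    case (trans a b c)
    show ?case
      unfolding Q_def
    proof (intro impI)
      assume ac: "a \<in> {0..1}" "c \<in> {0..1}"
      with trans have b: "b \<in> {0..1}" by auto
      have tri: "csingle (segment g a b) + csingle (segment g b c) - csingle (segment g a c) \<in> edge_classes"
        by (intro boundary_in_edge_classes triangle_boundary[OF _ g ac(1) b ac(2)]) auto
      have 1: "csingle (segment g a b) - (ray_to (g b) - ray_to (g a)) \<in> edge_classes"
        "csingle (segment g b c) - (ray_to (g c) - ray_to (g b)) \<in> edge_classes"
        using trans ac b by (auto simp: Q_def)
      show "csingle (segment g a c) - (ray_to (g c) - ray_to (g a)) \<in> edge_classes"
        using cchain.subspace_diff[OF subspace_edge_classes
            cchain.subspace_add[OF subspace_edge_classes 1] tri] by (simp add: algebra_simps)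
    qed
  next
    case (local x)
    then have x: "x \<in> {0..1}" by simp
    then have "g x \<in> topspace M"
      using continuous_map_funspace[OF g] by auto
    then obtain s v where gx: "g x = pt s v" and s: "s \<in> S" and v: "v \<in> unit_square"
      by (rule in_M_cases)
    have "openin (top_of_set {0..1}) {t \<in> {0..1}. g t \<in> star v (pt s v)}"
      using openin_continuous_map_preimage[OF g openin_star_region(2)[OF v, of "pt s v"]] by simp
    moreover have "x \<in> {t \<in> {0..1}. g t \<in> star v (pt s v)}"
      using x centre_in_star[OF s v] by (simp add: gx)
    ultimately obtain d where d: "d > 0" "\<And>t. t \<in> {0..1} \<Longrightarrow> dist t x < d \<Longrightarrow> g t \<in> star v (pt s v)"
      unfolding openin_euclidean_subtopology_iff by blast
    show ?case
    proof (intro exI[of _ d] conjI allI impI d(1))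
      fix a b assume ab: "a \<le> x \<and> x \<le> b \<and> b - a < d"
      show "Q a b"
        unfolding Q_def
      proof (intro impI)
        assume a: "a \<in> {0..1}" and b: "b \<in> {0..1}"
        have sub: "{a..b} \<subseteq> {0..1}" using a b by auto
        show "csingle (segment g a b) - (ray_to (g b) - ray_to (g a)) \<in> edge_classes"
        proof (rule cone_over_path[OF v])
          show "continuous_map (top_of_set {a..b}) M g"
            using g sub by (rule continuous_map_from_subtopology_mono)
          show "g ` {a..b} \<subseteq> star v (pt s v)"
            using ab sub by (auto intro!: d(2) simp: dist_real_def)
        qed (use ab in simp)
      qed
    qed
  qed
  then show ?thesis
    by (simp add: Q_def)
qed

text \<open>
  Each simplex of a cycle is replaced, modulo edges, by the difference of the rays to its two ends. The rays
  then cancel because the boundary of the cycle vanishes.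
\<close>
theorem cycle_in_edge_classes:
  assumes c: "c \<in> ccycles 1 M"
  shows "c \<in> edge_classes"
proof -
  define \<theta> where "\<theta> = (\<lambda>\<tau> :: (nat \<Rightarrow> real) \<Rightarrow> ('s \<times> (real \<times> real)) set. ray_to (\<tau> (on_edge 0)))"
  \<comment> \<open>linear in the chain, so it suffices to examine single simplices; on cycles it is the identity\<close>
  define f where "f = (\<lambda>c. c - cchain_extend \<theta> (cchain_boundary 1 c))"
  have "clinear f"
    by unfold_locales (simp_all add: f_def cchain_boundary_simps clinear_simps[OF linear_cchain_extend]
        cchain.scale_right_diff_distrib)
  then have "f c \<in> edge_classes"
  proof (rule clinear_image_in_subspace[OF _ subspace_edge_classes])
    fix \<sigma> assume "\<sigma> \<in> Poly_Mapping.keys c"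
    then have \<sigma>: "singular_simplex 1 M \<sigma>"
      using c by (auto simp: ccycles_def cchains_def)
    define g where "g = (\<lambda>t. \<sigma> (on_edge t))"
    have "continuous_map (top_of_set {0..1}) M g"
      using continuous_map_compose[OF continuous_map_on_edge] \<sigma>
      unfolding singular_simplex_def g_def o_def by blast
    from path_in_edge_classes[OF this]
    have *: "csingle (segment g 0 1) - (ray_to (g 1) - ray_to (g 0)) \<in> edge_classes" .
    have "segment g 0 1 = \<sigma>"
      by (rule extensional_simplex_1_eqI)
        (use \<sigma> in \<open>auto simp: segment_extensional segment_on_edge singular_simplex_def g_def\<close>)
    moreover have "cchain_extend \<theta> (cchain_boundary 1 (csingle \<sigma>)) = ray_to (g 1) - ray_to (g 0)"
      by (simp add: One_nat_def cchain_boundary_1_csingle clinear_simps[OF linear_cchain_extend])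
        (simp add: \<theta>_def singular_face_def standard_simplex_0_eq simplical_face_on_edge_0 g_def One_nat_def)
    ultimately show "f (csingle \<sigma>) \<in> edge_classes"
      using * by (simp add: f_def)
  qed
  moreover have "f c = c"
    using c by (simp add: f_def ccycles_def clinear_simps[OF linear_cchain_extend])
  ultimately show ?thesis
    by simp
qed

end

lemma turning_edge:
  assumes "\<And>t. t \<in> {0..1} \<Longrightarrow> h (F ((1 - t) *\<^sub>R v + t *\<^sub>R w)) = exp (2 * of_real pi * \<i> * of_real (t * z))"
  shows "turning h (segment F v w) = of_real z"
proof -
  have "turning h (segment F v w) = (2 * of_real pi * \<i> * of_real (1 * z) - 2 * of_real pi * \<i> * of_real (0 * z)) / (2 * of_real pi * \<i>)"
    by (rule turning_exp[where L = "\<lambda>t. 2 * of_real pi * \<i> * of_real (t * z)"])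
      (auto intro!: continuous_intros simp: segment_on_edge assms)
  then show ?thesis
    by simp
qed

section \<open>Edge cycles\<close>

context square_surface
begin

text \<open>
  The coefficient of the lower left corner of \<open>s\<close> in the boundary of an edge chain, when the corners of
  different squares are kept apart: the edges that end there are the bottom edge of the left neighbour and
  the left edge of the lower neighbour.
\<close>
definition divergence :: "('s \<Rightarrow> complex) \<Rightarrow> ('s \<Rightarrow> complex) \<Rightarrow> 's \<Rightarrow> complex" where
  "divergence a b s = (a (inv_into S r s) - a s) + (b (inv_into S u s) - b s)"

text \<open>
  Summation by parts. It is used for the vertices, for the horizontal edges and for the vertical edges.
\<close>
lemma sum_divergence:
  fixes x :: "'s \<Rightarrow> ('c \<Rightarrow>\<^sub>0 complex)"
  shows "(\<Sum>s\<in>S. cchain_scale (a s) (x (r s) - x s) + cchain_scale (b s) (x (u s) - x s))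
    = (\<Sum>s\<in>S. cchain_scale (divergence a b s) (x s))"
proof -
  have shift: "(\<Sum>s\<in>S. cchain_scale (c s) (x (t s))) = (\<Sum>s\<in>S. cchain_scale (c (inv_into S t s)) (x s))"
    if t: "bij_betw t S S" for c :: "'s \<Rightarrow> complex" and t
    using sum.reindex_bij_betw[OF t, of "\<lambda>s. cchain_scale (c (inv_into S t s)) (x s)"]
    by (simp add: bij_betw_inv_into_left[OF t] cong: sum.cong)
  show ?thesis
    by (simp add: divergence_def cchain.scale_right_diff_distrib cchain.scale_left_diff_distrib
        cchain.scale_left_distrib sum.distrib sum_subtractf shift[OF bij_r] shift[OF bij_u])
qed

definition vertex :: "'s \<Rightarrow> (nat \<Rightarrow> real) \<Rightarrow> ('s \<times> (real \<times> real)) set" where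
  "vertex s = (\<lambda>x\<in>standard_simplex 0. pt s (0, 0))"

lemma vertex_eq_iff: "vertex s = vertex t \<longleftrightarrow> pt s (0, 0) = pt t (0, 0)"
proof
  assume "vertex s = vertex t"
  then have "vertex s (on_edge 0) = vertex t (on_edge 0)" by simp
  then show "pt s (0, 0) = pt t (0, 0)"
    by (simp add: vertex_def standard_simplex_0_eq)
qed (simp add: vertex_def)

lemma boundary_edge:
  assumes "s \<in> S"
  shows "cchain_boundary 1 (csingle (hor s)) = csingle (vertex (r s)) - csingle (vertex s)"
    and "cchain_boundary 1 (csingle (ver s)) = csingle (vertex (u s)) - csingle (vertex s)"
proof -
  have face: "singular_face (Suc 0) 0 (segment F v w) = (\<lambda>x\<in>standard_simplex 0. F w)"
    "singular_face (Suc 0) (Suc 0) (segment F v w) = (\<lambda>x\<in>standard_simplex 0. F v)"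
    for F :: "real \<times> real \<Rightarrow> ('s \<times> (real \<times> real)) set" and v w
    using segment_on_edge[of 0 F v w] segment_on_edge[of 1 F v w]
    by (auto simp: singular_face_def standard_simplex_0_eq simplical_face_on_edge_0 intro!: restrict_ext)
  have "pt s (1, 0) = pt (r s) (0, 0)" "pt s (0, 1) = pt (u s) (0, 0)"
    using pt_right[OF assms, of 0] pt_up[OF assms, of 0] by auto
  then show "cchain_boundary 1 (csingle (hor s)) = csingle (vertex (r s)) - csingle (vertex s)"
    "cchain_boundary 1 (csingle (ver s)) = csingle (vertex (u s)) - csingle (vertex s)"
    by (simp_all add: One_nat_def cchain_boundary_1_csingle) (simp_all add: hor_def ver_def face vertex_def)
qed

lemma boundary_edge_chain:
  "cchain_boundary 1 (edge_chain a b) = (\<Sum>s\<in>S. cchain_scale (divergence a b s) (csingle (vertex s)))"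
proof -
  have "cchain_boundary 1 (edge_chain a b) =
    (\<Sum>s\<in>S. cchain_scale (a s) (csingle (vertex (r s)) - csingle (vertex s))
      + cchain_scale (b s) (csingle (vertex (u s)) - csingle (vertex s)))"
    by (simp add: edge_chain_def cchain_boundary_simps boundary_edge cong: sum.cong)
  also have "\<dots> = (\<Sum>s\<in>S. cchain_scale (divergence a b s) (csingle (vertex s)))"
    by (rule sum_divergence)
  finally show ?thesis .
qed

lemma singular_simplex_edge:
  assumes "s \<in> S"
  shows "singular_simplex 1 M (hor s)" "singular_simplex 1 M (ver s)"
  unfolding hor_def ver_def
  by (rule singular_simplex_segment[OF convex_unit_square continuous_map_pt[OF assms] corners(1) corners(2)]
      singular_simplex_segment[OF convex_unit_square continuous_map_pt[OF assms] corners(1) corners(3)])+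

lemma edge_chain_in_cchains: "edge_chain a b \<in> cchains 1 M"
  unfolding edge_chain_def
  by (intro cchain.subspace_sum[OF subspace_cchains] cchain.subspace_add[OF subspace_cchains]
      cchain.subspace_scale[OF subspace_cchains]) (simp_all add: singular_simplex_edge)

text \<open>
  Up to homology the two vertical sides of a square differ by as much as its two horizontal sides. So the
  change of the vertical part under the translation to the right may be replaced by a change of horizontal
  edges under the translation up, and the total change is a sum of horizontal edges
  weighted by the divergence, hence zero; for the upward translation the two kinds of edges exchange roles.
\<close>
lemma edge_chain_translate:
  assumes "\<And>s. s \<in> S \<Longrightarrow> divergence a b s = 0"
  shows "edge_chain (a \<circ> inv_into S r) (b \<circ> inv_into S r) - edge_chain a b \<in> cboundaries 1 M"
    and "edge_chain (a \<circ> inv_into S u) (b \<circ> inv_into S u) - edge_chain a b \<in> cboundaries 1 M"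
proof -
  let ?h = "\<lambda>s. csingle (hor s)" and ?v = "\<lambda>s. csingle (ver s)"
  let ?d = "\<lambda>s. (?v (r s) - ?v s) - (?h (u s) - ?h s)"
  have zero: "(\<Sum>s\<in>S. cchain_scale (a s) (x (r s) - x s) + cchain_scale (b s) (x (u s) - x s)) = 0"
    for x :: "'s \<Rightarrow> ('s \<times> (real \<times> real)) set cchain"
    by (simp add: sum_divergence assms)
  have d: "(\<Sum>s\<in>S. cchain_scale (c s) (?d s)) \<in> cboundaries 1 M" for c
    by (intro cchain.subspace_sum[OF subspace_cboundaries] cchain.subspace_scale[OF subspace_cboundaries] square_boundary)
  have "edge_chain (a \<circ> inv_into S r) (b \<circ> inv_into S r) - edge_chain a b =
    (\<Sum>s\<in>S. cchain_scale (a s) (?h (r s) - ?h s) + cchain_scale (b s) (?v (r s) - ?v s))"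
    unfolding edge_chain_reindex[OF bij_r, symmetric] unfolding edge_chain_def sum_subtractf[symmetric]
    by (simp add: cchain.scale_right_diff_distrib algebra_simps)
  also have "\<dots> = (\<Sum>s\<in>S. cchain_scale (a s) (?h (r s) - ?h s) + cchain_scale (b s) (?h (u s) - ?h s))
      + (\<Sum>s\<in>S. cchain_scale (b s) (?d s))"
    unfolding sum.distrib[symmetric] by (simp add: cchain.scale_right_diff_distrib algebra_simps)
  finally show "edge_chain (a \<circ> inv_into S r) (b \<circ> inv_into S r) - edge_chain a b \<in> cboundaries 1 M"
    using d[of b] by (simp only: zero[of ?h] add_0_left)
  have "edge_chain (a \<circ> inv_into S u) (b \<circ> inv_into S u) - edge_chain a b =
    (\<Sum>s\<in>S. cchain_scale (a s) (?h (u s) - ?h s) + cchain_scale (b s) (?v (u s) - ?v s))"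
    unfolding edge_chain_reindex[OF bij_u, symmetric] unfolding edge_chain_def sum_subtractf[symmetric]
    by (simp add: cchain.scale_right_diff_distrib algebra_simps)
  also have "\<dots> = (\<Sum>s\<in>S. cchain_scale (a s) (?v (r s) - ?v s) + cchain_scale (b s) (?v (u s) - ?v s))
      - (\<Sum>s\<in>S. cchain_scale (a s) (?d s))"
    unfolding sum_subtractf[symmetric] by (simp add: cchain.scale_right_diff_distrib algebra_simps)
  finally show "edge_chain (a \<circ> inv_into S u) (b \<circ> inv_into S u) - edge_chain a b \<in> cboundaries 1 M"
    using cchain.subspace_neg[OF subspace_cboundaries d[of a]] by (simp only: zero[of ?v] diff_0)
qed

text \<open>
  Attach to a corner of \<open>s\<close> the value of \<open>d\<close> at the square obtained by walking from \<open>s\<close> to that corner. At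
  the upper right corner there are two ways to walk, and they agree by assumption; so the label is
  invariant under gluing.
\<close>
lemma same_vertex_label:
  assumes comm: "\<And>s. s \<in> S \<Longrightarrow> d (u (r s)) = d (r (u s))" and "pt s (0, 0) = pt t (0, 0)"
  shows "d s = d t"
proof -
  define F where "F = (\<lambda>s v. if fst v = (1 :: real) then (if snd v = (1 :: real) then d (u (r s)) else d (r s))
      else (if snd v = 1 then d (u s) else d s))"
  have "F s (0, 0) = F t (0, 0)"
    by (rule gluing_invariant[OF assms(2)]) (auto simp: F_def comm)
  then show ?thesis
    by (simp add: F_def)
qed

text \<open>
  The boundary only yields that the divergences at all corners of one vertex add up to zero. They are all equal
  by the previous lemma, hence they vanish.
\<close>
lemma divergence_eq_0:
  assumes comm: "\<And>s. s \<in> S \<Longrightarrow> divergence a b (u (r s)) = divergence a b (r (u s))"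
    and cycle: "cchain_boundary 1 (edge_chain a b) = 0" and s: "s \<in> S"
  shows "divergence a b s = 0"
proof -
  have "0 = ceval (\<lambda>\<tau>. if \<tau> = vertex s then 1 else 0) (cchain_boundary 1 (edge_chain a b))"
    by (simp add: cycle ceval_simps)
  also have "\<dots> = (\<Sum>t\<in>S. divergence a b t * (if vertex t = vertex s then 1 else 0))"
    by (simp add: boundary_edge_chain ceval_simps cong: sum.cong)
  also have "\<dots> = (\<Sum>t\<in>{t\<in>S. vertex t = vertex s}. divergence a b t)"
    by (simp add: sum.inter_filter[OF finite_S] if_distrib cong: if_cong)
  also have "\<dots> = (\<Sum>t\<in>{t\<in>S. vertex t = vertex s}. divergence a b s)"
  proof (rule sum.cong[OF refl])
    fix t assume "t \<in> {t \<in> S. vertex t = vertex s}"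
    then have "pt t (0, 0) = pt s (0, 0)"
      by (simp add: vertex_eq_iff)
    with comm show "divergence a b t = divergence a b s"
      by (rule same_vertex_label[where d = "divergence a b"])
  qed
  also have "\<dots> = of_nat (card {t\<in>S. vertex t = vertex s}) * divergence a b s"
    by simp
  finally have "of_nat (card {t\<in>S. vertex t = vertex s}) * divergence a b s = 0" by simp
  moreover have "card {t\<in>S. vertex t = vertex s} \<noteq> 0"
    using finite_S s by auto
  ultimately show ?thesis
    by simp
qed

section \<open>Winding functionals on edges\<close>

lemma ceval_edge_chain:
  "ceval \<phi> (edge_chain a b) = (\<Sum>s\<in>S. a s * \<phi> (hor s) + b s * \<phi> (ver s))"
  by (simp add: edge_chain_def ceval_simps)

text \<open>
  The function \<open>q\<close> interpolates the values \<open>0\<close>, \<open>f s\<close>, \<open>g s\<close> and \<open>g s + f (u s)\<close> at the corners of \<open>s\<close>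
  bilinearly. By the cocycle condition it changes across a gluing by an integer constant, so its exponential
  is a well defined map from the surface to the unit circle, which turns \<open>f s\<close> times along the bottom of \<open>s\<close>
  and \<open>g s\<close> times along the left side.
\<close>
lemma edge_chain_boundary_pairing:
  fixes f g :: "'s \<Rightarrow> int"
  assumes cocycle: "\<And>s. s \<in> S \<Longrightarrow> f s + g (r s) = g s + f (u s)"
    and boundary: "edge_chain a b \<in> cboundaries 1 M"
  shows "(\<Sum>s\<in>S. a s * of_int (f s) + b s * of_int (g s)) = 0"
proof -
  define q where "q = (\<lambda>s v. of_int (f s) * fst v + of_int (g s) * snd v + (of_int (f (u s)) - of_int (f s)) * (fst v * snd v) :: real)"
  define H where "H = (\<lambda>s v. exp (2 * of_real pi * \<i> * of_real (q s v)))"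
  define h where "h = glue_map H"
  have periodic: "exp (2 * of_real pi * \<i> * of_real (x + of_int k)) = exp (2 * of_real pi * \<i> * of_real x)" for x :: real and k :: int
  proof -
    have "exp (2 * of_real pi * \<i> * of_real (x + of_int k)) =
        exp (2 * of_real pi * \<i> * of_real x) * exp (2 * of_real pi * \<i> * of_int k)"
      by (simp add: ring_distribs exp_add)
    also have "exp (2 * of_real pi * \<i> * of_int k) = 1"
      using exp_integer_2pi[of "of_int k"] by (simp add: algebra_simps)
    finally show ?thesis by simp
  qed
  have g_eq: "real_of_int (g (r s)) = real_of_int (g s) + real_of_int (f (u s)) - real_of_int (f s)" if "s \<in> S" for s
  proof -
    have "real_of_int (f s + g (r s)) = real_of_int (g s + f (u s))"
      using cocycle[OF that] by simp
    then show ?thesis by simp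
  qed
  have q_right: "q s (1, t) = q (r s) (0, t) + of_int (f s)"
    and q_up: "q s (t, 1) = q (u s) (t, 0) + of_int (g s)" if "s \<in> S" for s t
    unfolding q_def fst_conv snd_conv g_eq[OF that] by (simp_all add: algebra_simps)
  have h_pt: "h (pt s v) = H s v" if "s \<in> S" "v \<in> unit_square" for s v
    unfolding h_def
  proof (rule glue_map_pt[OF that])
    fix s t assume s: "s \<in> S" and t: "t \<in> {0..1::real}"
    show "H s (1, t) = H (r s) (0, t)" "H s (t, 1) = H (u s) (t, 0)"
      unfolding H_def q_right[OF s] q_up[OF s] by (rule periodic)+
  qed
  have h_cont: "continuous_map M euclidean h"
  proof (rule continuous_map_from_M)
    fix s assume s: "s \<in> S"
    have "continuous_map (top_of_set unit_square) euclidean (H s)"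
      by (auto simp: H_def q_def intro!: continuous_intros)
    then show "continuous_map (top_of_set unit_square) euclidean (\<lambda>v. h (pt s v))"
      by (rule continuous_map_eq) (simp add: h_pt[OF s])
  qed
  have h_nz: "h x \<noteq> 0" if "x \<in> topspace M" for x
    using that by (elim in_M_cases) (simp add: h_pt H_def)
  have edges: "turning h (hor s) = of_int (f s)" "turning h (ver s) = of_int (g s)" if s: "s \<in> S" for s
  proof -
    have "turning h (hor s) = of_real (of_int (f s))" "turning h (ver s) = of_real (of_int (g s))"
      unfolding hor_def ver_def
      by (rule turning_edge; simp add: h_pt[OF s] H_def q_def mult.commute)+
    then show "turning h (hor s) = of_int (f s)" "turning h (ver s) = of_int (g s)"
      by simp_all
  qed
  have "0 = ceval (turning h) (edge_chain a b)"
    using ceval_turning_boundary[OF h_cont h_nz boundary] by simp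
  also have "\<dots> = (\<Sum>s\<in>S. a s * of_int (f s) + b s * of_int (g s))"
    by (simp add: ceval_edge_chain edges cong: sum.cong)
  finally show ?thesis by simp
qed

lemma proj_edge_chain:
  "cchain_map 1 origami_proj (edge_chain a b) =
     cchain_scale (\<Sum>s\<in>S. a s) (csingle (segment (\<lambda>v. lattice_rel `` {v}) (0, 0) (1, 0)))
     + cchain_scale (\<Sum>s\<in>S. b s) (csingle (segment (\<lambda>v. lattice_rel `` {v}) (0, 0) (0, 1)))"
proof -
  have "simplex_map 1 origami_proj (segment (pt s) v w) = segment (\<lambda>v. lattice_rel `` {v}) v w" for s v w
    by (rule extensional_simplex_1_eqI)
      (auto simp: simplex_map_def segment_extensional segment_on_edge on_edge_in_simplex origami_proj_pt)
  then show ?thesis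
    by (simp add: edge_chain_def hor_def ver_def cchain_map_simps sum.distrib cchain.scale_sum_left)
qed

end

lemma continuous_map_from_torus:
  assumes "continuous_on UNIV k" "\<And>v w. lattice_rel `` {v} = lattice_rel `` {w} \<Longrightarrow> k v = k w"
  shows "\<exists>h. continuous_map torus euclidean h \<and> (\<forall>v. h (lattice_rel `` {v}) = k v)"
proof -
  define h where "h = (\<lambda>P. k (SOME v. lattice_rel `` {v} = P))"
  have h: "h (lattice_rel `` {v}) = k v" for v
    unfolding h_def by (rule assms(2)) (rule someI[of _ v], simp)
  then have "h \<circ> (\<lambda>v. lattice_rel `` {v}) = k"
    by auto
  then have "continuous_map torus euclidean h"
    using assms(1) continuous_compose_quotient_map_eq[OF quotient_map_torus, of euclidean h] by simp
  then show ?thesis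
    using h by blast
qed

text \<open>
  The two coordinates modulo \<open>\<int>\<close> are maps from the torus to the circle that turn once along one of the two
  edges and not at all along the other one.
\<close>
lemma torus_edges_independent:
  assumes "cchain_scale x (csingle (segment (\<lambda>v. lattice_rel `` {v}) (0, 0) (1, 0)))
     + cchain_scale y (csingle (segment (\<lambda>v. lattice_rel `` {v}) (0, 0) (0, 1))) \<in> cboundaries 1 torus"
  shows "x = 0" "y = 0"
proof -
  have *: "x * of_real (p (1, 0)) + y * of_real (p (0, 1)) = 0"
    if cont: "continuous_on UNIV p" and scale: "\<And>t v. p (t *\<^sub>R v) = t * p v"
      and int: "\<And>v w. fst w - fst v \<in> \<int> \<Longrightarrow> snd w - snd v \<in> \<int> \<Longrightarrow> p w - p v \<in> \<int>"
    for p :: "real \<times> real \<Rightarrow> real"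
  proof -
    define k where "k = (\<lambda>v. exp (2 * of_real pi * \<i> * of_real (p v)))"
    have "continuous_on UNIV k"
      unfolding k_def by (intro continuous_intros cont)
    moreover have "k v = k w" if "lattice_rel `` {v} = lattice_rel `` {w}" for v w
    proof -
      have "p w - p v \<in> \<int>"
        using that by (intro int) (auto simp: lattice_class_eq_iff)
      then have "exp (2 * of_real pi * \<i> * of_real (p w - p v)) = 1"
        using exp_integer_2pi[of "of_real (p w - p v)"] by (auto elim!: Ints_cases simp: algebra_simps)
      then have "k w / k v = 1"
        by (simp add: k_def exp_diff[symmetric] algebra_simps)
      then show ?thesis by simp
    qed
    ultimately obtain h where h: "continuous_map torus euclidean h" "\<And>v. h (lattice_rel `` {v}) = k v"
      using continuous_map_from_torus[of k] by blast
    have nz: "h P \<noteq> 0" if "P \<in> topspace torus" for P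
      using that h(2) by (auto simp: torus_def topspace_quotient_top quotient_def k_def)
    have "turning h (segment (\<lambda>v. lattice_rel `` {v}) (0, 0) w) = of_real (p w)" for w
      using scale by (intro turning_edge) (simp add: h(2) k_def flip: zero_prod_def)
    then show ?thesis
      using ceval_turning_boundary[OF h(1) nz assms] by (simp add: ceval_simps)
  qed
  show "x = 0"
    using *[of fst] by (simp add: continuous_on_fst)
  show "y = 0"
    using *[of snd] by (simp add: continuous_on_snd)
qed

section \<open>Automorphisms permute the squares\<close>

abbreviation open_square :: "(real \<times> real) set" where
  "open_square \<equiv> {0<..<1} \<times> {0<..<1}"

context square_surface
begin

lemma pt_interior_inj:
  assumes "pt s v = pt t w" "v \<in> open_square"
  shows "s = t" "v = w"
proof -
  define F where "F = (\<lambda>(s :: 's) v. if v \<in> open_square then {(s, v)} else {})"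
  have "F s v = F t w"
    by (rule gluing_invariant[OF assms(1)]) (simp_all add: F_def)
  moreover have "(s, v) \<in> F s v"
    using assms(2) by (simp add: F_def)
  ultimately have "(s, v) \<in> F t w"
    by simp
  then have "s = t \<and> v = w"
    by (cases "w \<in> open_square") (simp_all add: F_def)
  then show "s = t" "v = w"
    by simp_all
qed

text \<open>
  A point in the middle of a vertical edge lies on exactly two sides, the left side of one square and the right
  side of its left neighbour; it is labelled by the former.
\<close>
lemma pt_left_inj:
  assumes "pt s (0, 1/2) = pt t (0, 1/2)"
  shows "s = t"
proof -
  define F where "F = (\<lambda>s (v :: real \<times> real). if snd v = 1/2 then
      (if fst v = 0 then Some s else if fst v = 1 then Some (r s) else None) else None)"
  have "F s (0, 1/2) = F t (0, 1/2)"
    by (rule gluing_invariant[OF assms]) (simp_all add: F_def)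
  then show ?thesis
    by (simp add: F_def)
qed

lemma pt_bottom_inj:
  assumes "pt s (1/2, 0) = pt t (1/2, 0)"
  shows "s = t"
proof -
  define F where "F = (\<lambda>s (v :: real \<times> real). if fst v = 1/2 then
      (if snd v = 0 then Some s else if snd v = 1 then Some (u s) else None) else None)"
  have "F s (1/2, 0) = F t (1/2, 0)"
    by (rule gluing_invariant[OF assms]) (simp_all add: F_def)
  then show ?thesis
    by (simp add: F_def)
qed

lemma origami_aut_of_permutation:
  assumes \<tau>: "bij_betw \<tau> S S"
    and comm: "\<And>s. s \<in> S \<Longrightarrow> \<tau> (r s) = r (\<tau> s)" "\<And>s. s \<in> S \<Longrightarrow> \<tau> (u s) = u (\<tau> s)"
  shows "\<exists>f \<in> origami_aut M. \<forall>s\<in>S. \<forall>v\<in>unit_square. f (pt s v) = pt (\<tau> s) v"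
proof -
  define f where "f = (\<lambda>\<tau>. glue_map (\<lambda>s. pt (\<tau> s)))"
  have f_pt: "f \<tau> (pt s v) = pt (\<tau> s) v"
    if \<tau>: "\<tau> ` S \<subseteq> S" and comm: "\<And>s. s \<in> S \<Longrightarrow> \<tau> (r s) = r (\<tau> s)" "\<And>s. s \<in> S \<Longrightarrow> \<tau> (u s) = u (\<tau> s)"
      and s: "s \<in> S" and v: "v \<in> unit_square" for \<tau> s v
    unfolding f_def
  proof (rule glue_map_pt[OF s v])
    fix s t assume s: "s \<in> S" and t: "t \<in> {0..1::real}"
    then have "\<tau> s \<in> S" using \<tau> by blast
    then show "pt (\<tau> s) (1, t) = pt (\<tau> (r s)) (0, t)" "pt (\<tau> s) (t, 1) = pt (\<tau> (u s)) (t, 0)"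
      using comm[OF s] pt_right[OF _ t] pt_up[OF _ t] by simp_all
  qed
  have f_cont: "continuous_map M M (f \<tau>)"
    if \<tau>: "\<tau> ` S \<subseteq> S" and comm: "\<And>s. s \<in> S \<Longrightarrow> \<tau> (r s) = r (\<tau> s)" "\<And>s. s \<in> S \<Longrightarrow> \<tau> (u s) = u (\<tau> s)"
    for \<tau>
  proof (rule continuous_map_from_M)
    fix s assume s: "s \<in> S"
    then have "\<tau> s \<in> S" using \<tau> by blast
    from continuous_map_pt[OF this]
    show "continuous_map (top_of_set unit_square) M (\<lambda>v. f \<tau> (pt s v))"
      by (rule continuous_map_eq) (simp add: f_pt[OF \<tau> comm s])
  qed
  let ?i = "inv_into S \<tau>"
  have \<tau>S: "\<tau> ` S \<subseteq> S" and iS: "?i ` S \<subseteq> S"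
    using \<tau> bij_betw_inv_into[OF \<tau>] by (auto simp: bij_betw_def)
  have i: "?i (\<tau> s) = s" "\<tau> (?i s) = s" "?i s \<in> S" if "s \<in> S" for s
    using that bij_betw_inv_into_left[OF \<tau>] bij_betw_inv_into_right[OF \<tau>] iS by auto
  have icomm: "?i (r s) = r (?i s)" "?i (u s) = u (?i s)" if s: "s \<in> S" for s
    using comm[OF i(3)[OF s]] i[OF s] i(1)[of "r (?i s)"] i(1)[of "u (?i s)"] by simp_all
  have eq: "f \<tau> (pt s v) = pt (\<tau> s) v" "f ?i (pt s v) = pt (?i s) v" if "s \<in> S" "v \<in> unit_square" for s v
    using f_pt[OF \<tau>S comm that] f_pt[OF iS icomm that] by simp_all
  have "homeomorphic_maps M M (f \<tau>) (f ?i)"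
    unfolding homeomorphic_maps_def
  proof (intro conjI ballI)
    show "continuous_map M M (f \<tau>)" "continuous_map M M (f ?i)"
      by (rule f_cont[OF \<tau>S comm] f_cont[OF iS icomm]; assumption)+
    fix x assume "x \<in> topspace M"
    then obtain s v where x: "x = pt s v" and s: "s \<in> S" and v: "v \<in> unit_square"
      by (rule in_M_cases)
    have "\<tau> s \<in> S" using \<tau>S s by blast
    then show "f ?i (f \<tau> x) = x" "f \<tau> (f ?i x) = x"
      using s v i[OF s] by (simp_all add: x eq)
  qed
  then have "homeomorphic_map M M (f \<tau>)"
    by (auto simp: homeomorphic_map_maps)
  then have "homeomorphic_map M M (restrict (f \<tau>) (topspace M))"
    by (rule homeomorphic_map_eq) simp
  moreover have "origami_proj (restrict (f \<tau>) (topspace M) x) = origami_proj x" if "x \<in> topspace M" for x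
    using that by (elim in_M_cases) (simp add: eq origami_proj_pt)
  ultimately have "restrict (f \<tau>) (topspace M) \<in> origami_aut M"
    by (auto simp: origami_aut_def)
  moreover have "restrict (f \<tau>) (topspace M) (pt s v) = pt (\<tau> s) v" if "s \<in> S" "v \<in> unit_square" for s v
    using that eq(1)[OF that] pt_in_M[OF that] by simp
  ultimately show ?thesis
    by blast
qed

lemma map_edge_chain:
  assumes \<tau>: "bij_betw \<tau> S S" and f: "\<And>s v. s \<in> S \<Longrightarrow> v \<in> unit_square \<Longrightarrow> f (pt s v) = pt (\<tau> s) v"
  shows "cchain_map 1 f (edge_chain a b) = edge_chain (a \<circ> inv_into S \<tau>) (b \<circ> inv_into S \<tau>)"
proof -
  have "simplex_map 1 f (hor s) = hor (\<tau> s)" "simplex_map 1 f (ver s) = ver (\<tau> s)" if "s \<in> S" for s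
    unfolding hor_def ver_def using f[OF that]
    by (auto intro!: extensional_simplex_1_eqI
        simp: simplex_map_def segment_extensional segment_on_edge on_edge_in_simplex)
  then have "cchain_map 1 f (edge_chain a b) =
    (\<Sum>s\<in>S. cchain_scale (a s) (csingle (hor (\<tau> s))) + cchain_scale (b s) (csingle (ver (\<tau> s))))"
    by (simp add: edge_chain_def cchain_map_simps)
  then show ?thesis
    by (simp add: edge_chain_reindex[OF \<tau>])
qed

text \<open>
  The regions only depend on the point of the torus, so the stars of different points over the same point of
  the torus are disjoint. This replaces the Hausdorff property in the study of automorphisms.
\<close>
lemma star_same_coordinates:
  assumes "v \<in> unit_square" "w \<in> unit_square" "lattice_rel `` {v} = lattice_rel `` {w}"
  shows "star v P = star w P"
proof -
  have "centre (fst v) = centre (fst w)" "star_dom (fst v) = star_dom (fst w)"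
    "centre (snd v) = centre (snd w)" "star_dom (snd v) = star_dom (snd w)"
    using assms centre_star_dom_cong[of "fst v" "fst w"] centre_star_dom_cong[of "snd v" "snd w"]
    by (simp_all add: lattice_class_eq_iff mem_Times_iff)
  moreover from this have "radial (fst v) = radial (fst w)" "radial (snd v) = radial (snd w)"
    by (simp_all only: radial_def[abs_def])
  ultimately have "contraction v = contraction w"
    by (simp only: contraction_def[abs_def])
  then show ?thesis
    by (simp add: star_def star_region_def)
qed

lemma star_disjoint: "x \<in> star v P \<Longrightarrow> x \<in> star v P' \<Longrightarrow> P = P'"
  by (simp add: star_def)

lemma connected_open_square: "connected open_square"
  by (intro convex_connected convex_Times) auto

lemma open_square_meets:
  assumes "openin (top_of_set unit_square) T" "T \<noteq> {}"
  shows "T \<inter> open_square \<noteq> {}"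
proof -
  obtain U where U: "open U" "T = unit_square \<inter> U"
    using assms(1) by (auto simp: openin_open)
  have "closure open_square = unit_square"
    by (simp add: closure_Times)
  then have "U \<inter> open_square \<noteq> {}"
    using open_Int_closure_eq_empty[OF U(1), of open_square] U(2) assms(2) by auto
  moreover have "open_square \<subseteq> unit_square"
    by auto
  ultimately show ?thesis
    using U(2) by blast
qed

text \<open>
  Interior coordinates differ from other coordinates in the closed unit interval by less than one.
\<close>
lemma lattice_class_interior:
  assumes "lattice_rel `` {v} = lattice_rel `` {w}" "v \<in> open_square" "w \<in> unit_square"
  shows "v = w"
proof -
  have *: "x = y" if int: "y - x \<in> \<int>" and bounds: "0 < x" "x < 1" "0 \<le> y" "y \<le> 1" for x y :: real
  proof -
    obtain k where k: "y - x = of_int k"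
      using int by (rule Ints_cases)
    with bounds have "of_int k < (1 :: real)" "-1 < (of_int k :: real)"
      by auto
    then have "k = 0" by linarith
    with k show ?thesis by simp
  qed
  show ?thesis
    using assms by (auto simp: lattice_class_eq_iff prod_eq_iff mem_Times_iff intro: *)
qed

text \<open>
  An automorphism preserves coordinates, so it sends a point of the open square \<open>s\<close> to the point with the same
  coordinates in some square \<open>t\<close>. The square \<open>t\<close> depends on the point in a locally constant way, hence not at
  all, as the open square is connected.
\<close>
lemma origami_aut_on_open_square:
  assumes f: "f \<in> origami_aut M" and s: "s \<in> S"
  obtains t where "t \<in> S" "\<And>w. w \<in> open_square \<Longrightarrow> f (pt s w) = pt t w"
proof -
  have f_cont: "continuous_map M M f" and proj: "\<And>x. x \<in> topspace M \<Longrightarrow> origami_proj (f x) = origami_proj x"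
    using f by (auto simp: origami_aut_def homeomorphic_imp_continuous_map)
  let ?c = "(1/2, 1/2) :: real \<times> real"
  define R where "R = (\<lambda>t. {w \<in> open_square. f (pt s w) = pt t w})"
  have c: "?c \<in> unit_square" and dom: "star_dom (1/2) = {0<..<1}" and cen: "\<And>x. centre (1/2) x = 1/2"
    by (auto simp: star_dom_def centre_def)
  have sub: "open_square \<subseteq> unit_square" by auto
  have target: "\<exists>t\<in>S. f (pt s w) = pt t w" if w: "w \<in> open_square" for w
  proof -
    have x: "pt s w \<in> topspace M" using s w sub by (intro pt_in_M) auto
    then have "f (pt s w) \<in> topspace M"
      using continuous_map_funspace[OF f_cont] by blast
    then obtain t w' where t: "t \<in> S" "w' \<in> unit_square" "f (pt s w) = pt t w'"
      by (elim in_M_cases)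
    then have "lattice_rel `` {w} = lattice_rel `` {w'}"
      using proj[OF x] by (simp add: origami_proj_pt)
    then have "w = w'"
      using w t(2) by (rule lattice_class_interior)
    with t show ?thesis by blast
  qed
  have open_R: "openin (top_of_set open_square) (R t)" if t: "t \<in> S" for t
  proof -
    have "continuous_map (top_of_set open_square) M (\<lambda>w. f (pt s w))"
      using continuous_map_compose[OF continuous_map_from_subtopology_mono[OF continuous_map_pt[OF s] sub] f_cont]
      by (simp add: o_def)
    from openin_continuous_map_preimage[OF this openin_star_region(2)[OF c, of "pt t ?c"]]
    have *: "openin (top_of_set open_square) {w \<in> open_square. f (pt s w) \<in> star ?c (pt t ?c)}"
      by simp
    have "f (pt s w) \<in> star ?c (pt t ?c) \<longleftrightarrow> f (pt s w) = pt t w" if w: "w \<in> open_square" for w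
    proof -
      obtain t' where t': "t' \<in> S" "f (pt s w) = pt t' w"
        using target[OF w] by blast
      have "pt t' w \<in> star ?c (pt t ?c) \<longleftrightarrow> pt t' ?c = pt t ?c"
        using w sub by (subst pt_in_star_iff[OF t'(1) _ c]) (auto simp: dom cen)
      also have "\<dots> \<longleftrightarrow> t' = t"
        using pt_interior_inj(1)[of t' ?c t ?c] by auto
      also have "\<dots> \<longleftrightarrow> pt t' w = pt t w"
        using pt_interior_inj(1)[OF _ w, of t' t w] by auto
      finally show ?thesis by (simp add: t')
    qed
    then have "{w \<in> open_square. f (pt s w) \<in> star ?c (pt t ?c)} = R t"
      unfolding R_def by blast
    with * show ?thesis by simp
  qed
  obtain t where t: "t \<in> S" "f (pt s ?c) = pt t ?c"
    using target[of ?c] by auto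
  have "openin (top_of_set open_square) (\<Union>t'\<in>S - {t}. R t')"
    using open_R by (intro openin_Union) auto
  moreover have "R t \<inter> (\<Union>t'\<in>S - {t}. R t') = {}"
  proof -
    have "t' = t" if "x \<in> R t" "x \<in> R t'" for x t'
    proof -
      have "pt t' x = pt t x" "x \<in> open_square"
        using that unfolding R_def by auto
      then show ?thesis by (rule pt_interior_inj)
    qed
    then show ?thesis by blast
  qed
  moreover have "open_square \<subseteq> R t \<union> (\<Union>t'\<in>S - {t}. R t')"
  proof
    fix w assume w: "w \<in> open_square"
    then obtain t' where "t' \<in> S" "w \<in> R t'"
      using target[OF w] unfolding R_def by blast
    then show "w \<in> R t \<union> (\<Union>t'\<in>S - {t}. R t')"
      by (cases "t' = t") auto
  qed
  moreover have "R t \<noteq> {}"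
  proof -
    have "?c \<in> R t"
      unfolding R_def using t(2) by simp
    then show ?thesis by blast
  qed
  ultimately have "(\<Union>t'\<in>S - {t}. R t') = {}"
    using connected_open_square open_R[OF t(1)] unfolding connected_openin by blast
  then have "f (pt s w) = pt t w" if "w \<in> open_square" for w
    using target[OF that] that unfolding R_def by blast
  with t(1) that show thesis by blast
qed

text \<open>
  If the image of a point on a side of \<open>s\<close> were not the corresponding point of \<open>t\<close>, the two would have disjoint
  stars. By continuity nearby interior points of \<open>s\<close> would then have images in both stars.
\<close>
lemma origami_aut_on_square:
  assumes f: "f \<in> origami_aut M" and s: "s \<in> S"
  obtains t where "t \<in> S" "\<And>w. w \<in> unit_square \<Longrightarrow> f (pt s w) = pt t w"
proof -
  have f_cont: "continuous_map M M f" and proj: "\<And>x. x \<in> topspace M \<Longrightarrow> origami_proj (f x) = origami_proj x"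
    using f by (auto simp: origami_aut_def homeomorphic_imp_continuous_map)
  obtain t where t: "t \<in> S" and ft: "\<And>w. w \<in> open_square \<Longrightarrow> f (pt s w) = pt t w"
    using origami_aut_on_open_square[OF f s] by blast
  have "f (pt s w) = pt t w" if w: "w \<in> unit_square" for w
  proof -
    have x: "pt s w \<in> topspace M" using s w by (rule pt_in_M)
    then have "f (pt s w) \<in> topspace M"
      using continuous_map_funspace[OF f_cont] by blast
    then obtain t' w' where t': "t' \<in> S" and w': "w' \<in> unit_square" and fw: "f (pt s w) = pt t' w'"
      by (elim in_M_cases)
    have "lattice_rel `` {w'} = lattice_rel `` {w}"
      using proj[OF x] by (simp add: origami_proj_pt fw)
    then have star: "f (pt s w) \<in> star w (pt t' w')"
      using centre_in_star[OF t' w'] star_same_coordinates[OF w' w] by (simp add: fw)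
    have "continuous_map (top_of_set unit_square) M (\<lambda>w. f (pt s w))"
      using continuous_map_compose[OF continuous_map_pt[OF s] f_cont] by (simp add: o_def)
    from openin_continuous_map_preimage[OF this openin_star_region(2)[OF w]]
      openin_continuous_map_preimage[OF continuous_map_pt[OF t] openin_star_region(2)[OF w]]
    have "openin (top_of_set unit_square) ({x \<in> unit_square. f (pt s x) \<in> star w (pt t' w')} \<inter>
        {x \<in> unit_square. pt t x \<in> star w (pt t w)})"
      by (intro openin_Int) simp_all
    moreover have "w \<in> {x \<in> unit_square. f (pt s x) \<in> star w (pt t' w')} \<inter> {x \<in> unit_square. pt t x \<in> star w (pt t w)}"
      using w star centre_in_star[OF t w] by blast
    ultimately obtain x where "x \<in> open_square" "f (pt s x) \<in> star w (pt t' w')" "pt t x \<in> star w (pt t w)"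
      using open_square_meets by blast
    then have "pt t' w' = pt t w"
      using star_disjoint ft by metis
    then show ?thesis by (simp add: fw)
  qed
  with t that show thesis by blast
qed

text \<open>
  The midpoint of a vertical edge determines the square to its right, and its image can be computed in both
  adjacent squares; so the permutation commutes with the passage to the right, and likewise upwards.
\<close>
theorem origami_aut_permutes:
  assumes f: "f \<in> origami_aut M"
  obtains \<tau> where "bij_betw \<tau> S S" "\<And>s. s \<in> S \<Longrightarrow> \<tau> (r s) = r (\<tau> s)" "\<And>s. s \<in> S \<Longrightarrow> \<tau> (u s) = u (\<tau> s)"
    "\<And>s v. s \<in> S \<Longrightarrow> v \<in> unit_square \<Longrightarrow> f (pt s v) = pt (\<tau> s) v"
proof -
  have "\<forall>s\<in>S. \<exists>t\<in>S. \<forall>w\<in>unit_square. f (pt s w) = pt t w"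
    using origami_aut_on_square[OF f] by metis
  then obtain \<tau> where \<tau>: "\<And>s. s \<in> S \<Longrightarrow> \<tau> s \<in> S"
    and f_eq: "\<And>s v. s \<in> S \<Longrightarrow> v \<in> unit_square \<Longrightarrow> f (pt s v) = pt (\<tau> s) v"
    by metis
  have inj: "inj_on f (topspace M)"
    using f by (auto simp: origami_aut_def homeomorphic_map_def dest: homeomorphic_imp_injective_map)
  let ?c = "(1/2, 1/2) :: real \<times> real"
  have "inj_on \<tau> S"
  proof (rule inj_onI)
    fix s t assume st: "s \<in> S" "t \<in> S" "\<tau> s = \<tau> t"
    then have "f (pt s ?c) = f (pt t ?c)"
      by (simp add: f_eq)
    then have "pt s ?c = pt t ?c"
      using inj st by (auto simp: inj_on_def)
    then show "s = t"
      by (rule pt_interior_inj) simp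
  qed
  then have "bij_betw \<tau> S S"
    using \<tau> finite_S by (simp add: bij_betw_def endo_inj_surj image_subsetI)
  moreover have "\<tau> (r s) = r (\<tau> s)" if s: "s \<in> S" for s
  proof (rule pt_left_inj)
    have "pt (\<tau> (r s)) (0, 1/2) = f (pt (r s) (0, 1/2))"
      using s by (simp add: f_eq)
    also have "\<dots> = f (pt s (1, 1/2))"
      using pt_right[OF s, of "1/2"] by simp
    also have "\<dots> = pt (r (\<tau> s)) (0, 1/2)"
      using s pt_right[OF \<tau>[OF s], of "1/2"] by (simp add: f_eq)
    finally show "pt (\<tau> (r s)) (0, 1/2) = pt (r (\<tau> s)) (0, 1/2)" .
  qed
  moreover have "\<tau> (u s) = u (\<tau> s)" if s: "s \<in> S" for s
  proof (rule pt_bottom_inj)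
    have "pt (\<tau> (u s)) (1/2, 0) = f (pt (u s) (1/2, 0))"
      using s by (simp add: f_eq)
    also have "\<dots> = f (pt s (1/2, 1))"
      using pt_up[OF s, of "1/2"] by simp
    also have "\<dots> = pt (u (\<tau> s)) (1/2, 0)"
      using s pt_up[OF \<tau>[OF s], of "1/2"] by (simp add: f_eq)
    finally show "pt (\<tau> (u s)) (1/2, 0) = pt (u (\<tau> s)) (1/2, 0)" .
  qed
  ultimately show thesis
    using that f_eq by blast
qed

end

section \<open>Integral harmonic cochains\<close>

text \<open>
  Gaussian elimination without division: fewer homogeneous integral equations than unknowns have a nonzero
  integral solution.
\<close>
lemma integer_kernel_coeffs:
  fixes F :: "('i \<Rightarrow> int) set"
  assumes "finite I" "finite F" "card F \<le> n" "n < card I"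
  shows "\<exists>x. (\<exists>i\<in>I. x i \<noteq> 0) \<and> (\<forall>c\<in>F. (\<Sum>i\<in>I. c i * x i) = 0)"
  using assms
proof (induction n arbitrary: F I)
  case 0
  then have "F = {}" "I \<noteq> {}" by auto
  then show ?case
    by (intro exI[of _ "\<lambda>_. 1"]) auto
next
  case (Suc n)
  show ?case
  proof (cases "F = {}")
    case True
    moreover have "I \<noteq> {}" using Suc.prems by auto
    ultimately show ?thesis
      by (intro exI[of _ "\<lambda>_. 1"]) auto
  next
    case False
    then obtain c F' where F: "F = insert c F'" "c \<notin> F'"
      by (meson mk_disjoint_insert equals0I)
    have F': "finite F'" "card F' \<le> n"
      using F Suc.prems by auto
    show ?thesis
    proof (cases "\<forall>i\<in>I. c i = 0")
      case True
      obtain x where "\<exists>i\<in>I. x i \<noteq> 0" "\<forall>c\<in>F'. (\<Sum>i\<in>I. c i * x i) = 0"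
        using Suc.IH[of I F'] Suc.prems F' by auto
      with True show ?thesis
        by (intro exI[of _ x]) (simp add: F(1))
    next
      case False
      then obtain j where j: "j \<in> I" "c j \<noteq> 0" by blast
      define e where "e = (\<lambda>d i. c j * d i - d j * c i)"
      have "card (e ` F') \<le> n" "finite (e ` F')"
        using F' card_image_le[of F' e] by auto
      moreover have "n < card (I - {j})" "finite (I - {j})"
        using j(1) Suc.prems by auto
      ultimately obtain x where x: "\<exists>i\<in>I - {j}. x i \<noteq> 0" "\<And>d. d \<in> F' \<Longrightarrow> (\<Sum>i\<in>I - {j}. e d i * x i) = 0"
        using Suc.IH[of "I - {j}" "e ` F'"] by auto
      \<comment> \<open>solve the equation \<open>c\<close> for the unknown \<open>j\<close>, after clearing the denominator \<open>c j\<close>\<close>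
      define k where "k = (\<Sum>i\<in>I - {j}. c i * x i)"
      define y where "y = (\<lambda>i. if i = j then - k else c j * x i)"
      have y: "(\<Sum>i\<in>I. d i * y i) = (\<Sum>i\<in>I - {j}. c j * d i * x i) - d j * k" for d
      proof -
        have "(\<Sum>i\<in>I. d i * y i) = d j * y j + (\<Sum>i\<in>I - {j}. d i * y i)"
          by (rule sum.remove) (use j(1) Suc.prems in auto)
        also have "(\<Sum>i\<in>I - {j}. d i * y i) = (\<Sum>i\<in>I - {j}. c j * d i * x i)"
          by (rule sum.cong) (auto simp: y_def)
        finally show ?thesis by (simp add: y_def)
      qed
      have "(\<Sum>i\<in>I. c i * y i) = 0"
        by (simp add: y k_def sum_distrib_left mult.assoc)
      moreover have "(\<Sum>i\<in>I. d i * y i) = 0" if "d \<in> F'" for d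
      proof -
        have "(\<Sum>i\<in>I - {j}. c j * d i * x i) - d j * k = (\<Sum>i\<in>I - {j}. e d i * x i)"
          by (simp add: e_def k_def sum_distrib_left sum_subtractf algebra_simps)
        with x(2)[OF that] show ?thesis by (simp add: y)
      qed
      moreover have "\<exists>i\<in>I. y i \<noteq> 0"
        using x(1) j(2) by (auto simp: y_def)
      ultimately show ?thesis
        unfolding F(1) by blast
    qed
  qed
qed

text \<open>
  The same for equations that are given as linear functionals rather than by coefficients. The assumption on
  dependence says that a functional sees only the unknowns in \<open>I\<close>.
\<close>
lemma integer_kernel:
  fixes F :: "(('i \<Rightarrow> int) \<Rightarrow> int) set"
  assumes I: "finite I" and F: "finite F" "card F < card I"
    and lin: "\<And>L x y k. L \<in> F \<Longrightarrow> L (\<lambda>i. x i + k * y i) = L x + k * L y"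
    and dep: "\<And>L x y. L \<in> F \<Longrightarrow> (\<And>i. i \<in> I \<Longrightarrow> x i = y i) \<Longrightarrow> L x = L y"
  shows "\<exists>x. (\<exists>i\<in>I. x i \<noteq> 0) \<and> (\<forall>L\<in>F. L x = 0)"
proof -
  define co where "co = (\<lambda>(L :: ('i \<Rightarrow> int) \<Rightarrow> int) i. L (\<lambda>j. if j = i then 1 else 0))"
  have expand: "L (\<lambda>j. if j \<in> A then x j else 0) = (\<Sum>i\<in>A. co L i * x i)"
    if L: "L \<in> F" and A: "finite A" for L A x
    using A
  proof induction
    case empty
    show ?case
      using lin[OF L, of "\<lambda>_. 0" 1 "\<lambda>_. 0"] by simp
  next
    case (insert a A)
    have "(\<lambda>j. if j \<in> insert a A then x j else 0) =
        (\<lambda>j. (if j \<in> A then x j else 0) + x a * (if j = a then 1 else 0))"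
      using insert(2) by (auto simp: fun_eq_iff)
    then show ?case
      using insert by (simp add: lin[OF L] co_def mult.commute)
  qed
  have "card (co ` F) \<le> card F"
    using F(1) by (rule card_image_le)
  then obtain x where x: "\<exists>i\<in>I. x i \<noteq> 0" "\<And>L. L \<in> F \<Longrightarrow> (\<Sum>i\<in>I. co L i * x i) = 0"
    using integer_kernel_coeffs[of I "co ` F" "card F"] I F by auto
  have "L x = 0" if "L \<in> F" for L
    using dep[OF that, of x "\<lambda>j. if j \<in> I then x j else 0"] expand[OF that I] x(2)[OF that] by simp
  with x(1) show ?thesis by blast
qed

lemma funpow_bij_betw: "bij_betw k X X \<Longrightarrow> bij_betw (k ^^ i) X X"
  by (induction i) (auto intro: bij_betw_trans simp del: funpow.simps(2) simp: funpow_Suc_right bij_betw_id[unfolded id_def] bij_betw_id)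

text \<open>
  The unknowns are the values of \<open>f\<close> and \<open>g\<close>, twice the number of points of \<open>X\<close>. The equations say that \<open>(f, g)\<close> is
  a cocycle (one equation for each point), that it is a cycle (one equation for each point, the divergence
  summed over the powers of \<open>k\<close>), and that both weighted totals vanish. One cocycle equation is redundant
  because their sum over \<open>X\<close> is zero. The cycle equations at \<open>x1\<close> and at \<open>k x1\<close> are the same, and their common
  value is determined by the others because the sum over \<open>X\<close> is again zero. So, with \<open>n\<close> points,
  \<open>(n - 1) + (n - 2) + 2\<close> equations suffice, one less than the number of unknowns.
\<close>
lemma harmonic_cochain:
  fixes X :: "'x set" and r u k :: "'x \<Rightarrow> 'x" and w :: "'x \<Rightarrow> int"
  assumes X: "finite X" and r: "bij_betw r X X" and u: "bij_betw u X X"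
    and k: "bij_betw k X X" and period: "\<And>x. x \<in> X \<Longrightarrow> (k ^^ m) x = x"
    and x1: "x1 \<in> X" "k x1 \<noteq> x1"
  obtains f g :: "'x \<Rightarrow> int" where "\<exists>x\<in>X. f x \<noteq> 0 \<or> g x \<noteq> 0"
    "\<And>x. x \<in> X \<Longrightarrow> f x + g (r x) = g x + f (u x)"
    "\<And>x. x \<in> X \<Longrightarrow> (\<Sum>i<m. let y = (k ^^ i) x in
        (f (inv_into X r y) - f y) + (g (inv_into X u y) - g y)) = 0"
    "(\<Sum>x\<in>X. w x * f x) = 0" "(\<Sum>x\<in>X. w x * g x) = 0"
proof -
  define I where "I = X \<times> (UNIV :: bool set)"
  define ri ui where "ri = inv_into X r" and "ui = inv_into X u"
  \<comment> \<open>the flag False stands for f and True for g\<close>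
  define face where "face = (\<lambda>s (x :: 'x \<times> bool \<Rightarrow> int). x (s, False) + x (r s, True) - x (s, True) - x (u s, False))"
  define dv where "dv = (\<lambda>s (x :: 'x \<times> bool \<Rightarrow> int). (x (ri s, False) - x (s, False)) + (x (ui s, True) - x (s, True)))"
  define vert where "vert = (\<lambda>s x. \<Sum>i<m. dv ((k ^^ i) s) x)"
  define total where "total = (\<lambda>b (x :: 'x \<times> bool \<Rightarrow> int). \<Sum>s\<in>X. w s * x (s, b))"
  have ri: "bij_betw ri X X" and ui: "bij_betw ui X X"
    using r u by (auto simp: ri_def ui_def intro: bij_betw_inv_into)
  have in_X: "r s \<in> X" "u s \<in> X" "k s \<in> X" "ri s \<in> X" "ui s \<in> X" "(k ^^ i) s \<in> X" if "s \<in> X" for s i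
    using that r u k ri ui funpow_bij_betw[OF k, of i] by (auto simp: bij_betw_def)
  define F where "F = face ` (X - {x1}) \<union> vert ` (X - {x1, k x1}) \<union> {total False, total True}"
  have "card X \<ge> 2"
    using card_mono[of X "{x1, k x1}"] X x1 in_X by simp
  moreover have "card F \<le> (card X - 1) + (card X - 2) + 2"
  proof -
    have "card (face ` (X - {x1})) \<le> card X - 1"
      using X x1 card_image_le[of "X - {x1}" face] by simp
    moreover have "card (vert ` (X - {x1, k x1})) \<le> card X - 2"
      using X x1 in_X card_image_le[of "X - {x1, k x1}" vert] by (simp add: card_Diff_subset)
    moreover have "card {total False, total True} \<le> 2"
      by (simp add: card_insert_if)
    ultimately show ?thesis
      unfolding F_def using card_Un_le[of "face ` (X - {x1}) \<union> vert ` (X - {x1, k x1})" "{total False, total True}"]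
        card_Un_le[of "face ` (X - {x1})" "vert ` (X - {x1, k x1})"] by linarith
  qed
  moreover have "card I = 2 * card X"
    by (simp add: I_def card_cartesian_product)
  ultimately have card: "card F < card I" by linarith
  have fin: "finite I" "finite F"
    using X by (auto simp: I_def F_def)
  have dv_lin: "dv s (\<lambda>i. x i + c * y i) = dv s x + c * dv s y" for s x y c
    by (simp add: dv_def algebra_simps)
  have lin: "L (\<lambda>i. x i + c * y i) = L x + c * L y" if "L \<in> F" for L x y c
    using that unfolding F_def
    by (auto simp: face_def vert_def dv_lin total_def sum.distrib sum_distrib_left algebra_simps)
  have dep: "L x = L y" if "L \<in> F" "\<And>i. i \<in> I \<Longrightarrow> x i = y i" for L x y
  proof -
    have eq: "x (s, b) = y (s, b)" if "s \<in> X" for s b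
      using that \<open>\<And>i. i \<in> I \<Longrightarrow> x i = y i\<close> by (simp add: I_def)
    have "dv s x = dv s y" if "s \<in> X" for s
      using that by (simp add: dv_def eq in_X)
    then show ?thesis
      using \<open>L \<in> F\<close> unfolding F_def
      by (auto simp: face_def vert_def total_def eq in_X intro!: sum.cong)
  qed
  obtain x where x: "\<exists>i\<in>I. x i \<noteq> 0" and F0: "\<And>L. L \<in> F \<Longrightarrow> L x = 0"
  proof -
    have "\<exists>x. (\<exists>i\<in>I. x i \<noteq> 0) \<and> (\<forall>L\<in>F. L x = 0)"
      by (rule integer_kernel[OF fin card]) (fact lin, fact dep)
    then show thesis using that by blast
  qed
  have shift: "(\<Sum>s\<in>X. h (t s)) = (\<Sum>s\<in>X. h s)" if "bij_betw t X X" for t and h :: "'x \<Rightarrow> int"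
    using that by (rule sum.reindex_bij_betw)
  have face_0: "face s x = 0" if s: "s \<in> X" for s
  proof (cases "s = x1")
    case True
    have "(\<Sum>s\<in>X. face s x) = 0"
      by (simp add: face_def sum.distrib sum_subtractf
          shift[OF r, of "\<lambda>s. x (s, True)"] shift[OF u, of "\<lambda>s. x (s, False)"])
    moreover have "(\<Sum>s\<in>X. face s x) = face x1 x + (\<Sum>s\<in>X - {x1}. face s x)"
      using X x1(1) by (rule sum.remove)
    moreover have "(\<Sum>s\<in>X - {x1}. face s x) = 0"
      by (rule sum.neutral) (use F0 in \<open>auto simp: F_def\<close>)
    ultimately show ?thesis
      using True by simp
  next
    case False
    then show ?thesis
      using s F0[of "face s"] by (simp add: F_def)
  qed
  have vert_k: "vert (k s) x = vert s x" if s: "s \<in> X" for s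
  proof -
    have "vert (k s) x + dv s x = (\<Sum>i<Suc m. dv ((k ^^ i) s) x)"
      by (simp add: vert_def sum.lessThan_Suc_shift funpow_swap1 del: sum.lessThan_Suc)
    also have "\<dots> = vert s x + dv s x"
      by (simp add: vert_def period[OF s])
    finally show ?thesis by simp
  qed
  have vert_0: "vert s x = 0" if s: "s \<in> X" for s
  proof (cases "s \<in> {x1, k x1}")
    case True
    have "(\<Sum>s\<in>X. dv s x) = 0"
      by (simp add: dv_def sum.distrib sum_subtractf
          shift[OF ri, of "\<lambda>s. x (s, False)"] shift[OF ui, of "\<lambda>s. x (s, True)"])
    then have "(\<Sum>s\<in>X. vert s x) = 0"
      unfolding vert_def by (subst sum.swap) (simp add: shift[OF funpow_bij_betw[OF k], of "\<lambda>s. dv s x"])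
    moreover have "(\<Sum>s\<in>X. vert s x) = (\<Sum>s\<in>{x1, k x1}. vert s x)"
      by (rule sum.mono_neutral_right) (use X x1 in_X F0 in \<open>auto simp: F_def\<close>)
    ultimately have "2 * vert x1 x = 0"
      using x1(2) vert_k[OF x1(1)] by simp
    then show ?thesis
      using True vert_k[OF x1(1)] by auto
  next
    case False
    then show ?thesis
      using s F0[of "vert s"] by (simp add: F_def)
  qed
  show thesis
  proof (rule that[of "\<lambda>s. x (s, False)" "\<lambda>s. x (s, True)"])
    show "\<exists>s\<in>X. x (s, False) \<noteq> 0 \<or> x (s, True) \<noteq> 0"
      using x unfolding I_def by (metis (full_types) SigmaE)
    show "x (s, False) + x (r s, True) = x (s, True) + x (u s, False)" if "s \<in> X" for s
      using face_0[OF that] by (simp add: face_def)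
    show "(\<Sum>i<m. let y = (k ^^ i) s in (x (inv_into X r y, False) - x (y, False)) +
        (x (inv_into X u y, True) - x (y, True))) = 0" if "s \<in> X" for s
      using vert_0[OF that] by (simp add: vert_def dv_def ri_def ui_def Let_def)
    show "(\<Sum>s\<in>X. w s * x (s, False)) = 0" "(\<Sum>s\<in>X. w s * x (s, True)) = 0"
      using F0[of "total False"] F0[of "total True"] by (simp_all add: F_def total_def)
  qed
qed

section \<open>Cycles coming from a quotient of the set of squares\<close>

text \<open>
  Each vertex of the triangle occurs in two of its sides with opposite signs.
\<close>
lemma boundary_of_boundary:
  assumes "c \<in> cboundaries 1 X"
  shows "cchain_boundary 1 c = 0"
proof -
  obtain d where d: "c = cchain_boundary (Suc (Suc 0)) d" "d \<in> cchains 2 X"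
    using assms by (auto simp: cboundaries_def One_nat_def numeral_2_eq_2)
  have lin: "clinear (\<lambda>c :: 'a cchain. cchain_boundary 1 (cchain_boundary (Suc (Suc 0)) c))"
    using Vector_Spaces.linear_compose[OF linear_cchain_boundary linear_cchain_boundary] by (simp add: o_def)
  have zero: "cchain_boundary 1 (cchain_boundary (Suc (Suc 0)) (csingle \<tau>)) = 0"
    for \<tau> :: "(nat \<Rightarrow> real) \<Rightarrow> 'a"
  proof -
    have "simplical_face j (on_edge 0) \<in> standard_simplex (2 - Suc 0)" if "j \<le> 1" for j
      using that simplical_face_in_standard_simplex[of 1 j "on_edge 0"]
      by (simp add: standard_simplex_0_eq One_nat_def)
    then have ff: "singular_face (Suc 0) j (singular_face 2 i \<tau>) =
        (\<lambda>x\<in>standard_simplex 0. \<tau> (simplical_face i (simplical_face j (on_edge 0))))" if "j \<le> 1" for i j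
      using that by (auto simp: singular_face_def standard_simplex_0_eq intro!: restrict_ext)
    have "simplical_face 0 (simplical_face 0 (on_edge 0)) = simplical_face 1 (simplical_face 0 (on_edge 0))"
      "simplical_face 0 (simplical_face 1 (on_edge 0)) = simplical_face 2 (simplical_face 0 (on_edge 0))"
      "simplical_face 1 (simplical_face 1 (on_edge 0)) = simplical_face 2 (simplical_face 1 (on_edge 0))"
      by (rule ext, auto simp: simplical_face_def on_edge_def One_nat_def)+
    then show ?thesis
      using ff[of 0] ff[of 1]
      by (simp add: cchain_boundary_2_csingle cchain_boundary_simps)
        (simp add: One_nat_def cchain_boundary_1_csingle)
  qed
  have "cchain_boundary 1 (cchain_boundary (Suc (Suc 0)) d) \<in> {0}"
    by (rule clinear_image_in_subspace[OF lin cchain.subspace_single_0]) (simp add: zero)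
  then show ?thesis
    by (simp add: d(1))
qed

text \<open>
  Each point has a period, and the product of these is a common one.
\<close>
lemma finite_bij_period:
  assumes X: "finite X" and k: "bij_betw k X X"
  obtains m :: nat where "m > 0" "\<And>x. x \<in> X \<Longrightarrow> (k ^^ m) x = x"
proof -
  have "\<exists>n>0. (k ^^ n) x = x" if x: "x \<in> X" for x
  proof -
    have in_X: "(k ^^ i) x \<in> X" for i
      using funpow_bij_betw[OF k, of i] x by (auto simp: bij_betw_def)
    have "\<not> inj (\<lambda>i. (k ^^ i) x)"
      using X in_X finite_imageD[of "\<lambda>i. (k ^^ i) x" UNIV] finite_subset[of "range (\<lambda>i. (k ^^ i) x)" X]
      by auto
    then obtain i j where ij: "i < j" "(k ^^ i) x = (k ^^ j) x"
      unfolding inj_def by (metis linorder_less_linear)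
    then have "(k ^^ i) x = (k ^^ i) ((k ^^ (j - i)) x)"
      by (metis add_diff_inverse_nat comp_apply funpow_add less_imp_not_less)
    then have "x = (k ^^ (j - i)) x"
      using funpow_bij_betw[OF k, of i] x in_X by (auto simp: bij_betw_def inj_on_def)
    with ij(1) show ?thesis
      by (intro exI[of _ "j - i"]) simp
  qed
  then obtain n where n: "\<And>x. x \<in> X \<Longrightarrow> n x > 0 \<and> (k ^^ n x) x = x"
    by metis
  have "(k ^^ prod n X) x = x" if x: "x \<in> X" for x
  proof -
    have "((k ^^ n x) ^^ q) x = x" for q
      using n[OF x] by (induction q) simp_all
    moreover have "n x dvd prod n X"
      using X x by (rule dvd_prodI)
    then obtain q where "prod n X = n x * q" by (auto elim: dvdE)
    ultimately show ?thesis
      by (simp add: funpow_mult)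
  qed
  moreover have "prod n X > 0"
    using n by (simp add: prod_pos)
  ultimately show thesis
    using that by blast
qed

text \<open>
  A quotient of the combinatorial data of a square-tiled surface. In the application it describes the quotient of
  the origami by its automorphism group, at the level of squares only.
\<close>
locale square_quotient = square_surface S r u
  for S :: "'s set" and r u +
  fixes X :: "'x set" and r' u' :: "'x \<Rightarrow> 'x" and p :: "'s \<Rightarrow> 'x"
  assumes bij_r': "bij_betw r' X X" and bij_u': "bij_betw u' X X" and p_image: "p ` S = X"
    and p_r: "\<And>s. s \<in> S \<Longrightarrow> p (r s) = r' (p s)" and p_u: "\<And>s. s \<in> S \<Longrightarrow> p (u s) = u' (p s)"
begin

abbreviation "left \<equiv> inv_into S r"
abbreviation "down \<equiv> inv_into S u"
abbreviation "left' \<equiv> inv_into X r'"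
abbreviation "down' \<equiv> inv_into X u'"

lemma finite_X: "finite X"
  using p_image finite_S by auto

lemma p_in_X [simp]: "s \<in> S \<Longrightarrow> p s \<in> X"
  using p_image by auto

lemma bij_left: "bij_betw left S S" and bij_down: "bij_betw down S S"
  and bij_left': "bij_betw left' X X" and bij_down': "bij_betw down' X X"
  using bij_r bij_u bij_r' bij_u' by (simp_all add: bij_betw_inv_into)

lemma inverse_simps:
  "s \<in> S \<Longrightarrow> left s \<in> S" "s \<in> S \<Longrightarrow> down s \<in> S" "x \<in> X \<Longrightarrow> left' x \<in> X" "x \<in> X \<Longrightarrow> down' x \<in> X"
  "s \<in> S \<Longrightarrow> r (left s) = s" "s \<in> S \<Longrightarrow> u (down s) = s" "x \<in> X \<Longrightarrow> r' (left' x) = x" "x \<in> X \<Longrightarrow> u' (down' x) = x"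
  "s \<in> S \<Longrightarrow> left (r s) = s" "s \<in> S \<Longrightarrow> down (u s) = s" "x \<in> X \<Longrightarrow> left' (r' x) = x" "x \<in> X \<Longrightarrow> down' (u' x) = x"
  using bij_left bij_down bij_left' bij_down'
    bij_betw_inv_into_left[OF bij_r] bij_betw_inv_into_left[OF bij_u]
    bij_betw_inv_into_left[OF bij_r'] bij_betw_inv_into_left[OF bij_u']
    bij_betw_inv_into_right[OF bij_r] bij_betw_inv_into_right[OF bij_u]
    bij_betw_inv_into_right[OF bij_r'] bij_betw_inv_into_right[OF bij_u']
  by (auto simp: bij_betw_def)

lemma X_closed: "x \<in> X \<Longrightarrow> r' x \<in> X" "x \<in> X \<Longrightarrow> u' x \<in> X"
  using bij_r' bij_u' by (auto simp: bij_betw_def)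

lemma p_left: "s \<in> S \<Longrightarrow> p (left s) = left' (p s)"
  using p_r[of "left s"] by (metis inverse_simps(1,5,11) p_in_X)

lemma p_down: "s \<in> S \<Longrightarrow> p (down s) = down' (p s)"
  using p_u[of "down s"] by (metis inverse_simps(2,6,12) p_in_X)

definition quotient_div :: "('x \<Rightarrow> complex) \<Rightarrow> ('x \<Rightarrow> complex) \<Rightarrow> 'x \<Rightarrow> complex" where
  "quotient_div a b x = (a (left' x) - a x) + (b (down' x) - b x)"

lemma divergence_quotient: "s \<in> S \<Longrightarrow> divergence (a \<circ> p) (b \<circ> p) s = quotient_div a b (p s)"
  by (simp add: divergence_def quotient_div_def p_left p_down)

text \<open>
  Turning once around the lower left corner: left, down, right, up.
\<close>
definition turn :: "'s \<Rightarrow> 's" where "turn s = u (r (down (left s)))"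

definition turn' :: "'x \<Rightarrow> 'x" where "turn' x = u' (r' (down' (left' x)))"

lemma bij_turn: "bij_betw turn S S" and bij_turn': "bij_betw turn' X X"
  using bij_betw_trans[OF bij_betw_trans[OF bij_betw_trans[OF bij_left bij_down] bij_r] bij_u]
    bij_betw_trans[OF bij_betw_trans[OF bij_betw_trans[OF bij_left' bij_down'] bij_r'] bij_u']
  by (simp_all add: turn_def turn'_def o_def bij_betw_def inj_on_def image_def)

lemma p_turn: "s \<in> S \<Longrightarrow> p (turn s) = turn' (p s)"
  by (simp add: turn_def turn'_def p_r p_u p_left p_down inverse_simps)

lemma vertex_turn:
  assumes s: "s \<in> S"
  shows "vertex (turn s) = vertex s"
proof -
  let ?d = "down (left s)"
  have in_S: "left s \<in> S" "?d \<in> S"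
    using s by (simp_all add: inverse_simps)
  have "pt s (0, 0) = pt (left s) (1, 0)"
    using pt_right[OF in_S(1), of 0] s by (simp add: inverse_simps)
  also have "\<dots> = pt ?d (1, 1)"
    using pt_up[OF in_S(2), of 1] in_S by (simp add: inverse_simps)
  also have "\<dots> = pt (r ?d) (0, 1)"
    using pt_right[OF in_S(2), of 1] by simp
  also have "\<dots> = pt (turn s) (0, 0)"
    using pt_up[of "r ?d" 0] in_S by (simp add: turn_def)
  finally show ?thesis
    by (simp add: vertex_def)
qed

text \<open>
  The vertex does not change when one turns around it, so the sum over \<open>S\<close> may be averaged over the turns; the
  averaged coefficients vanish.
\<close>
lemma sum_around_vertices:
  assumes m: "m > 0" and zero: "\<And>x. x \<in> X \<Longrightarrow> (\<Sum>i<m. d ((turn' ^^ i) x)) = 0"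
  shows "(\<Sum>s\<in>S. cchain_scale (d (p s)) (csingle (vertex s))) = 0"
proof -
  have turn_i: "bij_betw (turn ^^ i) S S" for i
    by (rule funpow_bij_betw[OF bij_turn])
  have in_S: "(turn ^^ i) s \<in> S" if "s \<in> S" for s i
    using that turn_i[of i] by (auto simp: bij_betw_def)
  have p_i: "p ((turn ^^ i) s) = (turn' ^^ i) (p s)" and vertex_i: "vertex ((turn ^^ i) s) = vertex s"
    if "s \<in> S" for s i
    using that by (induction i) (simp_all add: p_turn vertex_turn in_S)
  have "cchain_scale (of_nat m) (\<Sum>s\<in>S. cchain_scale (d (p s)) (csingle (vertex s))) =
      (\<Sum>i<m. \<Sum>s\<in>S. cchain_scale (d (p s)) (csingle (vertex s)))"
    by (subst cchain.sum_constant_scale) simp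
  also have "\<dots> = (\<Sum>i<m. \<Sum>s\<in>S. cchain_scale (d (p ((turn ^^ i) s))) (csingle (vertex ((turn ^^ i) s))))"
    by (rule sum.cong[OF refl]) (rule sum.reindex_bij_betw[OF turn_i, symmetric])
  also have "\<dots> = (\<Sum>s\<in>S. \<Sum>i<m. cchain_scale (d ((turn' ^^ i) (p s))) (csingle (vertex s)))"
    by (subst sum.swap) (simp add: p_i vertex_i cong: sum.cong)
  also have "\<dots> = 0"
    by (simp add: cchain.scale_sum_left[symmetric] zero)
  finally show ?thesis
    using m by simp
qed

text \<open>
  The harmonic cochain is used twice: as an edge chain, pulled back from the quotient, and as a cocycle on the
  surface. Its pairing with itself is a sum of squares, which would be zero for a boundary.
\<close>
theorem exists_nontrivial_quotient_cycle:
  assumes y: "y \<in> X" "u' (r' y) \<noteq> r' (u' y)"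
  obtains a b :: "'x \<Rightarrow> complex" where "edge_chain (a \<circ> p) (b \<circ> p) \<in> ccycles 1 M"
    "cchain_map 1 origami_proj (edge_chain (a \<circ> p) (b \<circ> p)) \<in> cboundaries 1 torus"
    "edge_chain (a \<circ> p) (b \<circ> p) \<notin> cboundaries 1 M"
proof -
  obtain m where m: "m > 0" "\<And>x. x \<in> X \<Longrightarrow> (turn' ^^ m) x = x"
    using finite_bij_period[OF finite_X bij_turn'] by blast
  \<comment> \<open>the square diagonal to y is reached in two ways; turning around the common corner takes one to the other\<close>
  have "turn' (r' (u' y)) = u' (r' y)"
    using y(1) by (simp add: turn'_def inverse_simps X_closed)
  with y have x1: "r' (u' y) \<in> X" "turn' (r' (u' y)) \<noteq> r' (u' y)"
    by (simp_all add: X_closed)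
  \<comment> \<open>sums over squares become sums over the quotient weighted by the sizes of the fibres\<close>
  define w where "w = (\<lambda>x. int (card {s \<in> S. p s = x}))"
  obtain f g where fg: "\<exists>x\<in>X. f x \<noteq> 0 \<or> g x \<noteq> 0"
    "\<And>x. x \<in> X \<Longrightarrow> f x + g (r' x) = g x + f (u' x)"
    "\<And>x. x \<in> X \<Longrightarrow> (\<Sum>i<m. let y = (turn' ^^ i) x in (f (left' y) - f y) + (g (down' y) - g y)) = 0"
    "(\<Sum>x\<in>X. w x * f x) = 0" "(\<Sum>x\<in>X. w x * g x) = 0"
    using harmonic_cochain[OF finite_X bij_r' bij_u' bij_turn' m(2) x1, of w] by blast
  define a b :: "'x \<Rightarrow> complex" where "a = (\<lambda>x. of_int (f x))" and "b = (\<lambda>x. of_int (g x))"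
  have fibres: "(\<Sum>s\<in>S. of_int (h (p s)) :: complex) = of_int (\<Sum>x\<in>X. w x * h x)" for h
  proof -
    have "(\<Sum>s\<in>S. h (p s)) = (\<Sum>x\<in>X. \<Sum>s\<in>{s \<in> S. p s = x}. h (p s))"
      using finite_S finite_X p_image by (intro sum.group[symmetric]) auto
    also have "\<dots> = (\<Sum>x\<in>X. w x * h x)"
      by (intro sum.cong refl) (simp add: w_def)
    finally show ?thesis
      by (metis of_int_sum)
  qed
  show thesis
  proof (rule that[of a b])
    have "(\<Sum>i<m. quotient_div a b ((turn' ^^ i) x)) = 0" if "x \<in> X" for x
      using arg_cong[OF fg(3)[OF that], of "of_int :: int \<Rightarrow> complex"]
      by (simp add: quotient_div_def a_def b_def Let_def)
    from sum_around_vertices[OF m(1) this]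
    have "cchain_boundary 1 (edge_chain (a \<circ> p) (b \<circ> p)) = 0"
      by (simp add: boundary_edge_chain divergence_quotient cong: sum.cong)
    then show "edge_chain (a \<circ> p) (b \<circ> p) \<in> ccycles 1 M"
      by (simp add: ccycles_def edge_chain_in_cchains)
    have "(\<Sum>s\<in>S. (a \<circ> p) s) = 0" "(\<Sum>s\<in>S. (b \<circ> p) s) = 0"
      using fibres[of f] fibres[of g] fg(4,5) by (simp_all add: a_def b_def)
    then show "cchain_map 1 origami_proj (edge_chain (a \<circ> p) (b \<circ> p)) \<in> cboundaries 1 torus"
      unfolding proj_edge_chain by (simp add: cchain.subspace_0[OF subspace_cboundaries])
    show "edge_chain (a \<circ> p) (b \<circ> p) \<notin> cboundaries 1 M"
    proof
      assume bd: "edge_chain (a \<circ> p) (b \<circ> p) \<in> cboundaries 1 M"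
      have cocycle: "(f \<circ> p) s + (g \<circ> p) (r s) = (g \<circ> p) s + (f \<circ> p) (u s)" if "s \<in> S" for s
        using fg(2)[of "p s"] that by (simp add: p_r p_u)
      have "(\<Sum>s\<in>S. (a \<circ> p) s * of_int ((f \<circ> p) s) + (b \<circ> p) s * of_int ((g \<circ> p) s)) = 0"
        using edge_chain_boundary_pairing[of "f \<circ> p" "g \<circ> p"] cocycle bd by blast
      then have "of_int (\<Sum>s\<in>S. f (p s) * f (p s) + g (p s) * g (p s)) = (0 :: complex)"
        by (simp add: a_def b_def)
      then have "(\<Sum>s\<in>S. f (p s) * f (p s) + g (p s) * g (p s)) = 0"
        by (simp only: of_int_eq_0_iff)
      then have "f (p s) * f (p s) + g (p s) * g (p s) = 0" if "s \<in> S" for s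
        using that finite_S by (subst (asm) sum_nonneg_eq_0_iff) auto
      then have "f x = 0 \<and> g x = 0" if "x \<in> X" for x
        using that p_image by (auto simp: sum_squares_eq_zero_iff)
      with fg(1) show False by blast
    qed
  qed
qed

lemma funpow_commute_on:
  assumes "\<And>x. x \<in> X \<Longrightarrow> t x \<in> X" "\<And>x. x \<in> X \<Longrightarrow> t (q x) = q (t x)" "x \<in> X"
  shows "(t ^^ i) (q x) = q ((t ^^ i) x)"
proof -
  have "(t ^^ i) x \<in> X \<and> (t ^^ i) (q x) = q ((t ^^ i) x)"
    using assms by (induction i) auto
  then show ?thesis by blast
qed

text \<open>
  The translation \<open>t\<close> preserves the homology class and the vanishing of the divergence, so all its powers do. The
  sum over a period is therefore homologous to a multiple of the given chain, and it is invariant under \<open>t\<close>.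
\<close>
lemma average_over_powers:
  assumes bij: "bij_betw t X X" and period: "\<And>x. x \<in> X \<Longrightarrow> (t ^^ m) x = x"
    and comm: "\<And>x. x \<in> X \<Longrightarrow> t (left' x) = left' (t x)" "\<And>x. x \<in> X \<Longrightarrow> t (down' x) = down' (t x)"
    and homologous: "\<And>a b. (\<And>x. x \<in> X \<Longrightarrow> quotient_div a b x = 0) \<Longrightarrow>
      edge_chain (a \<circ> t \<circ> p) (b \<circ> t \<circ> p) - edge_chain (a \<circ> p) (b \<circ> p) \<in> cboundaries 1 M"
    and ab: "\<And>x. x \<in> X \<Longrightarrow> quotient_div a b x = 0"
    and av: "\<And>a. av a = (\<lambda>x. \<Sum>i<m. a ((t ^^ i) x) :: complex)"
  shows "edge_chain (av a \<circ> p) (av b \<circ> p) - cchain_scale (of_nat m) (edge_chain (a \<circ> p) (b \<circ> p)) \<in> cboundaries 1 M"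
    and "\<And>x. x \<in> X \<Longrightarrow> quotient_div (av a) (av b) x = 0"
    and "\<And>f x. x \<in> X \<Longrightarrow> av f (t x) = av f x"
proof -
  have t_X: "t x \<in> X" "(t ^^ i) x \<in> X" if "x \<in> X" for x i
    using that bij funpow_bij_betw[OF bij, of i] by (auto simp: bij_betw_def)
  have comm_i: "(t ^^ i) (left' x) = left' ((t ^^ i) x)" "(t ^^ i) (down' x) = down' ((t ^^ i) x)"
    if "x \<in> X" for x i
    using funpow_commute_on[of t left'] funpow_commute_on[of t down'] t_X(1) comm that by blast+
  have div_i: "quotient_div (a \<circ> t ^^ i) (b \<circ> t ^^ i) x = 0" if "x \<in> X" for x i
    using ab[OF t_X(2)[OF that, of i]] comm_i[OF that] by (simp add: quotient_div_def)
  have iter: "edge_chain (a \<circ> t ^^ i \<circ> p) (b \<circ> t ^^ i \<circ> p) - edge_chain (a \<circ> p) (b \<circ> p) \<in> cboundaries 1 M" for i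
  proof (induction i)
    case 0
    then show ?case
      using cchain.subspace_0[OF subspace_cboundaries] by simp
  next
    case (Suc i)
    have "a \<circ> t ^^ Suc i = a \<circ> t ^^ i \<circ> t" "b \<circ> t ^^ Suc i = b \<circ> t ^^ i \<circ> t"
      by (simp_all add: o_assoc[symmetric] funpow_Suc_right del: funpow.simps)
    note eq = this
    have "(edge_chain (a \<circ> t ^^ i \<circ> t \<circ> p) (b \<circ> t ^^ i \<circ> t \<circ> p) - edge_chain (a \<circ> t ^^ i \<circ> p) (b \<circ> t ^^ i \<circ> p))
        + (edge_chain (a \<circ> t ^^ i \<circ> p) (b \<circ> t ^^ i \<circ> p) - edge_chain (a \<circ> p) (b \<circ> p)) \<in> cboundaries 1 M"
      by (intro cchain.subspace_add[OF subspace_cboundaries] homologous div_i Suc)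
    then show ?case
      unfolding eq by (simp only: add_diff_eq diff_add_cancel)
  qed
  have "edge_chain (av a \<circ> p) (av b \<circ> p) = (\<Sum>i<m. edge_chain (a \<circ> t ^^ i \<circ> p) (b \<circ> t ^^ i \<circ> p))"
    by (simp add: edge_chain_sum av o_def)
  moreover have "cchain_scale (of_nat m) (edge_chain (a \<circ> p) (b \<circ> p)) = (\<Sum>i<m. edge_chain (a \<circ> p) (b \<circ> p))"
    by (subst cchain.sum_constant_scale) simp
  ultimately show "edge_chain (av a \<circ> p) (av b \<circ> p) - cchain_scale (of_nat m) (edge_chain (a \<circ> p) (b \<circ> p)) \<in> cboundaries 1 M"
    using iter by (simp add: sum_subtractf[symmetric] cchain.subspace_sum[OF subspace_cboundaries])
  show "quotient_div (av a) (av b) x = 0" if "x \<in> X" for x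
  proof -
    have "quotient_div (av a) (av b) x = (\<Sum>i<m. quotient_div (a \<circ> t ^^ i) (b \<circ> t ^^ i) x)"
      by (simp add: quotient_div_def av sum.distrib sum_subtractf)
    then show ?thesis
      by (simp add: div_i[OF that])
  qed
  show "av f (t x) = av f x" if x: "x \<in> X" for f x
  proof -
    have "av f (t x) + f x = (\<Sum>i<Suc m. f ((t ^^ i) x))"
      by (simp add: av sum.lessThan_Suc_shift funpow_swap1 del: sum.lessThan_Suc)
    also have "\<dots> = av f x + f x"
      by (simp add: av period[OF x])
    finally show ?thesis
      by simp
  qed
qed

text \<open>
  When the two translations of the quotient commute, the divergence of the chain vanishes at every square, and the
  chain can be averaged first over the horizontal and then over the vertical translations. The result is
  invariant under both; by transitivity its coefficients are constants \<open>A\<close> and \<open>B\<close>. Its image in the torus is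
  \<open>A\<close> and \<open>B\<close> times the number of squares on the two standard loops, so both vanish.
\<close>
theorem invariant_cycle_eq_boundary:
  assumes comm: "\<And>x. x \<in> X \<Longrightarrow> u' (r' x) = r' (u' x)"
    and trans: "\<And>(d :: 'x \<Rightarrow> complex) x y. (\<And>x. x \<in> X \<Longrightarrow> d (r' x) = d x) \<Longrightarrow> (\<And>x. x \<in> X \<Longrightarrow> d (u' x) = d x) \<Longrightarrow>
      x \<in> X \<Longrightarrow> y \<in> X \<Longrightarrow> d x = d y"
    and c: "c \<in> ccycles 1 M" and c_edge: "c - edge_chain (a \<circ> p) (b \<circ> p) \<in> cboundaries 1 M"
    and proj: "cchain_map 1 origami_proj c \<in> cboundaries 1 torus"
  shows "c \<in> cboundaries 1 M"
proof -
  have comm': "left' (down' x) = down' (left' x)" if x: "x \<in> X" for x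
  proof -
    have "x = u' (r' (left' (down' x)))"
      using x by (simp add: inverse_simps)
    also have "\<dots> = r' (u' (left' (down' x)))"
      by (rule comm) (simp add: x inverse_simps)
    finally show ?thesis
      using x X_closed inverse_simps by (metis (no_types, lifting))
  qed
  have homologous: "edge_chain (a \<circ> left' \<circ> p) (b \<circ> left' \<circ> p) - edge_chain (a \<circ> p) (b \<circ> p) \<in> cboundaries 1 M"
    "edge_chain (a \<circ> down' \<circ> p) (b \<circ> down' \<circ> p) - edge_chain (a \<circ> p) (b \<circ> p) \<in> cboundaries 1 M"
    if Z: "\<And>x. x \<in> X \<Longrightarrow> quotient_div a b x = 0" for a b
  proof -
    have "divergence (a \<circ> p) (b \<circ> p) s = 0" if "s \<in> S" for s
      using that Z by (simp add: divergence_quotient)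
    note tr = edge_chain_translate[of "a \<circ> p" "b \<circ> p", OF this]
    have "edge_chain (a \<circ> left' \<circ> p) (b \<circ> left' \<circ> p) = edge_chain (a \<circ> p \<circ> left) (b \<circ> p \<circ> left)"
      "edge_chain (a \<circ> down' \<circ> p) (b \<circ> down' \<circ> p) = edge_chain (a \<circ> p \<circ> down) (b \<circ> p \<circ> down)"
      by (intro edge_chain_cong; simp add: p_left p_down)+
    then show "edge_chain (a \<circ> left' \<circ> p) (b \<circ> left' \<circ> p) - edge_chain (a \<circ> p) (b \<circ> p) \<in> cboundaries 1 M"
      "edge_chain (a \<circ> down' \<circ> p) (b \<circ> down' \<circ> p) - edge_chain (a \<circ> p) (b \<circ> p) \<in> cboundaries 1 M"
      using tr by simp_all
  qed
  have "cchain_boundary 1 c = 0"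
    using c by (simp add: ccycles_def)
  then have "cchain_boundary 1 (edge_chain (a \<circ> p) (b \<circ> p)) = 0"
    using boundary_of_boundary[OF c_edge] by (simp add: cchain_boundary_simps)
  moreover have "divergence (a \<circ> p) (b \<circ> p) (u (r s)) = divergence (a \<circ> p) (b \<circ> p) (r (u s))" if "s \<in> S" for s
    using that comm[of "p s"] by (simp add: divergence_quotient p_r p_u)
  ultimately have "divergence (a \<circ> p) (b \<circ> p) s = 0" if "s \<in> S" for s
    using that by (intro divergence_eq_0)
  then have Z0: "quotient_div a b x = 0" if "x \<in> X" for x
    using that p_image by (auto simp: divergence_quotient)
  obtain m where m: "m > 0" "\<And>x. x \<in> X \<Longrightarrow> (left' ^^ m) x = x"
    using finite_bij_period[OF finite_X bij_left'] by blast
  obtain n where n: "n > 0" "\<And>x. x \<in> X \<Longrightarrow> (down' ^^ n) x = x"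
    using finite_bij_period[OF finite_X bij_down'] by blast
  define av1 where "av1 = (\<lambda>(a :: 'x \<Rightarrow> complex) x. \<Sum>i<m. a ((left' ^^ i) x))"
  define av2 where "av2 = (\<lambda>(a :: 'x \<Rightarrow> complex) x. \<Sum>i<n. a ((down' ^^ i) x))"
  have av1: "edge_chain (av1 a \<circ> p) (av1 b \<circ> p) - cchain_scale (of_nat m) (edge_chain (a \<circ> p) (b \<circ> p)) \<in> cboundaries 1 M"
    "\<And>x. x \<in> X \<Longrightarrow> quotient_div (av1 a) (av1 b) x = 0" "\<And>a x. x \<in> X \<Longrightarrow> av1 a (left' x) = av1 a x"
    by (rule average_over_powers[OF bij_left' m(2), where av = av1 and a = a and b = b];
        simp add: comm' homologous Z0 av1_def)+
  have av2: "edge_chain (av2 (av1 a) \<circ> p) (av2 (av1 b) \<circ> p) -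
      cchain_scale (of_nat n) (edge_chain (av1 a \<circ> p) (av1 b \<circ> p)) \<in> cboundaries 1 M"
    "\<And>a x. x \<in> X \<Longrightarrow> av2 a (down' x) = av2 a x"
    by (rule average_over_powers[OF bij_down' n(2), where av = av2 and a = "av1 a" and b = "av1 b"];
        simp add: comm' homologous av1(2) av2_def)+
  have inv_left: "av2 (av1 f) (left' x) = av2 (av1 f) x" if x: "x \<in> X" for f x
  proof -
    have "(down' ^^ i) x \<in> X" "(down' ^^ i) (left' x) = left' ((down' ^^ i) x)" for i
      using funpow_commute_on[of down' left' x i] funpow_bij_betw[OF bij_down', of i] comm' inverse_simps(4) x
      by (auto simp: bij_betw_def)
    then show ?thesis
      by (simp add: av2_def av1(3))
  qed
  have const: "av2 (av1 f) x = av2 (av1 f) y" if "x \<in> X" "y \<in> X" for f x y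
  proof (rule trans[OF _ _ that])
    show "av2 (av1 f) (r' x) = av2 (av1 f) x" "av2 (av1 f) (u' x) = av2 (av1 f) x" if "x \<in> X" for x
      using that inv_left[of "r' x"] av2(2)[of "u' x" "av1 f"] by (simp_all add: X_closed inverse_simps)
  qed
  then obtain A B where AB: "\<And>x. x \<in> X \<Longrightarrow> av2 (av1 a) x = A" "\<And>x. x \<in> X \<Longrightarrow> av2 (av1 b) x = B"
    by (metis (no_types, lifting))
  have "edge_chain (av2 (av1 a) \<circ> p) (av2 (av1 b) \<circ> p) = edge_chain (\<lambda>_. A) (\<lambda>_. B)"
    by (rule edge_chain_cong) (simp_all add: AB)
  with av2(1) have const_class: "edge_chain (\<lambda>_. A) (\<lambda>_. B) - cchain_scale (of_nat n) (edge_chain (av1 a \<circ> p) (av1 b \<circ> p)) \<in> cboundaries 1 M"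
    by simp
  let ?e = "edge_chain (a \<circ> p) (b \<circ> p)" and ?e1 = "edge_chain (av1 a \<circ> p) (av1 b \<circ> p)"
    and ?k = "of_nat n * of_nat m :: complex"
  have "edge_chain (\<lambda>_. A) (\<lambda>_. B) - cchain_scale ?k c = (edge_chain (\<lambda>_. A) (\<lambda>_. B) - cchain_scale (of_nat n) ?e1)
      + cchain_scale (of_nat n) (?e1 - cchain_scale (of_nat m) ?e) - cchain_scale ?k (c - ?e)"
    by (simp add: cchain.scale_right_diff_distrib)
  also have "\<dots> \<in> cboundaries 1 M"
    by (intro cchain.subspace_add[OF subspace_cboundaries] cchain.subspace_diff[OF subspace_cboundaries]
        cchain.subspace_scale[OF subspace_cboundaries] const_class av1(1) c_edge)
  finally have hom: "edge_chain (\<lambda>_. A) (\<lambda>_. B) - cchain_scale ?k c \<in> cboundaries 1 M" .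
  have "cchain_map 1 origami_proj (edge_chain (\<lambda>_. A) (\<lambda>_. B)) - cchain_scale ?k (cchain_map 1 origami_proj c) \<in> cboundaries 1 torus"
    using cchain_map_in_cboundaries[OF continuous_map_proj hom] by (simp add: cchain_map_simps)
  from cchain.subspace_add[OF subspace_cboundaries this cchain.subspace_scale[OF subspace_cboundaries proj, of ?k]]
  have "cchain_map 1 origami_proj (edge_chain (\<lambda>_. A) (\<lambda>_. B)) \<in> cboundaries 1 torus"
    by simp
  then have "(\<Sum>s\<in>S. A) = 0" "(\<Sum>s\<in>S. B) = 0"
    unfolding proj_edge_chain by (rule torus_edges_independent)+
  then have "edge_chain (\<lambda>_. A) (\<lambda>_. B) = 0"
    using finite_S by (auto simp: edge_chain_def)
  then have "cchain_scale ?k c \<in> cboundaries 1 M"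
    using cchain.subspace_neg[OF subspace_cboundaries hom] by simp
  from cchain.subspace_scale[OF subspace_cboundaries this, of "1 / ?k"] show ?thesis
    using m(1) n(1) by simp
qed

end

section \<open>Averaging over automorphisms\<close>

text \<open>
  Every permutation of the squares that respects the gluings comes from an automorphism, so an invariant class is
  homologous to each of the permuted edge chains and to their average.
\<close>
lemma (in square_surface) invariant_class_average:
  assumes c: "c \<in> ccycles 1 M"
    and inv: "\<And>f. f \<in> origami_aut M \<Longrightarrow> cchain_map 1 f c - c \<in> cboundaries 1 M"
    and N: "finite N" "N \<noteq> {}"
    and \<tau>: "\<And>n. n \<in> N \<Longrightarrow> bij_betw (\<tau> n) S S"
      "\<And>n s. n \<in> N \<Longrightarrow> s \<in> S \<Longrightarrow> \<tau> n (r s) = r (\<tau> n s)" "\<And>n s. n \<in> N \<Longrightarrow> s \<in> S \<Longrightarrow> \<tau> n (u s) = u (\<tau> n s)"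
  obtains a b where "c - edge_chain (\<lambda>s. \<Sum>n\<in>N. a (inv_into S (\<tau> n) s)) (\<lambda>s. \<Sum>n\<in>N. b (inv_into S (\<tau> n) s)) \<in> cboundaries 1 M"
proof -
  obtain a b where ab: "c - edge_chain a b \<in> cboundaries 1 M"
    using cycle_in_edge_classes[OF c] by (auto simp: edge_classes_def)
  have *: "c - edge_chain (a \<circ> inv_into S (\<tau> n)) (b \<circ> inv_into S (\<tau> n)) \<in> cboundaries 1 M" if n: "n \<in> N" for n
  proof -
    obtain f where f: "f \<in> origami_aut M" "\<And>s v. s \<in> S \<Longrightarrow> v \<in> unit_square \<Longrightarrow> f (pt s v) = pt (\<tau> n s) v"
      using origami_aut_of_permutation[OF \<tau>(1)[OF n] \<tau>(2)[OF n] \<tau>(3)[OF n]] by blast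
    have "continuous_map M M f"
      using f(1) by (auto simp: origami_aut_def homeomorphic_imp_continuous_map)
    from cchain_map_in_cboundaries[OF this ab]
    have "cchain_map 1 f c - edge_chain (a \<circ> inv_into S (\<tau> n)) (b \<circ> inv_into S (\<tau> n)) \<in> cboundaries 1 M"
      by (simp add: cchain_map_simps map_edge_chain[OF \<tau>(1)[OF n] f(2)])
    from cchain.subspace_diff[OF subspace_cboundaries this inv[OF f(1)]] show ?thesis
      by simp
  qed
  let ?k = "1 / of_nat (card N) :: complex"
  have k: "of_nat (card N) * ?k = 1"
    using N by simp
  have eq: "(\<Sum>n\<in>N. c - edge_chain (a \<circ> inv_into S (\<tau> n)) (b \<circ> inv_into S (\<tau> n))) =
    cchain_scale (of_nat (card N)) c - edge_chain (\<lambda>s. \<Sum>n\<in>N. a (inv_into S (\<tau> n) s)) (\<lambda>s. \<Sum>n\<in>N. b (inv_into S (\<tau> n) s))"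
    by (simp add: sum_subtractf edge_chain_sum cchain.sum_constant_scale o_def)
  have "(\<Sum>n\<in>N. c - edge_chain (a \<circ> inv_into S (\<tau> n)) (b \<circ> inv_into S (\<tau> n))) \<in> cboundaries 1 M"
    by (intro cchain.subspace_sum[OF subspace_cboundaries] *)
  from cchain.subspace_scale[OF subspace_cboundaries this[unfolded eq], of ?k]
  have "c - edge_chain (\<lambda>s. \<Sum>n\<in>N. ?k * a (inv_into S (\<tau> n) s)) (\<lambda>s. \<Sum>n\<in>N. ?k * b (inv_into S (\<tau> n) s)) \<in> cboundaries 1 M"
    using N by (simp add: cchain.scale_right_diff_distrib edge_chain_scale sum_distrib_left)
  then show thesis
    by (rule that[of "\<lambda>s. ?k * a s" "\<lambda>s. ?k * b s"])
qed

section \<open>Cosets\<close>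

context group
begin

lemma mem_normalizer_iff:
  assumes H: "H \<subseteq> carrier G"
  shows "n \<in> normalizer G H \<longleftrightarrow> n \<in> carrier G \<and> n <# H = H #> n"
proof -
  have "n <# H #> inv n = H \<longleftrightarrow> n <# H = H #> n" if n: "n \<in> carrier G"
  proof
    assume "n <# H #> inv n = H"
    then have "(n <# H #> inv n) #> n = H #> n" by simp
    then show "n <# H = H #> n"
      using n H by (simp add: coset_mult_assoc l_coset_subset_G)
  next
    assume "n <# H = H #> n"
    then show "n <# H #> inv n = H"
      using n H by (simp add: coset_mult_assoc)
  qed
  then show ?thesis
    using H by (auto simp: normalizer_def stabilizer_def)
qed

text \<open>
  If \<open>N x y = N y x\<close> for all \<open>x\<close>, \<open>y\<close>, then \<open>N x n = N n x = N x\<close> for \<open>n\<close> in \<open>N\<close>, so \<open>x n x\<^sup>-\<^sup>1\<close> is in \<open>N\<close>.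
\<close>
lemma normal_abelian_iff_commuting_cosets:
  assumes N: "subgroup N G"
  shows "N \<lhd> G \<and> comm_group (G Mod N) \<longleftrightarrow>
    (\<forall>x\<in>carrier G. \<forall>y\<in>carrier G. N #> (x \<otimes> y) = N #> (y \<otimes> x))"
proof (intro iffI conjI ballI)
  fix x y assume asm: "N \<lhd> G \<and> comm_group (G Mod N)" and x: "x \<in> carrier G" and y: "y \<in> carrier G"
  interpret N: normal N G using asm by blast
  interpret Q: comm_group "G Mod N" using asm by blast
  have "(N #> x) <#> (N #> y) = (N #> y) <#> (N #> x)"
    using Q.m_comm[of "N #> x" "N #> y"] x y
    by (auto simp: FactGroup_def RCOSETS_def)
  then show "N #> (x \<otimes> y) = N #> (y \<otimes> x)"
    using x y by (simp add: N.rcos_sum)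
next
  assume comm: "\<forall>x\<in>carrier G. \<forall>y\<in>carrier G. N #> (x \<otimes> y) = N #> (y \<otimes> x)"
  show normal: "N \<lhd> G"
    unfolding normal_inv_iff
  proof (intro conjI ballI N)
    fix x n assume x: "x \<in> carrier G" and n: "n \<in> N"
    have nG: "n \<in> carrier G" using n N by (rule subgroup.mem_carrier[rotated])
    have "N #> (x \<otimes> n) = N #> (n \<otimes> x)"
      using comm x nG by blast
    also have "\<dots> = N #> x"
      using coset_mult_assoc[OF subgroup.subset[OF N] nG x] coset_join2[OF nG N n] by simp
    finally have "x \<otimes> n \<in> N #> x"
      using rcos_self[OF m_closed[OF x nG] N] by simp
    then show "x \<otimes> n \<otimes> inv x \<in> N"
      using subgroup.rcos_module[OF N is_group x m_closed[OF x nG]] by simp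
  qed
  interpret N: normal N G by (rule normal)
  show "comm_group (G Mod N)"
  proof (rule group.group_comm_groupI[OF N.factorgroup_is_group])
    fix A B assume "A \<in> carrier (G Mod N)" "B \<in> carrier (G Mod N)"
    then obtain x y where "x \<in> carrier G" "y \<in> carrier G" "A = N #> x" "B = N #> y"
      by (auto simp: FactGroup_def RCOSETS_def)
    then show "A \<otimes>\<^bsub>G Mod N\<^esub> B = B \<otimes>\<^bsub>G Mod N\<^esub> A"
      using comm by (simp add: FactGroup_def N.rcos_sum)
  qed
qed

end

locale origami_data = group G for G (structure) +
  fixes gr gu :: 'a and H :: "'a set"
  assumes finite_G: "finite (carrier G)"
    and gr: "gr \<in> carrier G" and gu: "gu \<in> carrier G"
    and gen: "generate G {gr, gu} = carrier G" and H: "subgroup H G"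
begin

abbreviation "N \<equiv> normalizer G H"
abbreviation "squares \<equiv> rcosets\<^bsub>G\<^esub> H"

text \<open>
  The map \<open>H g \<mapsto> N g\<close>, written as a product of sets so that no representative has to be chosen.
\<close>
definition coset_map :: "'a set \<Rightarrow> 'a set" where
  "coset_map A = N <#> A"

lemma H_sub: "H \<subseteq> carrier G"
  using H by (rule subgroup.subset)

lemma N: "subgroup N G"
  using H_sub by (rule normalizer_imp_subgroup)

lemma N_sub: "N \<subseteq> carrier G"
  using N by (rule subgroup.subset)

lemma in_N: "n \<in> N \<Longrightarrow> n \<in> carrier G" "n \<in> N \<Longrightarrow> inv n \<in> N" "m \<in> N \<Longrightarrow> n \<in> N \<Longrightarrow> m \<otimes> n \<in> N"
  using N N_sub by (auto intro: subgroup.m_inv_closed subgroup.m_closed)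

lemma N_coset: "n \<in> N \<Longrightarrow> g \<in> carrier G \<Longrightarrow> N #> (n \<otimes> g) = N #> g"
  using coset_mult_assoc[OF N_sub in_N(1)] coset_join2[OF in_N(1) N] by metis

lemma normalizer_coset: "n \<in> N \<Longrightarrow> g \<in> carrier G \<Longrightarrow> n <# (H #> g) = H #> (n \<otimes> g)"
  using mem_normalizer_iff[OF H_sub, of n] coset_assoc[of n g H] H_sub
  by (simp add: coset_mult_assoc)

lemma coset_map_eq:
  assumes g: "g \<in> carrier G"
  shows "coset_map (H #> g) = N #> g"
proof -
  have "H \<subseteq> N"
    using coset_join2[OF _ H] coset_join3[OF _ H] H_sub by (auto simp: mem_normalizer_iff[OF H_sub])
  have "N <#> H = N"
  proof
    show "N <#> H \<subseteq> N"
      using \<open>H \<subseteq> N\<close> in_N(3) by (auto simp: set_mult_def)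
    show "N \<subseteq> N <#> H"
      using subgroup.one_closed[OF H] in_N(1) by (force simp: set_mult_def)
  qed
  then show ?thesis
    using setmult_rcos_assoc[OF N_sub H_sub g] by (simp add: coset_map_def)
qed

lemma square_cases:
  assumes "A \<in> squares"
  obtains g where "g \<in> carrier G" "A = H #> g"
  using assms by (auto simp: RCOSETS_def)

lemma bij_right_mult:
  assumes K: "subgroup K G" and g: "g \<in> carrier G"
  shows "bij_betw (\<lambda>A. A #> g) (rcosets K) (rcosets K)"
proof (rule bij_betw_byWitness[where f' = "\<lambda>A. A #> inv g"])
  have sub: "K \<subseteq> carrier G" using K by (rule subgroup.subset)
  show "\<forall>A\<in>rcosets K. A #> g #> inv g = A" "\<forall>A\<in>rcosets K. A #> inv g #> g = A"
    using g sub by (auto simp: RCOSETS_def coset_mult_assoc m_assoc)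
  show "(\<lambda>A. A #> g) ` (rcosets K) \<subseteq> rcosets K" "(\<lambda>A. A #> inv g) ` (rcosets K) \<subseteq> rcosets K"
  proof -
    have "A #> h \<in> rcosets K" if "A \<in> rcosets K" "h \<in> carrier G" for A h
      using that sub rcosetsI[OF sub m_closed] by (auto simp: RCOSETS_def coset_mult_assoc)
    with g show "(\<lambda>A. A #> g) ` (rcosets K) \<subseteq> rcosets K" "(\<lambda>A. A #> inv g) ` (rcosets K) \<subseteq> rcosets K"
      by auto
  qed
qed

lemma right_mult_simps:
  assumes "A \<in> squares" "g \<in> carrier G" "h \<in> carrier G"
  shows "A #> g \<in> squares" "A #> g #> h = A #> (g \<otimes> h)" "A #> \<one> = A" "coset_map (A #> g) = coset_map A #> g"
proof -
  obtain k where k: "k \<in> carrier G" "A = H #> k"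
    using assms(1) by (rule square_cases)
  then show "A #> g \<in> squares" "A #> g #> h = A #> (g \<otimes> h)" "A #> \<one> = A"
    using assms H_sub by (auto simp: RCOSETS_def coset_mult_assoc m_assoc)
  have "coset_map (A #> g) = N #> (k \<otimes> g)"
    using k assms(2) H_sub by (simp add: coset_mult_assoc coset_map_eq)
  also have "\<dots> = coset_map A #> g"
    using k assms(2) N_sub by (simp add: coset_mult_assoc coset_map_eq)
  finally show "coset_map (A #> g) = coset_map A #> g" .
qed

text \<open>
  In a finite group inverses are powers, so an induction over words needs only right multiplication by the two
  generators.
\<close>
lemma generator_induct:
  assumes g: "g \<in> carrier G" and one: "P \<one>"
    and step: "\<And>h. h \<in> carrier G \<Longrightarrow> P h \<Longrightarrow> P (h \<otimes> gr)" "\<And>h. h \<in> carrier G \<Longrightarrow> P h \<Longrightarrow> P (h \<otimes> gu)"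
  shows "P g"
proof -
  have powers: "P (h \<otimes> k [^] (i :: nat))"
    if "h \<in> carrier G" "P h" "k \<in> carrier G" "\<And>h. h \<in> carrier G \<Longrightarrow> P h \<Longrightarrow> P (h \<otimes> k)" for h k i
    using that by (induction i) (simp_all add: m_assoc[symmetric])
  have inverse: "P (h \<otimes> inv k)"
    if h: "h \<in> carrier G" "P h" and k: "k \<in> carrier G" "\<And>h. h \<in> carrier G \<Longrightarrow> P h \<Longrightarrow> P (h \<otimes> k)" for h k
  proof -
    have "k [^] Coset.order G = \<one>"
      using k(1) finite_G by (simp add: pow_order_eq_1)
    moreover have "Coset.order G > 0"
      using finite_G by (simp add: order_gt_0_iff_finite)
    then have "k [^] Coset.order G = k [^] (Coset.order G - 1) \<otimes> k"
      by (metis Suc_pred' nat_pow_Suc One_nat_def)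
    ultimately have "inv k = k [^] (Coset.order G - 1)"
      using k(1) by (intro inv_equality) auto
    with powers[OF h k] show ?thesis by simp
  qed
  have "\<forall>h\<in>carrier G. P h \<longrightarrow> P (h \<otimes> x)" if "x \<in> generate G {gr, gu}" for x
    using that
  proof (induction rule: generate.induct)
    case one
    then show ?case by simp
  next
    case (incl x)
    then show ?case using step by auto
  next
    case (inv x)
    then show ?case using inverse step gr gu by auto
  next
    case (eng x y)
    then have "x \<in> carrier G" "y \<in> carrier G" using gen by auto
    with eng.IH show ?case by (simp add: m_assoc[symmetric])
  qed
  then have "P (\<one> \<otimes> g)"
    using g gen one by blast
  with g show ?thesis by simp
qed

sublocale Q: square_quotient squares "\<lambda>A. A #> gr" "\<lambda>A. A #> gu"
  "rcosets N" "\<lambda>A. A #> gr" "\<lambda>A. A #> gu" coset_map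
proof (unfold_locales)
  show "finite squares"
    using finite_G by (auto simp: RCOSETS_def)
  show "coset_map ` squares = rcosets N"
    by (auto simp: RCOSETS_def coset_map_eq image_iff)
qed (simp_all add: bij_right_mult H N gr gu right_mult_simps(4)[OF _ _ gr])

text \<open>
  Commuting of two elements on the cosets of \<open>N\<close> is preserved by products, so it extends from the generators to all
  elements; at the coset \<open>N\<close> it becomes \<open>N x y = N y x\<close>. In the other direction \<open>N (x y)\<close> has to be moved past
  a further factor \<open>a\<close>, which is possible since \<open>N a (x y) = N (x y) a\<close>.
\<close>
lemma commuting_iff:
  "(\<forall>A\<in>rcosets N. A #> gr #> gu = A #> gu #> gr) \<longleftrightarrow>
    (\<forall>x\<in>carrier G. \<forall>y\<in>carrier G. N #> (x \<otimes> y) = N #> (y \<otimes> x))"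
proof
  assume comm: "\<forall>A\<in>rcosets N. A #> gr #> gu = A #> gu #> gr"
  define C where "C = (\<lambda>g k. \<forall>a\<in>carrier G. N #> (a \<otimes> g \<otimes> k) = N #> (a \<otimes> k \<otimes> g))"
  have sym: "C k g" if "C g k" for g k
    using that by (simp add: C_def)
  have mult: "C (g \<otimes> h) k" if "C g k" "C h k" "g \<in> carrier G" "h \<in> carrier G" "k \<in> carrier G" for g h k
    unfolding C_def
  proof
    fix a assume a: "a \<in> carrier G"
    have "N #> (a \<otimes> (g \<otimes> h) \<otimes> k) = N #> ((a \<otimes> g) \<otimes> h \<otimes> k)"
      using a that by (simp add: m_assoc)
    also have "\<dots> = N #> ((a \<otimes> g) \<otimes> k \<otimes> h)"
      using that a by (simp add: C_def)
    also have "\<dots> = (N #> (a \<otimes> g \<otimes> k)) #> h"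
      using that a N_sub by (simp add: coset_mult_assoc)
    also have "\<dots> = (N #> (a \<otimes> k \<otimes> g)) #> h"
      using that a by (simp add: C_def)
    also have "\<dots> = N #> (a \<otimes> k \<otimes> (g \<otimes> h))"
      using that a N_sub by (simp add: coset_mult_assoc m_assoc)
    finally show "N #> (a \<otimes> (g \<otimes> h) \<otimes> k) = N #> (a \<otimes> k \<otimes> (g \<otimes> h))" .
  qed
  have one: "C \<one> k" if "k \<in> carrier G" for k
    using that by (simp add: C_def)
  have extend: "C g k" if "C gr k" "C gu k" "g \<in> carrier G" "k \<in> carrier G" for g k
    using that(3) by (rule generator_induct) (use that one mult gr gu in auto)
  have "C gr gu"
    unfolding C_def
  proof
    fix a assume a: "a \<in> carrier G"
    then have "N #> a \<in> rcosets N"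
      by (auto simp: RCOSETS_def)
    with comm have "N #> a #> gr #> gu = N #> a #> gu #> gr"
      by blast
    then show "N #> (a \<otimes> gr \<otimes> gu) = N #> (a \<otimes> gu \<otimes> gr)"
      using a gr gu N_sub by (simp add: coset_mult_assoc m_assoc)
  qed
  moreover have "C g g" for g
    by (simp add: C_def)
  ultimately have "C g gr" "C g gu" if "g \<in> carrier G" for g
    using that gr gu sym extend by blast+
  then have C: "C g k" if "g \<in> carrier G" "k \<in> carrier G" for g k
    using extend[of k g] that by (blast intro: sym)
  show "\<forall>x\<in>carrier G. \<forall>y\<in>carrier G. N #> (x \<otimes> y) = N #> (y \<otimes> x)"
  proof (intro ballI)
    fix x y assume xy: "x \<in> carrier G" "y \<in> carrier G"
    then have "N #> (\<one> \<otimes> x \<otimes> y) = N #> (\<one> \<otimes> y \<otimes> x)"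
      using C[of x y] unfolding C_def by blast
    then show "N #> (x \<otimes> y) = N #> (y \<otimes> x)"
      using xy by simp
  qed
next
  assume comm: "\<forall>x\<in>carrier G. \<forall>y\<in>carrier G. N #> (x \<otimes> y) = N #> (y \<otimes> x)"
  show "\<forall>A\<in>rcosets N. A #> gr #> gu = A #> gu #> gr"
  proof
    fix A assume "A \<in> rcosets N"
    then obtain a where a: "a \<in> carrier G" "A = N #> a"
      by (auto simp: RCOSETS_def)
    have swap: "N #> (x \<otimes> y) = N #> (y \<otimes> x)" if "x \<in> carrier G" "y \<in> carrier G" for x y
      using comm that by blast
    have "N #> (a \<otimes> (gr \<otimes> gu)) = N #> ((gr \<otimes> gu) \<otimes> a)"
      using a(1) gr gu by (intro swap) auto
    also have "\<dots> = N #> (gr \<otimes> gu) #> a"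
      using a(1) gr gu N_sub by (simp only: coset_mult_assoc m_closed)
    also have "N #> (gr \<otimes> gu) = N #> (gu \<otimes> gr)"
      using gr gu by (rule swap)
    also have "N #> (gu \<otimes> gr) #> a = N #> ((gu \<otimes> gr) \<otimes> a)"
      using a(1) gr gu N_sub by (simp only: coset_mult_assoc m_closed)
    also have "\<dots> = N #> (a \<otimes> (gu \<otimes> gr))"
      using a(1) gr gu by (intro swap) auto
    finally show "A #> gr #> gu = A #> gu #> gr"
      using a gr gu N_sub by (simp add: coset_mult_assoc m_assoc)
  qed
qed

lemma invariant_function_const:
  assumes inv: "\<And>A. A \<in> rcosets N \<Longrightarrow> d (A #> gr) = d A" "\<And>A. A \<in> rcosets N \<Longrightarrow> d (A #> gu) = d A"
    and AB: "A \<in> rcosets N" "B \<in> rcosets N"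
  shows "d A = d B"
proof -
  have base: "d (N #> g) = d (N #> \<one>)" if "g \<in> carrier G" for g
    using that
  proof (rule generator_induct)
    fix h assume h: "h \<in> carrier G" "d (N #> h) = d (N #> \<one>)"
    then have "N #> h \<in> rcosets N"
      by (auto simp: RCOSETS_def)
    then show "d (N #> (h \<otimes> gr)) = d (N #> \<one>)" "d (N #> (h \<otimes> gu)) = d (N #> \<one>)"
      using inv[of "N #> h"] h gr gu N_sub by (simp_all add: coset_mult_assoc)
  qed simp
  obtain g k where "g \<in> carrier G" "A = N #> g" "k \<in> carrier G" "B = N #> k"
    using AB by (auto simp: RCOSETS_def)
  then show ?thesis
    using base[of g] base[of k] by metis
qed

lemma bij_left_mult:
  assumes n: "n \<in> N"
  shows "bij_betw (\<lambda>A. n <# A) squares squares"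
    and "A \<in> squares \<Longrightarrow> inv_into squares (\<lambda>A. n <# A) A = inv n <# A"
proof -
  have closed: "m <# A \<in> squares" if "m \<in> N" "A \<in> squares" for m A
    using that in_N(1)[OF that(1)] by (elim square_cases) (auto simp: normalizer_coset RCOSETS_def)
  have inverse: "n <# (inv n <# A) = A" "inv n <# (n <# A) = A" if A: "A \<in> squares" for A
    using A in_N(1)[OF n] in_N(2)[OF n] n
    by (auto elim!: square_cases simp: normalizer_coset m_assoc[symmetric])
  show bij: "bij_betw (\<lambda>A. n <# A) squares squares"
    by (rule bij_betw_byWitness[where f' = "\<lambda>A. inv n <# A"])
      (use closed inverse n in_N(2)[OF n] in auto)
  show "inv_into squares (\<lambda>A. n <# A) A = inv n <# A" if A: "A \<in> squares"
    by (rule inv_into_f_eq) (use bij closed inverse A in_N(2)[OF n] in \<open>auto simp: bij_betw_def\<close>)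
qed

lemma left_mult_right_mult:
  assumes "n \<in> N" "A \<in> squares" "g \<in> carrier G"
  shows "n <# (A #> g) = (n <# A) #> g"
  using assms in_N(1)[OF assms(1)] H_sub
  by (auto elim!: square_cases simp: coset_mult_assoc normalizer_coset m_assoc)

text \<open>
  Squares in the same coset of \<open>N\<close> differ by left multiplication with an element of \<open>N\<close>, which only permutes
  the summands.
\<close>
lemma sum_over_normalizer_factors:
  fixes a :: "'a set \<Rightarrow> complex"
  shows "\<exists>\<alpha>. \<forall>A\<in>squares. (\<Sum>n\<in>N. a (inv_into squares (\<lambda>A. n <# A) A)) = \<alpha> (coset_map A)"
proof -
  define av where "av = (\<lambda>A. \<Sum>n\<in>N. a (n <# A))"
  have bij_inv: "bij_betw (\<lambda>n. inv n) N N"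
    by (rule bij_betw_byWitness[where f' = "\<lambda>n. inv n"]) (use in_N in auto)
  have av: "(\<Sum>n\<in>N. a (inv_into squares (\<lambda>A. n <# A) A)) = av A" if "A \<in> squares" for A
    using sum.reindex_bij_betw[OF bij_inv, of "\<lambda>n. a (n <# A)"] that
    by (simp add: av_def bij_left_mult(2) cong: sum.cong)
  have av_const: "av A = av B" if A: "A \<in> squares" and B: "B \<in> squares" and eq: "coset_map A = coset_map B" for A B
  proof -
    obtain g where g: "g \<in> carrier G" "A = H #> g" using A by (rule square_cases)
    obtain k where k: "k \<in> carrier G" "B = H #> k" using B by (rule square_cases)
    have "N #> g = N #> k"
      using eq g k by (simp add: coset_map_eq)
    then have "k \<in> N #> g"
      using rcos_self[OF k(1) N] by simp
    then obtain m where m: "m \<in> N" "k = m \<otimes> g"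
      by (auto simp: r_coset_def)
    have bij_m: "bij_betw (\<lambda>n. n \<otimes> m) N N"
      by (rule bij_betw_byWitness[where f' = "\<lambda>n. n \<otimes> inv m"]) (use in_N m(1) in \<open>auto simp: m_assoc\<close>)
    have "n <# B = (n \<otimes> m) <# A" if "n \<in> N" for n
      using that m g in_N by (simp add: k(2) normalizer_coset m_assoc)
    then have "av B = (\<Sum>n\<in>N. a ((n \<otimes> m) <# A))"
      by (simp add: av_def cong: sum.cong)
    also have "\<dots> = av A"
      unfolding av_def by (rule sum.reindex_bij_betw[OF bij_m])
    finally show ?thesis by simp
  qed
  define \<alpha> where "\<alpha> = (\<lambda>x. av (SOME A. A \<in> squares \<and> coset_map A = x))"
  have "av A = \<alpha> (coset_map A)" if A: "A \<in> squares" for A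
  proof -
    have "(SOME B. B \<in> squares \<and> coset_map B = coset_map A) \<in> squares \<and>
        coset_map (SOME B. B \<in> squares \<and> coset_map B = coset_map A) = coset_map A"
      by (rule someI[of _ A]) (simp add: A)
    then show ?thesis
      unfolding \<alpha>_def using av_const[OF A] by metis
  qed
  with av show ?thesis by metis
qed

text \<open>
  A permutation \<open>\<tau>\<close> that commutes with the two generators commutes with all of \<open>G\<close>. If \<open>\<tau> H = H n\<close>, then
  \<open>H n h = \<tau> (H h) = H n\<close> for \<open>h\<close> in \<open>H\<close>, so \<open>n H \<subseteq> H n\<close>, and equality follows by counting. Hence \<open>n\<close> normalizes
  \<open>H\<close>, and \<open>\<tau>\<close> is left multiplication by \<open>n\<close>.
\<close>
lemma equivariant_permutation_preserves_coset_map: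
  assumes \<tau>: "bij_betw \<tau> squares squares"
    and comm: "\<And>A. A \<in> squares \<Longrightarrow> \<tau> (A #> gr) = \<tau> A #> gr" "\<And>A. A \<in> squares \<Longrightarrow> \<tau> (A #> gu) = \<tau> A #> gu"
    and A: "A \<in> squares"
  shows "coset_map (\<tau> A) = coset_map A"
proof -
  have \<tau>_in: "\<tau> A \<in> squares" if "A \<in> squares" for A
    using that \<tau> by (auto simp: bij_betw_def)
  have H_sq: "H \<in> squares"
    by (rule subgroup.subgroup_in_rcosets[OF H is_group])
  have eqv: "\<tau> (H #> g) = \<tau> H #> g" if "g \<in> carrier G" for g
    using that
  proof (rule generator_induct)
    show "\<tau> (H #> \<one>) = \<tau> H #> \<one>"
      using right_mult_simps(3)[OF H_sq one_closed one_closed] right_mult_simps(3)[OF \<tau>_in[OF H_sq] one_closed one_closed] by simp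
    fix h assume h: "h \<in> carrier G" "\<tau> (H #> h) = \<tau> H #> h"
    have "H #> h \<in> squares"
      using right_mult_simps(1)[OF H_sq h(1) one_closed] .
    then show "\<tau> (H #> (h \<otimes> gr)) = \<tau> H #> (h \<otimes> gr)" "\<tau> (H #> (h \<otimes> gu)) = \<tau> H #> (h \<otimes> gu)"
      using comm[of "H #> h"] h gr gu right_mult_simps(2)[OF H_sq h(1)] right_mult_simps(2)[OF \<tau>_in[OF H_sq] h(1)]
      by simp_all
  qed
  obtain n where n: "n \<in> carrier G" "\<tau> H = H #> n"
    using \<tau>_in[OF H_sq] by (rule square_cases)
  have "n <# H \<subseteq> H #> n"
  proof
    fix x assume "x \<in> n <# H"
    then obtain h where h: "h \<in> H" "x = n \<otimes> h" by (auto simp: l_coset_def)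
    then have hG: "h \<in> carrier G" using H_sub by blast
    have "H #> (n \<otimes> h) = \<tau> H #> h"
      using n hG H_sub by (simp add: coset_mult_assoc)
    also have "\<dots> = \<tau> H"
      using eqv[OF hG] coset_join2[OF hG H h(1)] by simp
    finally have "H #> (n \<otimes> h) = H #> n" by (simp add: n)
    then show "x \<in> H #> n"
      using rcos_self[OF m_closed[OF n(1) hG] H] h(2) by simp
  qed
  moreover have "finite (H #> n)"
    using finite_G r_coset_subset_G[OF H_sub n(1)] finite_subset by blast
  moreover have "card (n <# H) = card (H #> n)"
  proof -
    have "n <# H = (\<lambda>h. n \<otimes> h) ` H" "H #> n = (\<lambda>h. h \<otimes> n) ` H"
      by (auto simp: l_coset_def r_coset_def)
    moreover have "inj_on (\<lambda>h. n \<otimes> h) H" "inj_on (\<lambda>h. h \<otimes> n) H"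
      using n(1) H_sub by (auto simp: inj_on_def subset_iff)
    ultimately show ?thesis
      by (simp add: card_image)
  qed
  ultimately have "n <# H = H #> n"
    by (intro card_subset_eq)
  then have nN: "n \<in> N"
    using n(1) by (simp add: mem_normalizer_iff[OF H_sub])
  obtain g where g: "g \<in> carrier G" "A = H #> g"
    using A by (rule square_cases)
  have "\<tau> A = H #> (n \<otimes> g)"
    using eqv[OF g(1)] n g H_sub by (simp add: coset_mult_assoc)
  then show ?thesis
    using n(1) g N_coset[OF nN g(1)] by (simp add: coset_map_eq)
qed

theorem quasiregular_iff_commuting:
  "quasiregular (origami G gr gu H) \<longleftrightarrow> (\<forall>A\<in>rcosets N. A #> gr #> gu = A #> gu #> gr)"
proof -
  have M: "origami G gr gu H = Q.M"
    by (simp add: origami_def)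
  show ?thesis
    unfolding M quasiregular_iff[OF Q.continuous_map_proj]
  proof (intro iffI ballI impI)
    assume quasi: "\<forall>c\<in>ccycles 1 Q.M. cchain_map 1 origami_proj c \<in> cboundaries 1 torus \<longrightarrow>
      (\<forall>f\<in>origami_aut Q.M. cchain_map 1 f c - c \<in> cboundaries 1 Q.M) \<longrightarrow> c \<in> cboundaries 1 Q.M"
    fix A assume A: "A \<in> rcosets N"
    show "A #> gr #> gu = A #> gu #> gr"
    proof (rule ccontr)
      assume "A #> gr #> gu \<noteq> A #> gu #> gr"
      then obtain a b where ab: "Q.edge_chain (a \<circ> coset_map) (b \<circ> coset_map) \<in> ccycles 1 Q.M"
        "cchain_map 1 origami_proj (Q.edge_chain (a \<circ> coset_map) (b \<circ> coset_map)) \<in> cboundaries 1 torus"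
        "Q.edge_chain (a \<circ> coset_map) (b \<circ> coset_map) \<notin> cboundaries 1 Q.M"
        using Q.exists_nontrivial_quotient_cycle[OF A] by metis
      have "cchain_map 1 f (Q.edge_chain (a \<circ> coset_map) (b \<circ> coset_map)) = Q.edge_chain (a \<circ> coset_map) (b \<circ> coset_map)"
        if f: "f \<in> origami_aut Q.M" for f
      proof -
        obtain \<tau> where \<tau>: "bij_betw \<tau> squares squares"
          "\<And>A. A \<in> squares \<Longrightarrow> \<tau> (A #> gr) = \<tau> A #> gr" "\<And>A. A \<in> squares \<Longrightarrow> \<tau> (A #> gu) = \<tau> A #> gu"
          and f_eq: "\<And>A v. A \<in> squares \<Longrightarrow> v \<in> unit_square \<Longrightarrow> f (Q.pt A v) = Q.pt (\<tau> A) v"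
          using Q.origami_aut_permutes[OF f] by blast
        have "coset_map (inv_into squares \<tau> A) = coset_map A" if "A \<in> squares" for A
          using equivariant_permutation_preserves_coset_map[OF \<tau>, of "inv_into squares \<tau> A"]
            bij_betw_inv_into[OF \<tau>(1)] bij_betw_inv_into_right[OF \<tau>(1) that] that
          by (auto simp: bij_betw_def)
        then have "Q.edge_chain (a \<circ> coset_map \<circ> inv_into squares \<tau>) (b \<circ> coset_map \<circ> inv_into squares \<tau>) =
            Q.edge_chain (a \<circ> coset_map) (b \<circ> coset_map)"
          by (intro Q.edge_chain_cong) simp_all
        moreover have "cchain_map 1 f (Q.edge_chain (a \<circ> coset_map) (b \<circ> coset_map)) =
            Q.edge_chain (a \<circ> coset_map \<circ> inv_into squares \<tau>) (b \<circ> coset_map \<circ> inv_into squares \<tau>)"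
          by (rule Q.map_edge_chain[OF \<tau>(1)]) (rule f_eq)
        ultimately show ?thesis
          by simp
      qed
      then have "\<forall>f\<in>origami_aut Q.M. cchain_map 1 f (Q.edge_chain (a \<circ> coset_map) (b \<circ> coset_map)) -
          Q.edge_chain (a \<circ> coset_map) (b \<circ> coset_map) \<in> cboundaries 1 Q.M"
        by (simp add: cchain.subspace_0[OF subspace_cboundaries])
      with quasi ab show False
        by blast
    qed
  next
    assume comm: "\<forall>A\<in>rcosets N. A #> gr #> gu = A #> gu #> gr"
    fix c assume c: "c \<in> ccycles 1 Q.M" and proj: "cchain_map 1 origami_proj c \<in> cboundaries 1 torus"
      and inv: "\<forall>f\<in>origami_aut Q.M. cchain_map 1 f c - c \<in> cboundaries 1 Q.M"
    have "finite N" "N \<noteq> {}"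
      using finite_subset[OF N_sub finite_G] subgroup.one_closed[OF N] by auto
    then obtain a b where ab: "c - Q.edge_chain (\<lambda>A. \<Sum>n\<in>N. a (inv_into squares (\<lambda>A. n <# A) A))
        (\<lambda>A. \<Sum>n\<in>N. b (inv_into squares (\<lambda>A. n <# A) A)) \<in> cboundaries 1 Q.M"
      using Q.invariant_class_average[OF c, of N "\<lambda>(n :: 'a) (A :: 'a set). n <# A"] inv bij_left_mult(1) left_mult_right_mult gr gu
      by blast
    obtain \<alpha> where \<alpha>: "\<And>A. A \<in> squares \<Longrightarrow> (\<Sum>n\<in>N. a (inv_into squares (\<lambda>A. n <# A) A)) = \<alpha> (coset_map A)"
      using sum_over_normalizer_factors[of a] by blast
    obtain \<beta> where \<beta>: "\<And>A. A \<in> squares \<Longrightarrow> (\<Sum>n\<in>N. b (inv_into squares (\<lambda>A. n <# A) A)) = \<beta> (coset_map A)"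
      using sum_over_normalizer_factors[of b] by blast
    have "Q.edge_chain (\<lambda>A. \<Sum>n\<in>N. a (inv_into squares (\<lambda>A. n <# A) A))
        (\<lambda>A. \<Sum>n\<in>N. b (inv_into squares (\<lambda>A. n <# A) A)) = Q.edge_chain (\<alpha> \<circ> coset_map) (\<beta> \<circ> coset_map)"
      by (rule Q.edge_chain_cong) (simp_all add: \<alpha> \<beta>)
    with ab have "c - Q.edge_chain (\<alpha> \<circ> coset_map) (\<beta> \<circ> coset_map) \<in> cboundaries 1 Q.M"
      by simp
    then show "c \<in> cboundaries 1 Q.M"
      using comm by (intro Q.invariant_cycle_eq_boundary[OF _ _ c _ proj]) (auto intro: invariant_function_const)
  qed
qed

end

theorem theorem1p3:
  fixes G :: "('g, 'b) monoid_scheme" and gr gu :: 'g and H :: "'g set"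
  assumes "group G" and "finite (carrier G)"
    and "gr \<in> carrier G" and "gu \<in> carrier G"
    and "generate G {gr, gu} = carrier G"
    and "subgroup H G"
    and "\<And>K. K \<lhd> G \<Longrightarrow> K \<subseteq> H \<Longrightarrow> K = {\<one>\<^bsub>G\<^esub>}"
  shows "quasiregular (origami G gr gu H) \<longleftrightarrow>
    normalizer G H \<lhd> G \<and> comm_group (G Mod normalizer G H)"
proof -
  interpret group G by fact
  interpret origami_data G gr gu H
    by (intro origami_data.intro origami_data_axioms.intro; fact assms)
  show ?thesis
    unfolding quasiregular_iff_commuting commuting_iff normal_abelian_iff_commuting_cosets[OF N] ..
qed

end
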